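(* Let $\mathfrak a=((\lambda_j,\alpha_j))_{j\in\mathbb Z_+}$ be a sequence in which $(\lambda_j)_{j\in\mathbb Z_+}$ is a strictly increasing sequence of non-negative numbers and the $\alpha_j$ are nonzero matrices in $M_r^+$, and suppose that $(A_1)$ $\sum_{n=1}^{\infty}\sum_{\lambda_j\in\Delta_n}|\lambda_j-\pi n|^2<\infty$, $\ \sup_{n\in\mathbb N}\sum_{\lambda_j\in\Delta_n}1<\infty$, $\ \sum_{n=1}^{\infty}\bigl\|I-\sum_{\lambda_j\in\Delta_n}\alpha_j\bigr\|^2<\infty$. Set $\nu:=\sum_{j=0}^\infty\alpha_j\delta_{\lambda_j}$ and $\nu_0:=\frac12I\delta_0+\sum_{n=1}^\infty I\delta_{\pi n}$. Then the limit $$H_\nu(x):=\lim_{n\to\infty}\int_0^{\pi(n+1/2)}2\cos(2\lambda x)\,d(\nu-\nu_0)(\lambda),\qquad x\in(-1,1),$$ exists in the topology of the space $L_2((-1,1),M_r)$. If, in addition, $(A_3)$ the system of functions $\{d\cos\lambda_jx\mid j\in\mathbb Z_+,\ d\in\operatorname{Ran}\alpha_j\}$ is complete in $L_2$, then $H_\nu$ belongs to $\Re\mathfrak H_2$.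
   Context: Fix $r\in\mathbb N$. $M_r$ is the algebra of $r\times r$ complex matrices with the operator norm and unit $I$; $M_r^+=\{A\in M_r: A=A^*\ge0\}$. $\mathbb Z_+=\{0,1,2,\dots\}$. $L_2=L_2((0,1),\mathbb C^r)$. "Complete" means that the closed linear span is the whole space. $\delta_\lambda$ is the Dirac measure at $\lambda$; the integral is over $[0,\pi(n+1/2)]$, endpoints included. Intervals: $\Delta_0=\{0\}$, $\Delta_1=(0,\tfrac{3\pi}2]$, $\Delta_n=(\pi n-\tfrac\pi2,\pi n+\tfrac\pi2]$ for $n>1$. Sums over $\lambda_j\in\Delta_n$ are sums over all indices $j$ with $\lambda_j\in\Delta_n$. A function $H\in L_2((-1,1),M_r)$ is called an accelerant if it is even ($H(-x)=H(x)$) and if for every $a\in[0,1]$ the integral equation $f(x)+\int_0^aH(x-t)f(t)\,dt=0$, $x\in(0,1)$, has no nontrivial solutions in $L_2$. $\mathfrak H_2$ is the set of all accelerants, and $\Re\mathfrak H_2$ is the subset of those with $H(x)=H(x)^*$ a.e. *)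

theory Defs
  imports "HOL-Probability.Giry_Monad"
begin

text \<open>
  The algebra \<open>M_r\<close> is the type \<open>complex^'r^'r\<close>. Its library norm is the Frobenius norm, so the
  operator norm is introduced separately; the library norm on \<open>complex^'r\<close> is the Euclidean one.
\<close>

definition op_norm :: "complex^'r^'r \<Rightarrow> real" where
  "op_norm A = onorm (\<lambda>v. A *v v)"

definition adj :: "complex^'r^'r \<Rightarrow> complex^'r^'r" where
  "adj A = (\<chi> i j. cnj (A $ j $ i))"

text \<open>
  The library inner product on \<open>complex^'r\<close> is the real part of the Hermitian one; on
  \<open>(A v, v)\<close> with \<open>A\<close> self-adjoint the two coincide.
\<close>

definition psd :: "(complex^'r^'r) set" where
  "psd = {A. adj A = A \<and> (\<forall>v. 0 \<le> (A *v v) \<bullet> v)}"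

text \<open>
  Square integrable functions, with \<open>nrm\<close> the norm on the space of values. Elements are
  functions, not classes: identities in \<open>L_2\<close> are stated almost everywhere.
\<close>

definition L2 :: "('b::euclidean_space \<Rightarrow> real) \<Rightarrow> real set \<Rightarrow> (real \<Rightarrow> 'b) set" where
  "L2 nrm S = {f \<in> borel_measurable (lebesgue_on S).
                 integrable (lebesgue_on S) (\<lambda>x. (nrm (f x))\<^sup>2)}"

definition L2_dist :: "('b::euclidean_space \<Rightarrow> real) \<Rightarrow> real set \<Rightarrow> (real \<Rightarrow> 'b) \<Rightarrow> (real \<Rightarrow> 'b) \<Rightarrow> real"
  where "L2_dist nrm S f g = sqrt (LINT x|lebesgue_on S. (nrm (f x - g x))\<^sup>2)"

definition L2_limit ::
    "('b::euclidean_space \<Rightarrow> real) \<Rightarrow> real set \<Rightarrow> (nat \<Rightarrow> real \<Rightarrow> 'b) \<Rightarrow> (real \<Rightarrow> 'b) \<Rightarrow> bool" where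
  "L2_limit nrm S F f \<longleftrightarrow> (\<forall>n. F n \<in> L2 nrm S) \<and> f \<in> L2 nrm S \<and>
     (\<lambda>n. L2_dist nrm S (F n) f) \<longlonglongrightarrow> 0"

definition complex_span :: "(real \<Rightarrow> complex^'r) set \<Rightarrow> (real \<Rightarrow> complex^'r) set" where
  "complex_span X =
     {g. \<exists>T c. finite T \<and> T \<subseteq> X \<and> g = (\<lambda>x. \<Sum>\<phi>\<in>T. c \<phi> *s \<phi> x)}"

definition complete_in_L2 :: "(real \<Rightarrow> complex^'r) set \<Rightarrow> bool" where
  "complete_in_L2 X \<longleftrightarrow> X \<subseteq> L2 norm {0<..<1} \<and>
     (\<forall>f \<in> L2 norm {0<..<1}. \<forall>e>0. \<exists>g \<in> complex_span X. L2_dist norm {0<..<1} f g < e)"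

definition accelerants :: "(real \<Rightarrow> complex^'r^'r) set" where
  "accelerants = {H \<in> L2 op_norm {-1<..<1}.
     (AE x in lebesgue_on {-1<..<1}. H (- x) = H x) \<and>
     (\<forall>a\<in>{0..1}. \<forall>f \<in> L2 norm {0<..<1}.
        (AE x in lebesgue_on {0<..<1}.
           f x + (LINT t|lebesgue_on {0<..<a}. H (x - t) *v f t) = 0) \<longrightarrow>
        (AE x in lebesgue_on {0<..<1}. f x = 0))}"

definition Re_accelerants :: "(real \<Rightarrow> complex^'r^'r) set" where
  "Re_accelerants = {H \<in> accelerants. AE x in lebesgue_on {-1<..<1}. H x = adj (H x)}"

definition Delta :: "nat \<Rightarrow> real set" where
  "Delta n = (if n = 0 then {0}
              else if n = 1 then {0<..3 * pi / 2}
              else {pi * real n - pi / 2<..pi * real n + pi / 2})"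

text \<open>
  Matrix-valued measures are rendered as set functions; \<open>measure (return borel x)\<close> is the Dirac
  measure at \<open>x\<close>. Both \<open>nu\<close> and \<open>nu0\<close> are only locally finite, and their values are meaningful on
  bounded Borel sets.
\<close>

definition nu :: "(nat \<Rightarrow> real) \<Rightarrow> (nat \<Rightarrow> complex^'r^'r) \<Rightarrow> real set \<Rightarrow> complex^'r^'r" where
  "nu lam alpha B = (\<Sum>j. measure (return borel (lam j)) B *\<^sub>R alpha j)"

definition nu0 :: "real set \<Rightarrow> complex^'r^'r" where
  "nu0 B = (1/2) *\<^sub>R (measure (return borel 0) B *\<^sub>R mat 1) +
           (\<Sum>n. measure (return borel (pi * real (Suc n))) B *\<^sub>R mat 1)"

text \<open>
  The integral over \<open>S\<close> of a bounded Borel function \<open>f\<close> against a vector measure \<open>m\<close>: the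
  common limit of the integrals of simple functions converging to \<open>f\<close> uniformly on \<open>S\<close>. (Such
  simple functions exist for every bounded Borel \<open>f\<close>, so the value is unique.)
\<close>

definition has_vm_integral ::
    "(real set \<Rightarrow> 'b::real_normed_vector) \<Rightarrow> real set \<Rightarrow> (real \<Rightarrow> real) \<Rightarrow> 'b \<Rightarrow> bool" where
  "has_vm_integral m S f I \<longleftrightarrow>
     (\<forall>s. (\<forall>k. simple_function borel (s k)) \<and> uniform_limit S s f sequentially \<longrightarrow>
          (\<lambda>k. \<Sum>y\<in>s k ` S. y *\<^sub>R m (s k -` {y} \<inter> S)) \<longlonglongrightarrow> I)"

definition vm_integral ::
    "(real set \<Rightarrow> 'b::real_normed_vector) \<Rightarrow> real set \<Rightarrow> (real \<Rightarrow> real) \<Rightarrow> 'b" where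
  "vm_integral m S f = (THE I. has_vm_integral m S f I)"

definition H_partial ::
    "(nat \<Rightarrow> real) \<Rightarrow> (nat \<Rightarrow> complex^'r^'r) \<Rightarrow> nat \<Rightarrow> real \<Rightarrow> complex^'r^'r" where
  "H_partial lam alpha n x =
     vm_integral (\<lambda>B. nu lam alpha B - nu0 B) {0..pi * (real n + 1/2)} (\<lambda>l. 2 * cos (2 * l * x))"

definition cos_system ::
    "(nat \<Rightarrow> real) \<Rightarrow> (nat \<Rightarrow> complex^'r^'r) \<Rightarrow> (real \<Rightarrow> complex^'r) set" where
  "cos_system lam alpha =
     {\<lambda>x. complex_of_real (cos (lam j * x)) *s d |j d. d \<in> range (\<lambda>v. alpha j *v v)}"

end

theory Submission
  imports Defs
begin

text \<open>
  Integrating against finitely many point masses turns the partial integrals into trigonometric sums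
  \<open>H_n(x) = (\<Sum>j. 2 cos(2 lam_j x) alpha_j) - D_n(x) I\<close> over \<open>lam_j \<le> pi (n + 1/2)\<close>, with the
  Dirichlet kernel \<open>D_n\<close> of period one. Expanding each cosine to first
  order about \<open>lam_j = pi n\<close>, the \<open>n\<close>-th block becomes \<open>cos(2 pi n x) a_n + x sin(2 pi n x) b_n\<close> up to an
  absolutely summable remainder, with square summable \<open>a_n\<close> and \<open>b_n\<close>; by orthogonality the
  sums are Cauchy in \<open>L_2\<close> (\<open>kern_L2_Cauchy\<close>), and \<open>L_2\<close> is complete. Evenness and
  self-adjointness pass to the limit \<open>H\<close>.

  For the accelerant property, cut a solution on \<open>(0, a)\<close> off at \<open>a\<close>. The result \<open>g\<close> satisfies
  \<open>\<integral> g \<bullet> (g + H * g) = 0\<close>. With \<open>H_n\<close> in place of \<open>H\<close> this form equals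
  \<open>\<parallel>g - S_n g\<parallel>\<^sup>2 + 2 (\<Sum>j. alpha_j c_j \<bullet> c_j + alpha_j s_j \<bullet> s_j)\<close>, where \<open>S_n g\<close> is the Fourier
  partial sum and \<open>c_j\<close>, \<open>s_j\<close> are the cosine and sine coefficients of \<open>g\<close> at frequency
  \<open>2 lam_j\<close> (\<open>quadratic_form_kern\<close>). All terms are nonnegative, so in the limit
  \<open>alpha_j c_j = alpha_j s_j = 0\<close> for every \<open>j\<close>: \<open>g\<close> is annihilated. It follows that
  \<open>H_n * g = - S_n g\<close> exactly on \<open>(0, 1)\<close>, that \<open>g = - H * g\<close> almost everywhere there, and that
  \<open>g\<close> has a continuous representative on \<open>[0, 1]\<close>, the uniform limit of the one-periodic \<open>S_n g\<close>, with
  equal values at \<open>0\<close> and \<open>1\<close>.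

  Completeness of the cosines kills the part of \<open>g\<close> symmetric about \<open>1/2\<close>. Hence \<open>g\<close> is odd about
  \<open>1/2\<close>, and its representative \<open>G\<close> vanishes at both end points
  (\<open>continuous_odd_representative\<close>). The odd part is not tested by the cosines directly. Its
  derivative would be, being symmetric and again annihilated; differentiability is not known, but the
  equation \<open>G = - H * G\<close> bounds the difference quotients of \<open>G\<close> in \<open>L_2\<close>
  (\<open>difference_quotient_bound\<close>). The differences are orthogonal to the complete system.
  Approximating the symmetric primitive of \<open>G\<close> by that system and letting the step tend to zero gives
  \<open>\<integral> \<bar>G\<bar>\<^sup>2 = 0\<close> (\<open>odd_annihilated_eq_0\<close>).
\<close>

section \<open>Matrices and their norms\<close>

lemma norm_matrix_vector_mult_le:
  fixes A :: "complex^'n^'m" and v :: "complex^'n"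
  shows "norm (A *v v) \<le> norm A * norm v"
proof -
  have row: "norm ((A *v v) $ i) \<le> norm (A $ i) * norm v" for i
  proof -
    have "norm ((A *v v) $ i) \<le> (\<Sum>j\<in>UNIV. \<bar>norm (A $ i $ j)\<bar> * \<bar>norm (v $ j)\<bar>)"
      unfolding matrix_vector_mult_def by (auto intro!: order_trans[OF norm_sum] simp: norm_mult)
    also have "\<dots> \<le> L2_set (\<lambda>j. norm (A $ i $ j)) UNIV * L2_set (\<lambda>j. norm (v $ j)) UNIV"
      by (rule L2_set_mult_ineq)
    finally show ?thesis by (simp add: norm_vec_def)
  qed
  have "norm (A *v v) \<le> L2_set (\<lambda>i. norm v * norm (A $ i)) UNIV"
    unfolding norm_vec_def[of "A *v v"] by (intro L2_set_mono) (use row in \<open>auto simp: mult.commute\<close>)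
  also have "\<dots> = norm A * norm v"
    by (simp add: L2_set_right_distrib[symmetric] norm_vec_def[of A] mult.commute)
  finally show ?thesis .
qed

lemma bounded_bilinear_matrix_vector_mult:
  "bounded_bilinear ((*v) :: complex^'n^'m \<Rightarrow> complex^'n \<Rightarrow> complex^'m)"
proof
  show "\<exists>K. \<forall>A v. norm ((A :: complex^'n^'m) *v v) \<le> norm A * norm v * K"
    by (intro exI[of _ 1]) (simp add: norm_matrix_vector_mult_le)
qed (auto simp: matrix_vector_mult_def vec_eq_iff algebra_simps sum.distrib scaleR_sum_right)

interpretation mv: bounded_bilinear "(*v) :: complex^'n^'m \<Rightarrow> complex^'n \<Rightarrow> complex^'m"
  by (rule bounded_bilinear_matrix_vector_mult)

lemma norm_le_op_norm: "norm (A *v v) \<le> op_norm A * norm v"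
  unfolding op_norm_def by (rule onorm[OF mv.bounded_linear_right])

lemma op_norm_le_norm: "op_norm A \<le> norm A"
  unfolding op_norm_def by (rule onorm_le) (rule norm_matrix_vector_mult_le)

lemma op_norm_nonneg: "0 \<le> op_norm A"
  unfolding op_norm_def by (rule onorm_pos_le[OF mv.bounded_linear_right])

lemma norm_entry_le_op_norm:
  fixes A :: "complex^'r^'r"
  shows "norm (A $ i $ j) \<le> op_norm A"
proof -
  have "norm (A $ i $ j) = norm ((A *v axis j 1) $ i)"
    by (simp add: matrix_vector_mult_def axis_def if_distrib if_distribR sum.delta cong: if_cong)
  also have "\<dots> \<le> norm (A *v axis j 1)" by (rule Finite_Cartesian_Product.norm_nth_le)
  also have "\<dots> \<le> op_norm A" using norm_le_op_norm[of A "axis j 1"] by simp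
  finally show ?thesis .
qed

lemma norm_le_card_op_norm:
  fixes A :: "complex^'r^'r"
  shows "norm A \<le> (real CARD('r))\<^sup>2 * op_norm A"
proof -
  have "norm A \<le> (\<Sum>i\<in>UNIV. norm (A $ i))" by (simp add: norm_vec_def L2_set_le_sum)
  also have "\<dots> \<le> (\<Sum>i\<in>(UNIV::'r set). \<Sum>j\<in>(UNIV::'r set). norm (A $ i $ j))"
    by (intro sum_mono) (simp add: norm_vec_def[of "_ $ _"] L2_set_le_sum)
  also have "\<dots> \<le> (\<Sum>i\<in>(UNIV::'r set). \<Sum>j\<in>(UNIV::'r set). op_norm A)"
    by (intro sum_mono norm_entry_le_op_norm)
  finally show ?thesis by (simp add: power2_eq_square)
qed

lemma op_norm_triangle: "op_norm (A + B) \<le> op_norm A + op_norm B"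
  using onorm_triangle[OF mv.bounded_linear_right[of A] mv.bounded_linear_right[of B]]
  by (simp add: op_norm_def mv.add_left)

lemma abs_op_norm_diff_le: "\<bar>op_norm A - op_norm B\<bar> \<le> norm (A - B)"
  using op_norm_triangle[of "A - B" B] op_norm_triangle[of "B - A" A]
    op_norm_le_norm[of "A - B"] op_norm_le_norm[of "B - A"] by (simp add: norm_minus_commute)

lemma continuous_on_op_norm: "continuous_on UNIV (op_norm :: complex^'r^'r \<Rightarrow> real)"
  unfolding continuous_on_iff
proof safe
  fix A :: "complex^'r^'r" and e :: real assume "e > 0"
  then show "\<exists>d>0. \<forall>B\<in>UNIV. dist B A < d \<longrightarrow> dist (op_norm B) (op_norm A) < e"
    by (intro exI[of _ e]) (auto simp: dist_norm intro: le_less_trans[OF abs_op_norm_diff_le])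
qed

lemma borel_measurable_op_norm [measurable]: "op_norm \<in> borel_measurable borel"
  by (rule borel_measurable_continuous_onI[OF continuous_on_op_norm])

lemma inner_matrix_vector_mult:
  fixes A :: "complex^'r^'r"
  shows "(A *v x) \<bullet> y = x \<bullet> (adj A *v y)"
proof -
  have *: "(\<Sum>j\<in>UNIV. a j * z j) \<bullet> w = (\<Sum>j\<in>UNIV. z j \<bullet> (cnj (a j) * w))"
    for a z :: "'r \<Rightarrow> complex" and w
    by (subst inner_sum_left) (auto intro!: sum.cong simp: inner_complex_def algebra_simps)
  have "(A *v x) \<bullet> y = (\<Sum>i\<in>UNIV. \<Sum>j\<in>UNIV. x $ j \<bullet> (cnj (A $ i $ j) * y $ i))"
    by (simp add: inner_vec_def matrix_vector_mult_def *)
  also have "\<dots> = (\<Sum>j\<in>UNIV. \<Sum>i\<in>UNIV. x $ j \<bullet> (cnj (A $ i $ j) * y $ i))" by (rule sum.swap)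
  also have "\<dots> = x \<bullet> (adj A *v y)"
    by (simp add: inner_vec_def matrix_vector_mult_def adj_def inner_sum_right)
  finally show ?thesis .
qed

lemma psd_inner_commute:
  assumes "A \<in> psd" shows "(A *v x) \<bullet> y = x \<bullet> (A *v y)"
  using assms inner_matrix_vector_mult[of A x y] by (simp add: psd_def)

lemma psd_nonneg: "A \<in> psd \<Longrightarrow> 0 \<le> (A *v x) \<bullet> x"
  by (simp add: psd_def)

lemma adj_add: "adj (A + B) = adj A + adj B"
  and adj_diff: "adj (A - B) = adj A - adj B"
  and adj_scaleR: "adj (c *\<^sub>R A) = c *\<^sub>R adj A"
  and adj_zero: "adj 0 = 0"
  and adj_mat_1: "adj (mat 1) = mat 1"
  by (auto simp: adj_def vec_eq_iff mat_def)

lemma adj_sum: "adj (sum f S) = (\<Sum>j\<in>S. adj (f j))"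
  by (induction S rule: infinite_finite_induct) (auto simp: adj_add adj_zero)

lemma bounded_linear_adj: "bounded_linear (adj :: complex^'r^'r \<Rightarrow> complex^'r^'r)"
  by (intro linear_conv_bounded_linear[THEN iffD1] linearI) (auto simp: adj_add adj_scaleR)

lemma psd_sum: "(\<And>j. j \<in> S \<Longrightarrow> f j \<in> psd) \<Longrightarrow> sum f S \<in> psd"
  by (auto simp: psd_def adj_sum mv.sum_left inner_sum_left intro!: sum_nonneg)

text \<open>The Cauchy--Schwarz inequality for a form that may degenerate.\<close>

lemma psd_Cauchy_Schwarz:
  assumes "A \<in> psd"
  shows "((A *v x) \<bullet> y)\<^sup>2 \<le> ((A *v x) \<bullet> x) * ((A *v y) \<bullet> y)"
proof -
  define a where "a = (A *v y) \<bullet> y"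
  define b where "b = (A *v x) \<bullet> y"
  define c where "c = (A *v x) \<bullet> x"
  have "0 \<le> a * t\<^sup>2 + 2 * b * t + c" for t :: real
  proof -
    have "(A *v (x + t *\<^sub>R y)) \<bullet> (x + t *\<^sub>R y) = a * t\<^sup>2 + 2 * b * t + c"
      using psd_inner_commute[OF assms, of y x]
      by (simp add: mv.add_right mv.scaleR_right inner_add_left inner_add_right a_def b_def c_def
          inner_commute algebra_simps power2_eq_square)
    then show ?thesis using psd_nonneg[OF assms, of "x + t *\<^sub>R y"] by simp
  qed
  note q = this
  have "b\<^sup>2 \<le> c * a"
  proof (cases "a = 0")
    case True
    have "b = 0"
    proof (rule ccontr)
      assume "b \<noteq> 0"
      then show False using q[of "- (c + 1) / (2 * b)"] True by simp
    qed
    then show ?thesis using True by simp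
  next
    case False
    then have "a > 0" using psd_nonneg[OF assms, of y] by (simp add: a_def)
    with q[of "- b / a"] show ?thesis
      by (simp add: field_simps power2_eq_square)
  qed
  then show ?thesis by (simp add: a_def b_def c_def)
qed

lemma psd_mult_eq_0:
  assumes "A \<in> psd" "(A *v x) \<bullet> x = 0" shows "A *v x = 0"
  using psd_Cauchy_Schwarz[OF assms(1), of x "A *v x"] assms(2) by simp

text \<open>On nonnegative matrices the operator norm is monotone.\<close>

lemma op_norm_psd_mono:
  assumes A: "A \<in> psd" and BA: "B - A \<in> psd"
  shows "op_norm A \<le> op_norm B"
proof -
  have le: "(A *v x) \<bullet> x \<le> op_norm B * (norm x)\<^sup>2" for x
  proof -
    have "(A *v x) \<bullet> x \<le> (B *v x) \<bullet> x"
      using psd_nonneg[OF BA, of x] by (simp add: mv.diff_left inner_diff_left)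
    also have "\<dots> \<le> norm (B *v x) * norm x" by (rule norm_cauchy_schwarz)
    also have "\<dots> \<le> op_norm B * norm x * norm x" by (intro mult_right_mono norm_le_op_norm) auto
    finally show ?thesis by (simp add: power2_eq_square mult.assoc)
  qed
  show ?thesis unfolding op_norm_def[of A]
  proof (rule onorm_le)
    fix x
    have "((A *v x) \<bullet> (A *v x))\<^sup>2 \<le> ((A *v x) \<bullet> x) * ((A *v (A *v x)) \<bullet> (A *v x))"
      by (rule psd_Cauchy_Schwarz[OF A])
    also have "\<dots> \<le> (op_norm B * (norm x)\<^sup>2) * (op_norm B * (norm (A *v x))\<^sup>2)"
      by (intro mult_mono le psd_nonneg[OF A]) (auto intro!: mult_nonneg_nonneg op_norm_nonneg)
    finally have *: "(norm (A *v x))\<^sup>2 * (norm (A *v x))\<^sup>2 \<le> (op_norm B * norm x)\<^sup>2 * (norm (A *v x))\<^sup>2"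
      by (simp add: dot_square_norm power2_eq_square algebra_simps)
    show "norm (A *v x) \<le> op_norm B * norm x"
    proof (cases "A *v x = 0")
      case True then show ?thesis by (simp add: op_norm_nonneg)
    next
      case False
      then have "(norm (A *v x))\<^sup>2 \<le> (op_norm B * norm x)\<^sup>2"
        using mult_right_le_imp_le[OF *] by simp
      then show ?thesis by (rule power2_le_imp_le) (simp add: op_norm_nonneg)
    qed
  qed
qed

section \<open>Square integrable functions\<close>

text \<open>
  Square integrability and the seminorm of \<open>L_2(M)\<close>, for functions with values in a Euclidean space.
\<close>

definition sqint :: "'a measure \<Rightarrow> ('a \<Rightarrow> 'b::euclidean_space) \<Rightarrow> bool" where
  "sqint M f \<longleftrightarrow> f \<in> borel_measurable M \<and> integrable M (\<lambda>x. (norm (f x))\<^sup>2)"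

definition nrm2 :: "'a measure \<Rightarrow> ('a \<Rightarrow> 'b::euclidean_space) \<Rightarrow> real" where
  "nrm2 M f = sqrt (LINT x|M. (norm (f x))\<^sup>2)"

lemma sqintD: "sqint M f \<Longrightarrow> f \<in> borel_measurable M" "sqint M f \<Longrightarrow> integrable M (\<lambda>x. (norm (f x))\<^sup>2)"
  by (auto simp: sqint_def)

lemma nrm2_nonneg: "0 \<le> nrm2 M f"
  by (simp add: nrm2_def)

lemma nrm2_sq: "(nrm2 M f)\<^sup>2 = (LINT x|M. (norm (f x))\<^sup>2)"
  by (simp add: nrm2_def)

lemma sqint_bound:
  assumes "sqint M f" "g \<in> borel_measurable M" "AE x in M. norm (g x) \<le> norm (f x)"
  shows "sqint M g"
  unfolding sqint_def
proof
  show "integrable M (\<lambda>x. (norm (g x))\<^sup>2)"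
    by (rule Bochner_Integration.integrable_bound[OF sqintD(2)[OF assms(1)]])
      (use assms in \<open>auto intro: power_mono\<close>)
qed fact

lemma nrm2_mono:
  assumes "sqint M f" "g \<in> borel_measurable M" "AE x in M. norm (g x) \<le> norm (f x)"
  shows "nrm2 M g \<le> nrm2 M f"
  unfolding nrm2_def using sqintD(2)[OF sqint_bound[OF assms]] sqintD(2)[OF assms(1)] assms(3)
  by (intro real_sqrt_le_mono integral_mono_AE) (auto intro: power_mono)

lemma sqint_scaleR: "sqint M f \<Longrightarrow> sqint M (\<lambda>x. c *\<^sub>R f x)"
  by (auto simp: sqint_def power_mult_distrib)

lemma nrm2_scaleR: "nrm2 M (\<lambda>x. c *\<^sub>R f x) = \<bar>c\<bar> * nrm2 M f"
  by (simp add: nrm2_def power_mult_distrib real_sqrt_mult)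

lemma sqint_mult_integrable:
  assumes f: "sqint M f" and g: "sqint M g"
  shows "integrable M (\<lambda>x. norm (f x) * norm (g x))"
proof (rule Bochner_Integration.integrable_bound)
  show "integrable M (\<lambda>x. (norm (f x))\<^sup>2 + (norm (g x))\<^sup>2)" using f g by (auto simp: sqint_def)
  have *: "a * b \<le> a\<^sup>2 + b\<^sup>2" if "a \<ge> 0" "b \<ge> 0" for a b :: real
    using sum_squares_bound[of a b] mult_nonneg_nonneg[OF that] by linarith
  show "AE x in M. norm (norm (f x) * norm (g x)) \<le> norm ((norm (f x))\<^sup>2 + (norm (g x))\<^sup>2)"
    using * by (auto simp: abs_mult)
qed (use f g in \<open>auto simp: sqint_def\<close>)

lemma nrm2_Cauchy_Schwarz:
  assumes f: "sqint M f" and g: "sqint M g"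
  shows "(LINT x|M. norm (f x) * norm (g x)) \<le> nrm2 M f * nrm2 M g"
proof -
  note [measurable] = sqintD(1)[OF f] sqintD(1)[OF g]
  have "ennreal ((LINT x|M. norm (f x) * norm (g x))\<^sup>2) = (\<integral>\<^sup>+x. ennreal (norm (f x) * norm (g x)) \<partial>M)\<^sup>2"
    by (subst nn_integral_eq_integral[OF sqint_mult_integrable[OF f g]]) (auto simp: ennreal_power)
  also have "\<dots> = (\<integral>\<^sup>+x. ennreal (norm (f x)) * ennreal (norm (g x)) \<partial>M)\<^sup>2"
    by (simp add: ennreal_mult)
  also have "\<dots> \<le> (\<integral>\<^sup>+x. (ennreal (norm (f x)))\<^sup>2 \<partial>M) * (\<integral>\<^sup>+x. (ennreal (norm (g x)))\<^sup>2 \<partial>M)"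
    by (rule Cauchy_Schwarz_nn_integral) measurable
  also have "\<dots> = ennreal ((nrm2 M f)\<^sup>2) * ennreal ((nrm2 M g)\<^sup>2)"
    using sqintD(2)[OF f] sqintD(2)[OF g]
    by (simp add: ennreal_power nrm2_sq nn_integral_eq_integral)
  finally have "(LINT x|M. norm (f x) * norm (g x))\<^sup>2 \<le> (nrm2 M f * nrm2 M g)\<^sup>2"
    by (simp add: ennreal_mult[symmetric] power_mult_distrib)
  then show ?thesis by (rule power2_le_imp_le) (simp add: nrm2_nonneg)
qed

lemma sqint_inner_integrable:
  assumes f: "sqint M f" and g: "sqint M g"
  shows "integrable M (\<lambda>x. f x \<bullet> g x)"
  by (rule Bochner_Integration.integrable_bound[OF sqint_mult_integrable[OF f g]])
    (use f g in \<open>auto simp: sqint_def abs_mult intro: Cauchy_Schwarz_ineq2\<close>)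

lemma nrm2_inner_le:
  assumes f: "sqint M f" and g: "sqint M g"
  shows "\<bar>LINT x|M. f x \<bullet> g x\<bar> \<le> nrm2 M f * nrm2 M g"
proof -
  have "\<bar>LINT x|M. f x \<bullet> g x\<bar> \<le> (LINT x|M. \<bar>f x \<bullet> g x\<bar>)" by (rule integral_abs_bound)
  also have "\<dots> \<le> (LINT x|M. norm (f x) * norm (g x))"
    by (intro integral_mono Bochner_Integration.integrable_abs sqint_inner_integrable
        sqint_mult_integrable f g Cauchy_Schwarz_ineq2)
  finally show ?thesis using nrm2_Cauchy_Schwarz[OF f g] by simp
qed

lemma sqint_add:
  assumes f: "sqint M f" and g: "sqint M g"
  shows "sqint M (\<lambda>x. f x + g x)"
proof -
  have "integrable M (\<lambda>x. (norm (f x))\<^sup>2 + 2 * (f x \<bullet> g x) + (norm (g x))\<^sup>2)"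
    using f g sqint_inner_integrable[OF f g] by (auto simp: sqint_def)
  moreover have "(norm (f x + g x))\<^sup>2 = (norm (f x))\<^sup>2 + 2 * (f x \<bullet> g x) + (norm (g x))\<^sup>2" for x
    by (simp add: power2_norm_eq_inner inner_add_left inner_add_right inner_commute)
  ultimately show ?thesis using f g by (auto simp: sqint_def)
qed

lemma sqint_diff: "sqint M f \<Longrightarrow> sqint M g \<Longrightarrow> sqint M (\<lambda>x. f x - g x)"
  using sqint_add[of M f "\<lambda>x. (-1) *\<^sub>R g x"] sqint_scaleR[of M g "-1"] by simp

lemma sqint_sum: "(\<And>i. i \<in> I \<Longrightarrow> sqint M (f i)) \<Longrightarrow> sqint M (\<lambda>x. \<Sum>i\<in>I. f i x)"
proof (induction I rule: infinite_finite_induct)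
  case (insert i I)
  then show ?case by (auto intro: sqint_add)
qed (auto simp: sqint_def)

lemma nrm2_triangle:
  assumes f: "sqint M f" and g: "sqint M g"
  shows "nrm2 M (\<lambda>x. f x + g x) \<le> nrm2 M f + nrm2 M g"
proof -
  have "(norm (f x + g x))\<^sup>2 = (norm (f x))\<^sup>2 + 2 * (f x \<bullet> g x) + (norm (g x))\<^sup>2" for x
    by (simp add: power2_norm_eq_inner inner_add_left inner_add_right inner_commute)
  then have "(nrm2 M (\<lambda>x. f x + g x))\<^sup>2 = (nrm2 M f)\<^sup>2 + 2 * (LINT x|M. f x \<bullet> g x) + (nrm2 M g)\<^sup>2"
    using f g sqint_inner_integrable[OF f g] by (simp add: nrm2_sq sqint_def)
  also have "\<dots> \<le> (nrm2 M f + nrm2 M g)\<^sup>2"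
    using nrm2_inner_le[OF f g] by (simp add: power2_sum)
  finally show ?thesis by (rule power2_le_imp_le) (simp add: nrm2_nonneg)
qed

lemma nrm2_triangle_diff:
  assumes f: "sqint M f" and g: "sqint M g"
  shows "nrm2 M (\<lambda>x. f x - g x) \<le> nrm2 M f + nrm2 M g"
  using nrm2_triangle[OF f sqint_scaleR[OF g, of "-1"]] nrm2_scaleR[of M "-1" g] by simp

lemma nrm2_eq_0_AE:
  assumes "sqint M f" "nrm2 M f = 0" shows "AE x in M. f x = 0"
proof -
  have "(LINT x|M. (norm (f x))\<^sup>2) = 0" using assms(2) by (simp add: nrm2_def)
  then have "AE x in M. (norm (f x))\<^sup>2 = 0"
    using integral_nonneg_eq_0_iff_AE[OF sqintD(2)[OF assms(1)]] by simp
  then show ?thesis by simp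
qed

lemma (in finite_measure) sqint_bounded:
  assumes "f \<in> borel_measurable M" "AE x in M. norm (f x) \<le> B"
  shows "sqint M f"
  unfolding sqint_def
proof
  show "integrable M (\<lambda>x. (norm (f x))\<^sup>2)"
  proof (rule integrable_const_bound)
    show "AE x in M. norm ((norm (f x))\<^sup>2) \<le> B\<^sup>2"
      using assms(2) by eventually_elim (auto intro: power_mono)
  qed (use assms in auto)
qed fact

lemma (in finite_measure) sqint_integrable:
  assumes "sqint M f" shows "integrable M f"
proof -
  have "sqint M (\<lambda>_. 1::real)" by (rule sqint_bounded[of _ 1]) auto
  from sqint_mult_integrable[OF assms this] sqintD(1)[OF assms] show ?thesis
    by (auto simp: integrable_norm_iff)
qed

lemma (in finite_measure) integral_norm_le_nrm2:
  assumes "sqint M f" shows "(LINT x|M. norm (f x)) \<le> nrm2 M f * sqrt (measure M (space M))"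
proof -
  have "sqint M (\<lambda>_. 1::real)" by (rule sqint_bounded[of _ 1]) auto
  from nrm2_Cauchy_Schwarz[OF assms this] show ?thesis by (simp add: nrm2_def)
qed

text \<open>The Riesz--Fischer theorem on a finite measure space.\<close>

lemma (in finite_measure) sqint_complete:
  fixes F :: "nat \<Rightarrow> 'a \<Rightarrow> 'b::euclidean_space"
  assumes F: "\<And>n. sqint M (F n)"
    and Cauchy: "\<And>e. e > 0 \<Longrightarrow> \<exists>N. \<forall>m\<ge>N. \<forall>n\<ge>N. nrm2 M (\<lambda>x. F m x - F n x) < e"
  shows "\<exists>f. sqint M f \<and> (\<lambda>n. nrm2 M (\<lambda>x. F n x - f x)) \<longlonglongrightarrow> 0"
proof -
  note [measurable] = sqintD(1)[OF F]
  have "\<exists>r. \<forall>n. (\<forall>m\<ge>r n. \<forall>k\<ge>r n. nrm2 M (\<lambda>x. F m x - F k x) < (1/2)^n) \<and> r (Suc n) > r n"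
  proof (rule dependent_nat_choice)
    show "\<exists>N. \<forall>m\<ge>N. \<forall>k\<ge>N. nrm2 M (\<lambda>x. F m x - F k x) < (1/2)^0" by (rule Cauchy) simp
    fix R n
    obtain N where "\<forall>m\<ge>N. \<forall>k\<ge>N. nrm2 M (\<lambda>x. F m x - F k x) < (1/2)^Suc n"
      using Cauchy[of "(1/2)^Suc n"] by auto
    then show "\<exists>N. (\<forall>m\<ge>N. \<forall>k\<ge>N. nrm2 M (\<lambda>x. F m x - F k x) < (1/2)^Suc n) \<and> N > R"
      by (intro exI[of _ "max N (Suc R)"]) auto
  qed
  then obtain r where r: "\<And>n m k. m \<ge> r n \<Longrightarrow> k \<ge> r n \<Longrightarrow> nrm2 M (\<lambda>x. F m x - F k x) < (1/2)^n"
    and rmono: "strict_mono r" by (auto simp: strict_mono_Suc_iff)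
  define u where "u k x = F (r (Suc k)) x - F (r k) x" for k x
  have [measurable]: "u k \<in> borel_measurable M" for k unfolding u_def by measurable
  have u: "sqint M (u k)" for k unfolding u_def by (intro sqint_diff F)
  define c where "c = sqrt (measure M (space M))"
  have nu: "(\<integral>\<^sup>+x. ennreal (norm (u k x)) \<partial>M) \<le> ennreal (c * (1/2)^k)" for k
  proof -
    have "(LINT x|M. norm (u k x)) \<le> nrm2 M (u k) * c"
      unfolding c_def by (rule integral_norm_le_nrm2[OF u])
    also have "\<dots> \<le> (1/2)^k * c"
      unfolding u_def using r[of k "r (Suc k)" "r k"] rmono
      by (intro mult_right_mono) (auto simp: c_def strict_mono_def less_imp_le)
    finally show ?thesis
      using sqint_integrable[OF u[of k]] by (simp add: nn_integral_eq_integral mult.commute ennreal_leI)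
  qed
  have "(\<integral>\<^sup>+x. (\<Sum>k. ennreal (norm (u k x))) \<partial>M) = (\<Sum>k. \<integral>\<^sup>+x. ennreal (norm (u k x)) \<partial>M)"
    by (rule nn_integral_suminf) measurable
  also have "\<dots> \<le> (\<Sum>k. ennreal (c * (1/2)^k))" by (intro suminf_le nu) auto
  also have "\<dots> = ennreal (\<Sum>k. c * (1/2)^k)"
    by (intro suminf_ennreal2 summable_mult summable_geometric) (auto simp: c_def)
  finally have "(\<integral>\<^sup>+x. (\<Sum>k. ennreal (norm (u k x))) \<partial>M) \<noteq> \<infinity>"
    by (metis ennreal_less_top infinity_ennreal_def leD)
  then have "AE x in M. (\<Sum>k. ennreal (norm (u k x))) \<noteq> \<infinity>"
    by (intro nn_integral_PInf_AE) auto
  then have conv: "AE x in M. convergent (\<lambda>k. F (r k) x)"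
  proof eventually_elim
    case (elim x)
    then have "summable (\<lambda>k. norm (u k x))" by (intro summable_suminf_not_top) auto
    then have "convergent (\<lambda>k. F (r 0) x + (\<Sum>i<k. u i x))"
      using summable_norm_cancel[of "\<lambda>k. u k x"] by (auto simp: summable_iff_convergent convergent_add convergent_const)
    moreover have "F (r 0) x + (\<Sum>i<k. u i x) = F (r k) x" for k
      unfolding u_def sum_lessThan_telescope[of "\<lambda>k. F (r k) x"] by simp
    ultimately show ?case by simp
  qed
  define f where "f x = lim (\<lambda>k. F (r k) x)" for x
  have [measurable]: "f \<in> borel_measurable M" unfolding f_def by measurable
  have bound: "(\<integral>\<^sup>+x. ennreal ((norm (F n x - f x))\<^sup>2) \<partial>M) \<le> ennreal (((1/2)^k)\<^sup>2)" if "n \<ge> r k" for n k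
  proof -
    have "(\<integral>\<^sup>+x. ennreal ((norm (F n x - f x))\<^sup>2) \<partial>M)
        = (\<integral>\<^sup>+x. liminf (\<lambda>m. ennreal ((norm (F n x - F (r m) x))\<^sup>2)) \<partial>M)"
    proof (intro nn_integral_cong_AE)
      show "AE x in M. ennreal ((norm (F n x - f x))\<^sup>2) = liminf (\<lambda>m. ennreal ((norm (F n x - F (r m) x))\<^sup>2))"
        using conv
      proof eventually_elim
        case (elim x)
        then have "(\<lambda>m. F (r m) x) \<longlonglongrightarrow> f x" by (simp add: f_def convergent_LIMSEQ_iff)
        then have "(\<lambda>m. ennreal ((norm (F n x - F (r m) x))\<^sup>2)) \<longlonglongrightarrow> ennreal ((norm (F n x - f x))\<^sup>2)"
          by (intro tendsto_intros)
        then show ?case by (rule lim_imp_Liminf[OF sequentially_bot, symmetric])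
      qed
    qed
    also have "\<dots> \<le> liminf (\<lambda>m. \<integral>\<^sup>+x. ennreal ((norm (F n x - F (r m) x))\<^sup>2) \<partial>M)"
      by (rule nn_integral_liminf) measurable
    also have "\<dots> \<le> limsup (\<lambda>m. \<integral>\<^sup>+x. ennreal ((norm (F n x - F (r m) x))\<^sup>2) \<partial>M)"
      by (rule Liminf_le_Limsup) simp
    also have "\<dots> \<le> ennreal (((1/2)^k)\<^sup>2)"
    proof (rule Limsup_bounded)
      show "\<forall>\<^sub>F m in sequentially. (\<integral>\<^sup>+x. ennreal ((norm (F n x - F (r m) x))\<^sup>2) \<partial>M) \<le> ennreal (((1/2)^k)\<^sup>2)"
        using eventually_ge_at_top[of k]
      proof eventually_elim
        case (elim m)
        have "r m \<ge> r k" using elim rmono by (simp add: strict_mono_less_eq)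
        then have "nrm2 M (\<lambda>x. F n x - F (r m) x) < (1/2)^k" by (intro r that)
        then have "(nrm2 M (\<lambda>x. F n x - F (r m) x))\<^sup>2 \<le> ((1/2)^k)\<^sup>2"
          by (intro power_mono) (auto simp: nrm2_nonneg)
        then show ?case
          using sqintD(2)[OF sqint_diff[OF F[of n] F[of "r m"]]]
          by (simp add: nn_integral_eq_integral nrm2_sq ennreal_leI)
      qed
    qed
    finally show ?thesis .
  qed
  have d: "sqint M (\<lambda>x. F n x - f x) \<and> nrm2 M (\<lambda>x. F n x - f x) \<le> (1/2)^k" if "n \<ge> r k" for n k
  proof
    show s: "sqint M (\<lambda>x. F n x - f x)" unfolding sqint_def
    proof
      show "integrable M (\<lambda>x. (norm (F n x - f x))\<^sup>2)"
      proof (rule integrableI_nonneg)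
        show "(\<integral>\<^sup>+x. ennreal ((norm (F n x - f x))\<^sup>2) \<partial>M) < \<infinity>"
          using bound[OF that] by (rule le_less_trans) simp
      qed auto
    qed auto
    have "ennreal ((nrm2 M (\<lambda>x. F n x - f x))\<^sup>2) \<le> ennreal (((1/2)^k)\<^sup>2)"
      using bound[OF that] sqintD(2)[OF s] by (simp add: nn_integral_eq_integral nrm2_sq)
    then have "(nrm2 M (\<lambda>x. F n x - f x))\<^sup>2 \<le> ((1/2)^k)\<^sup>2" by (subst (asm) ennreal_le_iff) auto
    then show "nrm2 M (\<lambda>x. F n x - f x) \<le> (1/2)^k" by (rule power2_le_imp_le) simp
  qed
  show ?thesis
  proof (intro exI conjI)
    show "sqint M f" using sqint_diff[OF F[of "r 0"] conjunct1[OF d[of 0 "r 0"]]] by simp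
    show "(\<lambda>n. nrm2 M (\<lambda>x. F n x - f x)) \<longlonglongrightarrow> 0"
    proof (rule LIMSEQ_I)
      fix e :: real assume "e > 0"
      then obtain k where "(1/2::real)^k < e" using real_arch_pow_inv[of e "1/2"] by auto
      then show "\<exists>N. \<forall>n\<ge>N. norm (nrm2 M (\<lambda>x. F n x - f x) - 0) < e"
        using d[of k] by (intro exI[of _ "r k"]) (force simp: nrm2_nonneg)
    qed
  qed
qed

section \<open>The integrals over the intervals as trigonometric sums\<close>

lemma simple_function_uniform_approx:
  fixes f :: "real \<Rightarrow> real"
  assumes f: "f \<in> borel_measurable borel" and bdd: "\<And>x. \<bar>f x\<bar> \<le> c"
  shows "\<exists>s. (\<forall>k. simple_function borel (s k)) \<and> uniform_limit S s f sequentially"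
proof -
  define s where "s k x = of_int \<lfloor>real (Suc k) * f x\<rfloor> / real (Suc k)" for k x
  have near: "\<bar>s k x - f x\<bar> \<le> 1 / real (Suc k)" for k x
  proof -
    have "\<bar>of_int \<lfloor>real (Suc k) * f x\<rfloor> - real (Suc k) * f x\<bar> \<le> 1" by linarith
    moreover have "s k x - f x = (of_int \<lfloor>real (Suc k) * f x\<rfloor> - real (Suc k) * f x) / real (Suc k)"
      by (simp add: s_def field_simps)
    ultimately show ?thesis by (simp add: abs_divide divide_right_mono)
  qed
  have "simple_function borel (s k)" for k
  proof (rule simple_function_borel_measurable)
    show "s k \<in> borel_measurable borel" unfolding s_def using f by measurable
    define K where "K = real (Suc k) * c"
    have "\<bar>real (Suc k) * f x\<bar> \<le> K" for x
      unfolding K_def abs_mult using bdd[of x] by (intro mult_mono) auto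
    then have "\<lfloor>real (Suc k) * f x\<rfloor> \<in> {\<lfloor>-K\<rfloor>..\<lfloor>K\<rfloor>}" for x
      by (auto intro!: floor_mono simp: abs_le_iff) (smt (verit))
    then have "s k ` space borel \<subseteq> (\<lambda>i. of_int i / real (Suc k)) ` {\<lfloor>-K\<rfloor>..\<lfloor>K\<rfloor>}"
      by (auto simp: s_def)
    then show "finite (s k ` space borel)" by (rule finite_subset) auto
  qed
  moreover have "uniform_limit S s f sequentially"
  proof (rule uniform_limitI)
    fix e :: real assume "e > 0"
    then have "\<forall>\<^sub>F k in sequentially. 1 / real (Suc k) < e"
      using order_tendstoD(2)[OF LIMSEQ_inverse_real_of_nat] by (simp add: inverse_eq_divide)
    then show "\<forall>\<^sub>F k in sequentially. \<forall>x\<in>S. dist (s k x) (f x) < e"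
      by eventually_elim (auto simp: dist_real_def intro: le_less_trans[OF near])
  qed
  ultimately show ?thesis by blast
qed

text \<open>Against finitely many point masses, the vector integral is a finite sum.\<close>

lemma vm_integral_point_masses:
  fixes m :: "real set \<Rightarrow> 'b::real_normed_vector" and f :: "real \<Rightarrow> real"
  assumes fin: "finite F" and S: "S \<in> sets borel" and p: "\<And>i. i \<in> F \<Longrightarrow> p i \<in> S"
    and m: "\<And>B. B \<in> sets borel \<Longrightarrow> B \<subseteq> S \<Longrightarrow> m B = (\<Sum>i\<in>F. indicator B (p i) *\<^sub>R a i)"
    and f: "f \<in> borel_measurable borel" and bdd: "\<And>x. \<bar>f x\<bar> \<le> c"
  shows "vm_integral m S f = (\<Sum>i\<in>F. f (p i) *\<^sub>R a i)"
proof -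
  have lim: "(\<lambda>k. \<Sum>y\<in>s k ` S. y *\<^sub>R m (s k -` {y} \<inter> S)) \<longlonglongrightarrow> (\<Sum>i\<in>F. f (p i) *\<^sub>R a i)"
    if s: "\<And>k. simple_function borel (s k)" and ul: "uniform_limit S s f sequentially"
    for s :: "nat \<Rightarrow> real \<Rightarrow> real"
  proof -
    have eq: "(\<Sum>y\<in>s k ` S. y *\<^sub>R m (s k -` {y} \<inter> S)) = (\<Sum>i\<in>F. s k (p i) *\<^sub>R a i)" for k
    proof -
      have finS: "finite (s k ` S)"
        using simple_functionD(1)[OF s[of k]] by (rule rev_finite_subset) auto
      have meas: "s k -` {y} \<inter> S \<in> sets borel" for y
        using simple_functionD(2)[OF s[of k], of "{y}"] S by auto
      have "(\<Sum>y\<in>s k ` S. y *\<^sub>R m (s k -` {y} \<inter> S))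
          = (\<Sum>y\<in>s k ` S. \<Sum>i\<in>F. (y * indicator (s k -` {y} \<inter> S) (p i)) *\<^sub>R a i)"
        by (simp add: m[OF meas] scaleR_sum_right)
      also have "\<dots> = (\<Sum>i\<in>F. (\<Sum>y\<in>s k ` S. y * indicator (s k -` {y} \<inter> S) (p i)) *\<^sub>R a i)"
        by (subst sum.swap) (simp add: scaleR_sum_left)
      also have "\<dots> = (\<Sum>i\<in>F. s k (p i) *\<^sub>R a i)"
      proof (intro sum.cong refl)
        fix i assume i: "i \<in> F"
        have "(\<Sum>y\<in>s k ` S. y * indicator (s k -` {y} \<inter> S) (p i))
            = (\<Sum>y\<in>s k ` S. if y = s k (p i) then y else 0)"
          using p[OF i] by (intro sum.cong) (auto simp: indicator_def)
        also have "\<dots> = s k (p i)" using finS p[OF i] by simp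
        finally show "(\<Sum>y\<in>s k ` S. y * indicator (s k -` {y} \<inter> S) (p i)) *\<^sub>R a i = s k (p i) *\<^sub>R a i"
          by simp
      qed
      finally show ?thesis .
    qed
    show ?thesis unfolding eq
      by (intro tendsto_sum tendsto_scaleR tendsto_const tendsto_uniform_limitI[OF ul] p)
  qed
  obtain s where s: "\<And>k. simple_function borel (s k)" "uniform_limit S s f sequentially"
    using simple_function_uniform_approx[OF f bdd] by blast
  show ?thesis unfolding vm_integral_def
  proof (rule the_equality)
    show "has_vm_integral m S f (\<Sum>i\<in>F. f (p i) *\<^sub>R a i)"
      unfolding has_vm_integral_def using lim by blast
    fix I assume "has_vm_integral m S f I"
    then have "(\<lambda>k. \<Sum>y\<in>s k ` S. y *\<^sub>R m (s k -` {y} \<inter> S)) \<longlonglongrightarrow> I"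
      using s unfolding has_vm_integral_def by blast
    then show "I = (\<Sum>i\<in>F. f (p i) *\<^sub>R a i)" using lim[OF s] by (rule LIMSEQ_unique)
  qed
qed

text \<open>For nonnegative \<open>lam\<close>, the indices of the points in the \<open>n\<close>-th interval of integration.\<close>

definition upto_ix :: "(nat \<Rightarrow> real) \<Rightarrow> nat \<Rightarrow> nat set" where
  "upto_ix lam n = {j. lam j \<le> pi * (real n + 1/2)}"

text \<open>From \<open>n = 1\<close> on, the intervals grow exactly by the blocks; the irregular \<open>Delta 1\<close> ends at \<open>3 pi / 2\<close>.\<close>

lemma upto_ix_Suc:
  assumes "n \<ge> 1"
  shows "upto_ix lam (Suc n) = upto_ix lam n \<union> {j. lam j \<in> Delta (Suc n)}"
    "upto_ix lam n \<inter> {j. lam j \<in> Delta (Suc n)} = {}"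
  using assms by (auto simp: upto_ix_def Delta_def algebra_simps) (use pi_gt_zero in linarith)

lemma finite_upto_ix:
  assumes inj: "inj lam" and nonneg: "\<And>j. 0 \<le> lam j"
    and fin: "\<And>n. n \<ge> 1 \<Longrightarrow> finite {j. lam j \<in> Delta n}"
  shows "finite (upto_ix lam n)"
proof -
  have z: "finite {j. lam j = 0}"
    using finite_vimageI[OF _ inj, of "{0}"] by (simp add: vimage_def)
  have "lam j = 0 \<or> lam j \<in> Delta 1" if "lam j \<le> 3 * pi / 2" for j
    using nonneg[of j] that by (auto simp: Delta_def)
  then have "upto_ix lam 1 \<subseteq> {j. lam j = 0} \<union> {j. lam j \<in> Delta 1}"
    by (force simp: upto_ix_def simp del: One_nat_def)
  then have "finite (upto_ix lam 1)" by (rule finite_subset) (use z fin[of 1] in \<open>simp only: finite_Un order_refl simp_thms\<close>)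
  then have *: "finite (upto_ix lam (Suc n))" for n
  proof (induction n)
    case (Suc n)
    then show ?case using upto_ix_Suc(1)[of "Suc n" lam] fin[of "Suc (Suc n)"] by simp
  qed simp
  have "upto_ix lam n \<subseteq> upto_ix lam (Suc n)"
    by (auto simp: upto_ix_def intro: order_trans)
  then show ?thesis by (rule finite_subset) (rule *)
qed

text \<open>
  The kernel with point masses \<open>alpha j\<close> at \<open>lam j\<close>, \<open>j \<in> J\<close>, minus the Dirichlet kernel
  of period one.
\<close>

definition kern :: "(nat \<Rightarrow> real) \<Rightarrow> (nat \<Rightarrow> complex^'r^'r) \<Rightarrow> nat set \<Rightarrow> nat \<Rightarrow> real \<Rightarrow> complex^'r^'r" where
  "kern lam alpha J n x = (\<Sum>j\<in>J. (2 * cos (2 * lam j * x)) *\<^sub>R alpha j)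
     - (1 + (\<Sum>k=1..n. 2 * cos (2 * pi * real k * x))) *\<^sub>R mat 1"

lemma H_partial_eq_kern:
  fixes alpha :: "nat \<Rightarrow> complex^'r^'r"
  assumes fin: "finite (upto_ix lam n)" and nonneg: "\<And>j. 0 \<le> lam j"
  shows "H_partial lam alpha n x = kern lam alpha (upto_ix lam n) n x"
proof -
  define S where "S = {0..pi * (real n + 1/2)}"
  \<comment> \<open>The left summand indexes the points of \<open>nu\<close>, the right one those of \<open>nu0\<close>, where \<open>0\<close> has weight \<open>1/2\<close>.\<close>
  define p where "p i = (case i of Inl j \<Rightarrow> lam j | Inr k \<Rightarrow> pi * real (k::nat))" for i :: "nat + nat"
  define a where "a i = (case i of Inl j \<Rightarrow> alpha j | Inr k \<Rightarrow> - ((if k = 0 then 1/2 else 1::real) *\<^sub>R mat 1))"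
    for i :: "nat + nat"
  have S: "S \<in> sets borel" by (simp add: S_def)
  have split: "(\<Sum>i\<in>upto_ix lam n <+> {0..n}. g i)
      = (\<Sum>j\<in>upto_ix lam n. g (Inl j)) + (g (Inr 0) + (\<Sum>k<n. g (Inr (Suc k))))"
    for g :: "nat + nat \<Rightarrow> complex^'r^'r"
    using fin by (simp add: sum.Plus atLeast0AtMost sum.atMost_shift)
  have m: "nu lam alpha B - nu0 B = (\<Sum>i\<in>upto_ix lam n <+> {0..n}. indicator B (p i) *\<^sub>R a i)"
    if B: "B \<in> sets borel" and BS: "B \<subseteq> S" for B
  proof -
    have "nu lam alpha B = (\<Sum>j\<in>upto_ix lam n. indicator B (lam j) *\<^sub>R alpha j)"
      unfolding nu_def using BS fin
      by (subst suminf_finite[OF fin]) (auto simp: measure_return[OF B] S_def upto_ix_def indicator_def)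
    moreover have "(\<Sum>k. Sigma_Algebra.measure (return borel (pi * real (Suc k))) B *\<^sub>R mat 1)
        = (\<Sum>k<n. indicator B (pi * real (Suc k)) *\<^sub>R (mat 1 :: complex^'r^'r))"
    proof (subst suminf_finite[of "{..<n}"])
      fix k assume "k \<notin> {..<n}"
      then have "real n + 1/2 < real (Suc k)" by simp
      then have "pi * (real n + 1/2) < pi * real (Suc k)" by (intro mult_strict_left_mono) auto
      then have "pi * real (Suc k) \<notin> B" using BS by (auto simp: S_def)
      then show "Sigma_Algebra.measure (return borel (pi * real (Suc k))) B *\<^sub>R (mat 1 :: complex^'r^'r) = 0"
        by (simp add: measure_return[OF B])
    qed (auto simp: measure_return[OF B])
    ultimately have "nu lam alpha B - nu0 B = (\<Sum>j\<in>upto_ix lam n. indicator B (lam j) *\<^sub>R alpha j)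
        - ((1/2) *\<^sub>R (indicator B 0 *\<^sub>R mat 1) + (\<Sum>k<n. indicator B (pi * real (Suc k)) *\<^sub>R mat 1))"
      by (simp add: nu0_def measure_return[OF B])
    also have "\<dots> = (\<Sum>i\<in>upto_ix lam n <+> {0..n}. indicator B (p i) *\<^sub>R a i)"
      unfolding split by (simp add: p_def a_def sum_negf scaleR_minus_right del: sum_indicator_mult)
    finally show ?thesis .
  qed
  have "H_partial lam alpha n x = (\<Sum>i\<in>upto_ix lam n <+> {0..n}. (2 * cos (2 * p i * x)) *\<^sub>R a i)"
    unfolding H_partial_def S_def[symmetric]
  proof (rule vm_integral_point_masses[OF _ S _ m])
    show "finite (upto_ix lam n <+> {0..n})" using fin by simp
    show "p i \<in> S" if "i \<in> upto_ix lam n <+> {0..n}" for i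
      using that nonneg by (auto simp: p_def S_def upto_ix_def intro!: mult_left_mono)
    show "\<bar>2 * cos (2 * l * x)\<bar> \<le> 2" for l :: real by (simp add: abs_mult)
  qed auto
  also have "\<dots> = kern lam alpha (upto_ix lam n) n x"
    unfolding split by (simp add: p_def a_def kern_def
        sum_negf scaleR_minus_right scaleR_sum_left scaleR_add_left sum.atLeast1_atMost_eq mult.assoc)
  finally show ?thesis .
qed

section \<open>Orthogonality of the trigonometric functions\<close>

lemma integral_cos_period:
  fixes a b k :: int assumes "a \<le> b"
  shows "integral {real_of_int a..real_of_int b} (\<lambda>x. cos (2 * pi * real_of_int k * x))
    = (if k = 0 then real_of_int (b - a) else 0)"
proof (cases "k = 0")
  case False
  have "((\<lambda>x. cos (2 * pi * real_of_int k * x)) has_integral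
      (sin (2 * pi * real_of_int k * real_of_int b) / (2 * pi * real_of_int k) -
       sin (2 * pi * real_of_int k * real_of_int a) / (2 * pi * real_of_int k))) {real_of_int a..real_of_int b}"
    using assms False
    by (intro fundamental_theorem_of_calculus)
      (auto intro!: derivative_eq_intros simp: has_real_derivative_iff_has_vector_derivative[symmetric])
  then show ?thesis
    using False sin_int_2pin[of "k * b"] sin_int_2pin[of "k * a"]
    by (auto dest: integral_unique simp: mult.assoc)
qed (use assms in simp)

lemma integral_sin_period:
  fixes a b k :: int assumes "a \<le> b"
  shows "integral {real_of_int a..real_of_int b} (\<lambda>x. sin (2 * pi * real_of_int k * x)) = 0"
proof (cases "k = 0")
  case False
  have "((\<lambda>x. sin (2 * pi * real_of_int k * x)) has_integral
      (- cos (2 * pi * real_of_int k * real_of_int b) / (2 * pi * real_of_int k) -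
       - cos (2 * pi * real_of_int k * real_of_int a) / (2 * pi * real_of_int k))) {real_of_int a..real_of_int b}"
    using assms False
    by (intro fundamental_theorem_of_calculus)
      (auto intro!: derivative_eq_intros simp: has_real_derivative_iff_has_vector_derivative[symmetric])
  then show ?thesis
    using False cos_int_2pin[of "k * b"] cos_int_2pin[of "k * a"]
    by (auto dest: integral_unique simp: mult.assoc)
qed simp

lemma integral_trig_products:
  fixes a b :: int and k m :: nat assumes "a \<le> b"
  shows integral_cos_cos: "integral {real_of_int a..real_of_int b} (\<lambda>x. cos (2 * pi * real k * x) * cos (2 * pi * real m * x))
      = (if k = m then if k = 0 then real_of_int (b - a) else real_of_int (b - a) / 2 else 0)"
    and integral_sin_sin: "integral {real_of_int a..real_of_int b} (\<lambda>x. sin (2 * pi * real k * x) * sin (2 * pi * real m * x))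
      = (if k = m \<and> k \<noteq> 0 then real_of_int (b - a) / 2 else 0)"
    and integral_sin_cos: "integral {real_of_int a..real_of_int b} (\<lambda>x. sin (2 * pi * real k * x) * cos (2 * pi * real m * x)) = 0"
proof -
  define C where "C l = (\<lambda>x. cos (2 * pi * real_of_int l * x))" for l
  define S where "S l = (\<lambda>x. sin (2 * pi * real_of_int l * x))" for l
  define I where "I = {real_of_int a..real_of_int b}"
  have int: "C l integrable_on I" "S l integrable_on I" for l
    unfolding I_def C_def S_def by (auto intro!: integrable_continuous_interval continuous_intros)
  have IC: "integral I (C l) = (if l = 0 then real_of_int (b - a) else 0)" for l
    unfolding I_def C_def by (rule integral_cos_period[OF assms])
  have IS: "integral I (S l) = 0" for l
    unfolding I_def S_def by (rule integral_sin_period[OF assms])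
  have "(\<lambda>x. cos (2 * pi * real k * x) * cos (2 * pi * real m * x))
      = (\<lambda>x. (C (int k - int m) x + C (int k + int m) x) / 2)"
    by (auto simp: C_def cos_times_cos algebra_simps)
  then show "integral {real_of_int a..real_of_int b} (\<lambda>x. cos (2 * pi * real k * x) * cos (2 * pi * real m * x))
      = (if k = m then if k = 0 then real_of_int (b - a) else real_of_int (b - a) / 2 else 0)"
    unfolding I_def[symmetric] by (simp add: integral_add[OF int(1) int(1)] IC)
  have "(\<lambda>x. sin (2 * pi * real k * x) * sin (2 * pi * real m * x))
      = (\<lambda>x. (C (int k - int m) x - C (int k + int m) x) / 2)"
    by (auto simp: C_def sin_times_sin algebra_simps)
  then show "integral {real_of_int a..real_of_int b} (\<lambda>x. sin (2 * pi * real k * x) * sin (2 * pi * real m * x))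
      = (if k = m \<and> k \<noteq> 0 then real_of_int (b - a) / 2 else 0)"
    unfolding I_def[symmetric] by (simp add: integral_diff[OF int(1) int(1)] IC)
  have "(\<lambda>x. sin (2 * pi * real k * x) * cos (2 * pi * real m * x))
      = (\<lambda>x. (S (int k + int m) x + S (int k - int m) x) / 2)"
    by (auto simp: S_def sin_times_cos left_diff_distrib right_diff_distrib distrib_left distrib_right)
  then show "integral {real_of_int a..real_of_int b} (\<lambda>x. sin (2 * pi * real k * x) * cos (2 * pi * real m * x)) = 0"
    unfolding I_def[symmetric] by (simp add: integral_add[OF int(2) int(2)] IS)
qed

lemma integral_lebesgue_on_Ioo:
  fixes f :: "real \<Rightarrow> real"
  assumes "continuous_on {a..b} f"
  shows "(LINT x|lebesgue_on {a<..<b}. f x) = integral {a..b} f"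
proof -
  have "integrable (lebesgue_on {a..b}) f"
    by (rule continuous_imp_integrable_real) fact
  then have "set_integrable lebesgue {a..b} f"
    by (simp add: integrable_restrict_space set_integrable_def)
  then have "set_integrable lebesgue {a<..<b} f"
    by (rule set_integrable_subset) auto
  then have "integrable (lebesgue_on {a<..<b}) f"
    by (simp add: integrable_restrict_space set_integrable_def)
  then have "(LINT x|lebesgue_on {a<..<b}. f x) = integral {a<..<b} f"
    by (rule lebesgue_integral_eq_integral) auto
  then show ?thesis by (simp add: integral_open_interval_real)
qed

text \<open>Pythagoras for vector combinations of orthogonal real functions.\<close>

lemma nrm2_orthogonal_sum:
  fixes e :: "'i \<Rightarrow> 'a \<Rightarrow> real" and a :: "'i \<Rightarrow> 'b::euclidean_space"
  assumes "finite I" and e: "\<And>i. i \<in> I \<Longrightarrow> sqint M (e i)"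
    and orth: "\<And>i j. i \<in> I \<Longrightarrow> j \<in> I \<Longrightarrow> (LINT x|M. e i x * e j x) = (if i = j then c else 0)"
  shows "(nrm2 M (\<lambda>x. \<Sum>i\<in>I. e i x *\<^sub>R a i))\<^sup>2 = c * (\<Sum>i\<in>I. (norm (a i))\<^sup>2)"
proof -
  have int: "integrable M (\<lambda>x. e i x * e j x)" if "i \<in> I" "j \<in> I" for i j
    using sqint_inner_integrable[OF e[OF that(1)] e[OF that(2)]] by simp
  have "(nrm2 M (\<lambda>x. \<Sum>i\<in>I. e i x *\<^sub>R a i))\<^sup>2
      = (LINT x|M. (\<Sum>i\<in>I. \<Sum>j\<in>I. (e i x * e j x) * (a i \<bullet> a j)))"
    unfolding nrm2_sq power2_norm_eq_inner
    by (simp add: inner_sum_left inner_sum_right sum_distrib_left mult_ac inner_commute)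
  also have "\<dots> = (\<Sum>i\<in>I. \<Sum>j\<in>I. (LINT x|M. e i x * e j x) * (a i \<bullet> a j))"
    using int by (simp add: Bochner_Integration.integral_sum)
  also have "\<dots> = (\<Sum>i\<in>I. \<Sum>j\<in>I. if i = j then c * (a i \<bullet> a j) else 0)"
    by (intro sum.cong refl) (auto simp: orth)
  also have "\<dots> = c * (\<Sum>i\<in>I. (norm (a i))\<^sup>2)"
    using \<open>finite I\<close> by (simp add: sum_distrib_left power2_norm_eq_inner)
  finally show ?thesis .
qed

section \<open>Convergence of the trigonometric sums\<close>

lemma finite_measure_lebesgue_on_Ioo: "finite_measure (lebesgue_on {a<..<b::real})"
  by (rule finite_measureI) (cases "a \<le> b"; simp add: emeasure_restrict_space)

lemma sqint_lebesgue_on_Ioo_bounded: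
  fixes f :: "real \<Rightarrow> 'b::euclidean_space"
  assumes "f \<in> borel_measurable borel" "\<And>x. a < x \<Longrightarrow> x < b \<Longrightarrow> norm (f x) \<le> B"
  shows "sqint (lebesgue_on {a<..<b}) f"
proof (rule finite_measure.sqint_bounded[OF finite_measure_lebesgue_on_Ioo])
  show "f \<in> borel_measurable (lebesgue_on {a<..<b})"
    by (intro measurable_restrict_space1 measurable_completion) (use assms in simp)
  show "AE x in lebesgue_on {a<..<b}. norm (f x) \<le> B"
    by (rule AE_I2) (use assms in auto)
qed

lemma borel_measurable_kern [measurable]: "kern lam alpha J n \<in> borel_measurable borel"
  unfolding kern_def by measurable

lemma norm_kern_le:
  "norm (kern lam alpha J n x) \<le> (\<Sum>j\<in>J. 2 * norm (alpha j)) + (1 + 2 * real n) * norm (mat 1 :: complex^'r^'r)"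
  for alpha :: "nat \<Rightarrow> complex^'r^'r"
proof -
  have "norm (\<Sum>j\<in>J. (2 * cos (2 * lam j * x)) *\<^sub>R alpha j) \<le> (\<Sum>j\<in>J. 2 * norm (alpha j))"
    by (rule order_trans[OF norm_sum]) (auto intro!: sum_mono mult_right_mono simp: abs_mult)
  moreover have "\<bar>1 + (\<Sum>k=1..n. 2 * cos (2 * pi * real k * x))\<bar> \<le> 1 + (\<Sum>k=1..n. 2)"
    by (intro order_trans[OF abs_triangle_ineq] add_mono order_trans[OF sum_abs] sum_mono) (auto simp: abs_mult)
  then have "norm ((1 + (\<Sum>k=1..n. 2 * cos (2 * pi * real k * x))) *\<^sub>R (mat 1 :: complex^'r^'r))
      \<le> (1 + 2 * real n) * norm (mat 1 :: complex^'r^'r)"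
    by (auto intro!: mult_right_mono)
  ultimately show ?thesis
    unfolding kern_def by (intro order_trans[OF norm_triangle_ineq4] add_mono)
qed

lemma sqint_kern: "sqint (lebesgue_on {a<..<b}) (kern lam alpha J n)"
  by (rule sqint_lebesgue_on_Ioo_bounded[OF borel_measurable_kern norm_kern_le])

text \<open>
  First-order expansion of the cosine at the frequency \<open>mu\<close>. After summation over a block of
  frequencies the first-order terms give an orthogonal series times \<open>x\<close>.
\<close>

lemma cos_frequency_expansion:
  fixes mu eps x :: real assumes "\<bar>x\<bar> \<le> 1"
  shows "\<bar>2 * cos (2 * (mu + eps) * x) - 2 * cos (2 * mu * x) + 4 * eps * (x * sin (2 * mu * x))\<bar> \<le> 8 * eps\<^sup>2"
proof -
  define y where "y = 2 * eps * x"
  define t where "t = 2 * mu * x"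
  have c: "\<bar>cos y - 1\<bar> \<le> y\<^sup>2 / 2"
  proof -
    have "(sin (y / 2))\<^sup>2 \<le> (y / 2)\<^sup>2"
      by (subst abs_le_square_iff[symmetric]) (rule abs_sin_x_le_abs_x)
    then show ?thesis using cos_double_sin[of "y / 2"] by (simp add: power2_eq_square)
  qed
  have s: "\<bar>sin y - y\<bar> \<le> y\<^sup>2 / 2"
    using Maclaurin_sin_bound[of y 2] by (simp add: numeral_2_eq_2 sin_coeff_def)
  have "2 * cos (2 * (mu + eps) * x) - 2 * cos (2 * mu * x) + 4 * eps * (x * sin (2 * mu * x))
      = 2 * (cos t * (cos y - 1)) - 2 * (sin t * (sin y - y))"
    using cos_add[of t y] by (simp add: t_def y_def algebra_simps)
  also have "\<bar>\<dots>\<bar> \<le> 2 * (1 * (y\<^sup>2 / 2)) + 2 * (1 * (y\<^sup>2 / 2))"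
  proof -
    have "\<bar>cos t * (cos y - 1)\<bar> \<le> 1 * (y\<^sup>2 / 2)" "\<bar>sin t * (sin y - y)\<bar> \<le> 1 * (y\<^sup>2 / 2)"
      unfolding abs_mult using c s by (intro mult_mono; simp)+
    then show ?thesis by linarith
  qed
  also have "\<dots> = 8 * eps\<^sup>2 * x\<^sup>2" by (simp add: y_def power2_eq_square)
  also have "\<dots> \<le> 8 * eps\<^sup>2 * 1"
    using assms by (intro mult_left_mono) (auto simp: abs_square_le_1)
  finally show ?thesis by simp
qed

lemma kern_block:
  fixes alpha :: "nat \<Rightarrow> complex^'r^'r"
  assumes fin: "finite D" and x: "\<bar>x\<bar> \<le> 1" and C: "\<And>j. j \<in> D \<Longrightarrow> norm (alpha j) \<le> C"
  shows "norm ((\<Sum>j\<in>D. (2 * cos (2 * lam j * x)) *\<^sub>R alpha j) - (2 * cos (2 * pi * n * x)) *\<^sub>R mat 1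
      - (cos (2 * pi * n * x) *\<^sub>R (2 *\<^sub>R ((\<Sum>j\<in>D. alpha j) - mat 1))
         + x *\<^sub>R (sin (2 * pi * n * x) *\<^sub>R (\<Sum>j\<in>D. (- 4 * (lam j - pi * n)) *\<^sub>R alpha j))))
    \<le> 8 * C * (\<Sum>j\<in>D. \<bar>lam j - pi * n\<bar>\<^sup>2)" (is "norm ?L \<le> _")
proof -
  define q where "q j = 2 * cos (2 * lam j * x) - 2 * cos (2 * (pi * n) * x)
      + 4 * (lam j - pi * n) * (x * sin (2 * (pi * n) * x))" for j
  have "?L = (\<Sum>j\<in>D. q j *\<^sub>R alpha j)"
    by (simp add: q_def scaleR_diff_left scaleR_add_left sum.distrib sum_subtractf scaleR_sum_right
        scaleR_diff_right sum_negf left_diff_distrib right_diff_distrib mult_ac)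
  also have "norm \<dots> \<le> (\<Sum>j\<in>D. 8 * (lam j - pi * n)\<^sup>2 * C)"
  proof (rule order_trans[OF norm_sum], rule sum_mono)
    fix j assume j: "j \<in> D"
    have "\<bar>q j\<bar> \<le> 8 * (lam j - pi * n)\<^sup>2"
      using cos_frequency_expansion[OF x, of "pi * n" "lam j - pi * n"] by (simp add: q_def)
    then show "norm (q j *\<^sub>R alpha j) \<le> 8 * (lam j - pi * n)\<^sup>2 * C"
      using C[OF j] by (auto intro!: mult_mono)
  qed
  also have "\<dots> = 8 * C * (\<Sum>j\<in>D. \<bar>lam j - pi * n\<bar>\<^sup>2)"
    by (simp add: sum_distrib_left mult_ac)
  finally show ?thesis .
qed

lemma summable_block_Cauchy:
  fixes f :: "nat \<Rightarrow> real"
  assumes "summable f" "e > 0"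
  shows "\<exists>N. \<forall>p\<ge>N. \<forall>q. (\<Sum>n\<in>{p..<q}. f n) < e"
  using assms(1)[unfolded summable_Cauchy, rule_format, OF assms(2)] unfolding real_norm_def
  by (meson abs_ge_self le_less_trans)

lemma nrm2_trig_sum:
  fixes a :: "nat \<Rightarrow> 'b::euclidean_space"
  shows "(nrm2 (lebesgue_on {-1<..<1}) (\<lambda>x. \<Sum>n\<in>{p..<q}. cos (2 * pi * real (Suc n) * x) *\<^sub>R a n))\<^sup>2
      = (\<Sum>n\<in>{p..<q}. (norm (a n))\<^sup>2)"
    and "(nrm2 (lebesgue_on {-1<..<1}) (\<lambda>x. \<Sum>n\<in>{p..<q}. sin (2 * pi * real (Suc n) * x) *\<^sub>R a n))\<^sup>2
      = (\<Sum>n\<in>{p..<q}. (norm (a n))\<^sup>2)"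
proof -
  have e: "sqint (lebesgue_on {-1<..<1}) (\<lambda>x. cos (2 * pi * real (Suc n) * x))"
    "sqint (lebesgue_on {-1<..<1}) (\<lambda>x. sin (2 * pi * real (Suc n) * x))" for n
    by (rule sqint_lebesgue_on_Ioo_bounded[of _ _ _ 1]; simp)+
  show "(nrm2 (lebesgue_on {-1<..<1}) (\<lambda>x. \<Sum>n\<in>{p..<q}. cos (2 * pi * real (Suc n) * x) *\<^sub>R a n))\<^sup>2
      = (\<Sum>n\<in>{p..<q}. (norm (a n))\<^sup>2)"
    using integral_cos_cos[of "-1" 1]
    by (subst nrm2_orthogonal_sum[where c = 1])
      (auto simp: e integral_lebesgue_on_Ioo continuous_intros simp del: of_nat_Suc)
  show "(nrm2 (lebesgue_on {-1<..<1}) (\<lambda>x. \<Sum>n\<in>{p..<q}. sin (2 * pi * real (Suc n) * x) *\<^sub>R a n))\<^sup>2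
      = (\<Sum>n\<in>{p..<q}. (norm (a n))\<^sup>2)"
    using integral_sin_sin[of "-1" 1]
    by (subst nrm2_orthogonal_sum[where c = 1])
      (auto simp: e integral_lebesgue_on_Ioo continuous_intros simp del: of_nat_Suc)
qed

text \<open>
  The matrices \<open>alpha j\<close> with \<open>lam j\<close> outside \<open>Delta 0\<close> share a common bound, since each is
  dominated by the sum over its block, and these sums are bounded.
\<close>

lemma alpha_bounded:
  fixes alpha :: "nat \<Rightarrow> complex^'r^'r"
  assumes psd: "\<And>j. alpha j \<in> psd"
    and fin: "\<And>n. n \<ge> 1 \<Longrightarrow> finite {j. lam j \<in> Delta n}"
    and sm: "summable (\<lambda>n. (op_norm (mat 1 - (\<Sum>j | lam j \<in> Delta (Suc n). alpha j)))\<^sup>2)"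
  shows "\<exists>C. \<forall>n. \<forall>j\<in>{j. lam j \<in> Delta (Suc n)}. norm (alpha j) \<le> C"
proof -
  define s where "s n = (\<Sum>j | lam j \<in> Delta (Suc n). alpha j)" for n
  define K where "K = sqrt (\<Sum>n. (op_norm (mat 1 - s n))\<^sup>2)"
  have s: "op_norm (s n) \<le> op_norm (mat 1 :: complex^'r^'r) + norm (mat 1 - s n)" for n
    using abs_op_norm_diff_le[of "s n" "mat 1"] by (simp add: norm_minus_commute)
  have K: "op_norm (mat 1 - s n) \<le> K" for n
  proof -
    have "(op_norm (mat 1 - s n))\<^sup>2 = (\<Sum>i\<in>{n}. (op_norm (mat 1 - s i))\<^sup>2)" by simp
    also have "\<dots> \<le> (\<Sum>n. (op_norm (mat 1 - s n))\<^sup>2)"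
      by (rule sum_le_suminf) (use sm in \<open>auto simp: s_def\<close>)
    finally show ?thesis unfolding K_def by (rule real_le_rsqrt)
  qed
  define c where "c = (real CARD('r))\<^sup>2"
  have "norm (alpha j) \<le> c * (op_norm (mat 1 :: complex^'r^'r) + c * K)" if "lam j \<in> Delta (Suc n)" for n j
  proof -
    let ?D = "{j. lam j \<in> Delta (Suc n)}"
    have "s n - alpha j = (\<Sum>i\<in>?D - {j}. alpha i)"
      unfolding s_def using that fin[of "Suc n"] by (subst sum_diff1) auto
    then have "s n - alpha j \<in> psd" using psd_sum[of "?D - {j}" alpha] psd by simp
    then have "op_norm (alpha j) \<le> op_norm (s n)" by (rule op_norm_psd_mono[OF psd])
    also have "\<dots> \<le> op_norm (mat 1 :: complex^'r^'r) + c * op_norm (mat 1 - s n)"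
      using s[of n] norm_le_card_op_norm[of "mat 1 - s n"] by (simp add: c_def)
    also have "\<dots> \<le> op_norm (mat 1 :: complex^'r^'r) + c * K"
      using K[of n] by (intro add_left_mono mult_left_mono) (auto simp: c_def)
    finally have "c * op_norm (alpha j) \<le> c * (op_norm (mat 1 :: complex^'r^'r) + c * K)"
      by (intro mult_left_mono) (auto simp: c_def)
    then show ?thesis using norm_le_card_op_norm[of "alpha j"] unfolding c_def by (rule order_trans[rotated])
  qed
  then show ?thesis by blast
qed

text \<open>
  Each block is the sum of three terms: a cosine, \<open>x\<close> times a sine, and a remainder. The cosines are
  orthogonal, as are the sines, and their coefficients are square summable; the bounds of the
  remainders are summable.
\<close>

lemma kern_L2_Cauchy:
  fixes alpha :: "nat \<Rightarrow> complex^'r^'r"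
  assumes psd: "\<And>j. alpha j \<in> psd"
    and inj: "inj lam" and nonneg: "\<And>j. 0 \<le> lam j"
    and A1_lam: "summable (\<lambda>n. \<Sum>j | lam j \<in> Delta (Suc n). \<bar>lam j - pi * real (Suc n)\<bar>\<^sup>2)"
    and card: "\<And>n. n \<ge> 1 \<Longrightarrow> finite {j. lam j \<in> Delta n} \<and> card {j. lam j \<in> Delta n} \<le> c0"
    and A1_alpha: "summable (\<lambda>n. (op_norm (mat 1 - (\<Sum>j | lam j \<in> Delta (Suc n). alpha j)))\<^sup>2)"
    and e: "e > 0"
  shows "\<exists>N. \<forall>m\<ge>N. \<forall>n\<ge>N. nrm2 (lebesgue_on {-1<..<1})
    (\<lambda>x. kern lam alpha (upto_ix lam m) m x - kern lam alpha (upto_ix lam n) n x) < e"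
proof -
  define M where "M = lebesgue_on {-1<..<1::real}"
  define D where "D n = {j. lam j \<in> Delta (Suc n)}" for n
  define h where "h n x = kern lam alpha (upto_ix lam n) n x" for n x
  define A where "A n = 2 *\<^sub>R ((\<Sum>j\<in>D n. alpha j) - mat 1)" for n
  define B where "B n = (\<Sum>j\<in>D n. (- 4 * (lam j - pi * real (Suc n))) *\<^sub>R alpha j)" for n
  define r where "r n = (\<Sum>j\<in>D n. \<bar>lam j - pi * real (Suc n)\<bar>\<^sup>2)" for n
  have finD: "finite (D n)" and cardD: "card (D n) \<le> c0" for n
    using card[of "Suc n"] by (auto simp: D_def)
  obtain C where C: "\<And>n j. j \<in> D n \<Longrightarrow> norm (alpha j) \<le> C"
    using alpha_bounded[of alpha lam, OF psd _ A1_alpha] card unfolding D_def by blast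
  define C' where "C' = max C 0"
  have C': "\<And>n j. j \<in> D n \<Longrightarrow> norm (alpha j) \<le> C'" "C' \<ge> 0" using C by (force simp: C'_def)+
  have r0: "r n \<ge> 0" for n unfolding r_def by (intro sum_nonneg) auto
  have sr: "summable r" using A1_lam by (simp add: r_def[abs_def] D_def)
  have sA: "summable (\<lambda>n. (norm (A n))\<^sup>2)"
  proof (rule summable_comparison_test'[where N = 0])
    define c where "c = (real CARD('r))\<^sup>2"
    show "summable (\<lambda>n. (2 * c)\<^sup>2 * (op_norm (mat 1 - (\<Sum>j\<in>D n. alpha j)))\<^sup>2)"
      using A1_alpha unfolding D_def by (rule summable_mult)
    fix n :: nat
    have "norm (A n) = 2 * norm (mat 1 - (\<Sum>j\<in>D n. alpha j))" by (simp add: A_def norm_minus_commute)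
    also have "\<dots> \<le> 2 * (c * op_norm (mat 1 - (\<Sum>j\<in>D n. alpha j)))"
      unfolding c_def by (intro mult_left_mono norm_le_card_op_norm) auto
    finally have "(norm (A n))\<^sup>2 \<le> (2 * (c * op_norm (mat 1 - (\<Sum>j\<in>D n. alpha j))))\<^sup>2"
      by (rule power_mono) simp
    then show "norm ((norm (A n))\<^sup>2) \<le> (2 * c)\<^sup>2 * (op_norm (mat 1 - (\<Sum>j\<in>D n. alpha j)))\<^sup>2"
      by (simp add: power_mult_distrib)
  qed
  have sB: "summable (\<lambda>n. (norm (B n))\<^sup>2)"
  proof (rule summable_comparison_test'[where N = 0])
    show "summable (\<lambda>n. ((4 * C')\<^sup>2 * real c0) * r n)" using sr by (rule summable_mult)
    fix n :: nat
    have "norm (B n) \<le> (\<Sum>j\<in>D n. 4 * \<bar>lam j - pi * real (Suc n)\<bar> * C')"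
      unfolding B_def
    proof (rule order_trans[OF norm_sum], rule sum_mono)
      fix j assume j: "j \<in> D n"
      have "norm ((- 4 * u) *\<^sub>R alpha j) = 4 * \<bar>u\<bar> * norm (alpha j)" for u :: real
        by (simp add: abs_mult)
      then show "norm ((- 4 * (lam j - pi * real (Suc n))) *\<^sub>R alpha j)
          \<le> 4 * \<bar>lam j - pi * real (Suc n)\<bar> * C'"
        using C'(1)[OF j] by (simp only:) (intro mult_left_mono; simp)
    qed
    also have "\<dots> = 4 * C' * (\<Sum>j\<in>D n. \<bar>lam j - pi * real (Suc n)\<bar>)"
      by (simp add: sum_distrib_left mult_ac)
    finally have "(norm (B n))\<^sup>2 \<le> (4 * C' * (\<Sum>j\<in>D n. \<bar>lam j - pi * real (Suc n)\<bar>))\<^sup>2"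
      by (rule power_mono) simp
    also have "\<dots> \<le> (4 * C')\<^sup>2 * (r n * real (card (D n)))"
      unfolding power_mult_distrib[of "4 * C'"] r_def
      by (intro mult_left_mono sum_squared_le_sum_of_squares) auto
    also have "\<dots> \<le> (4 * C')\<^sup>2 * (r n * real c0)"
      using cardD r0 by (intro mult_left_mono) auto
    finally show "norm ((norm (B n))\<^sup>2) \<le> ((4 * C')\<^sup>2 * real c0) * r n" by (simp add: mult_ac)
  qed
  define Ac where "Ac p q x = (\<Sum>n\<in>{p..<q}. cos (2 * pi * real (Suc n) * x) *\<^sub>R A n)" for p q x
  define Bs where "Bs p q x = (\<Sum>n\<in>{p..<q}. sin (2 * pi * real (Suc n) * x) *\<^sub>R B n)" for p q x
  have step: "h (Suc n) x - h n x = (\<Sum>j\<in>D n. (2 * cos (2 * lam j * x)) *\<^sub>R alpha j)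
      - (2 * cos (2 * pi * real (Suc n) * x)) *\<^sub>R mat 1" if "n \<ge> 1" for n x
  proof -
    have "(\<Sum>j\<in>upto_ix lam (Suc n). (2 * cos (2 * lam j * x)) *\<^sub>R alpha j)
        = (\<Sum>j\<in>upto_ix lam n. (2 * cos (2 * lam j * x)) *\<^sub>R alpha j)
        + (\<Sum>j\<in>D n. (2 * cos (2 * lam j * x)) *\<^sub>R alpha j)"
      unfolding upto_ix_Suc(1)[OF that] D_def using finD[of n, unfolded D_def]
        upto_ix_Suc(2)[OF that] finite_upto_ix[OF inj nonneg] card
      by (intro sum.union_disjoint) auto
    then show ?thesis by (simp add: h_def kern_def scaleR_add_left algebra_simps)
  qed
  have diff: "norm (h q x - h p x - (Ac p q x + x *\<^sub>R Bs p q x)) \<le> 8 * C' * (\<Sum>n\<in>{p..<q}. r n)"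
    if "p \<le> q" "1 \<le> p" "\<bar>x\<bar> \<le> 1" for p q x
  proof -
    have "h q x - h p x = (\<Sum>n\<in>{p..<q}. h (Suc n) x - h n x)"
      using sum_Suc_diff'[OF that(1), of "\<lambda>n. h n x"] by simp
    then have "h q x - h p x - (Ac p q x + x *\<^sub>R Bs p q x) = (\<Sum>n\<in>{p..<q}. (h (Suc n) x - h n x)
        - (cos (2 * pi * real (Suc n) * x) *\<^sub>R A n + x *\<^sub>R (sin (2 * pi * real (Suc n) * x) *\<^sub>R B n)))"
      by (simp only: Ac_def Bs_def sum_subtractf sum.distrib scaleR_sum_right)
    also have "norm \<dots> \<le> (\<Sum>n\<in>{p..<q}. 8 * C' * r n)"
    proof (rule order_trans[OF norm_sum], rule sum_mono)
      fix n assume "n \<in> {p..<q}"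
      then have "n \<ge> 1" using that by simp
      from kern_block[OF finD[of n] that(3) C'(1), where lam = lam and n = "real (Suc n)"]
      show "norm (h (Suc n) x - h n x - (cos (2 * pi * real (Suc n) * x) *\<^sub>R A n
          + x *\<^sub>R (sin (2 * pi * real (Suc n) * x) *\<^sub>R B n))) \<le> 8 * C' * r n"
        unfolding step[OF \<open>n \<ge> 1\<close>] A_def B_def r_def .
    qed
    finally show ?thesis by (simp add: sum_distrib_left)
  qed
  have [measurable]: "h n \<in> borel_measurable borel" "Ac p q \<in> borel_measurable borel"
    "Bs p q \<in> borel_measurable borel" for n p q
    unfolding h_def[abs_def] Ac_def[abs_def] Bs_def[abs_def] by measurable
  have sq: "sqint M (Ac p q)" "sqint M (Bs p q)" "sqint M (\<lambda>x. x *\<^sub>R Bs p q x)" "sqint M (h n)" for p q n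
  proof -
    have e1: "sqint M (\<lambda>x. cos (2 * pi * real (Suc n) * x) *\<^sub>R A n)"
      "sqint M (\<lambda>x. sin (2 * pi * real (Suc n) * x) *\<^sub>R B n)" for n
      unfolding M_def
      by (rule sqint_lebesgue_on_Ioo_bounded[of _ _ _ "norm (A n)"], simp_all add: mult_left_le_one_le)
        (rule sqint_lebesgue_on_Ioo_bounded[of _ _ _ "norm (B n)"], simp_all add: mult_left_le_one_le)
    show "sqint M (Ac p q)" "sqint M (Bs p q)"
      unfolding Ac_def[abs_def] Bs_def[abs_def] by (intro sqint_sum e1)+
    then show "sqint M (\<lambda>x. x *\<^sub>R Bs p q x)"
      by (rule_tac sqint_bound[where f = "Bs p q"])
        (auto simp: M_def mult_left_le_one_le intro!: AE_I2 measurable_restrict_space1 measurable_completion)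
    show "sqint M (h n)" unfolding M_def h_def[abs_def] by (rule sqint_kern)
  qed
  have bound: "nrm2 M (\<lambda>x. h q x - h p x) \<le> sqrt (\<Sum>n\<in>{p..<q}. (norm (A n))\<^sup>2)
      + sqrt (\<Sum>n\<in>{p..<q}. (norm (B n))\<^sup>2) + sqrt 2 * (8 * C' * (\<Sum>n\<in>{p..<q}. r n))"
    if "p \<le> q" "1 \<le> p" for p q
  proof -
    define R where "R x = h q x - h p x - (Ac p q x + x *\<^sub>R Bs p q x)" for x
    define b where "b = 8 * C' * (\<Sum>n\<in>{p..<q}. r n)"
    have b0: "b \<ge> 0" unfolding b_def using C'(2) r0 by (intro mult_nonneg_nonneg sum_nonneg) auto
    have [measurable]: "R \<in> borel_measurable borel" unfolding R_def[abs_def] by measurable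
    have sR: "sqint M R" unfolding R_def[abs_def] by (intro sqint_diff sqint_add sq)
    have "nrm2 M R \<le> nrm2 M (\<lambda>_. b)"
    proof (rule nrm2_mono)
      show "sqint M (\<lambda>_. b)" unfolding M_def by (rule sqint_lebesgue_on_Ioo_bounded) auto
      show "R \<in> borel_measurable M" using sR by (rule sqintD)
      show "AE x in M. norm (R x) \<le> norm b"
        using diff[OF that] b0 by (intro AE_I2) (auto simp: M_def R_def b_def)
    qed
    also have "nrm2 M (\<lambda>_. b) = sqrt 2 * b"
      using b0 by (simp add: nrm2_def M_def real_sqrt_mult measure_restrict_space)
    finally have R: "nrm2 M R \<le> sqrt 2 * b" .
    have "(\<lambda>x. h q x - h p x) = (\<lambda>x. (Ac p q x + x *\<^sub>R Bs p q x) + R x)" by (auto simp: R_def)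
    then have "nrm2 M (\<lambda>x. h q x - h p x) \<le> nrm2 M (Ac p q) + nrm2 M (\<lambda>x. x *\<^sub>R Bs p q x) + nrm2 M R"
      using nrm2_triangle[OF sqint_add[OF sq(1)[of p q] sq(3)[of p q]] sR] nrm2_triangle[OF sq(1)[of p q] sq(3)[of p q]]
      by simp
    moreover have "nrm2 M (\<lambda>x. x *\<^sub>R Bs p q x) \<le> nrm2 M (Bs p q)"
      by (rule nrm2_mono[OF sq(2) sqintD(1)[OF sq(3)]])
        (auto simp: M_def mult_left_le_one_le intro!: AE_I2)
    moreover have "nrm2 M (Ac p q) = sqrt (\<Sum>n\<in>{p..<q}. (norm (A n))\<^sup>2)"
      unfolding M_def Ac_def[abs_def]
      by (rule real_sqrt_unique[symmetric, OF nrm2_trig_sum(1) nrm2_nonneg])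
    moreover have "nrm2 M (Bs p q) = sqrt (\<Sum>n\<in>{p..<q}. (norm (B n))\<^sup>2)"
      unfolding M_def Bs_def[abs_def]
      by (rule real_sqrt_unique[symmetric, OF nrm2_trig_sum(2) nrm2_nonneg])
    ultimately show ?thesis using R unfolding b_def by linarith
  qed
  obtain N1 where N1: "\<And>p q. p \<ge> N1 \<Longrightarrow> (\<Sum>n\<in>{p..<q}. (norm (A n))\<^sup>2) < (e/3)\<^sup>2"
    using summable_block_Cauchy[OF sA, of "(e/3)\<^sup>2"] e by (auto simp: power2_eq_square)
  obtain N2 where N2: "\<And>p q. p \<ge> N2 \<Longrightarrow> (\<Sum>n\<in>{p..<q}. (norm (B n))\<^sup>2) < (e/3)\<^sup>2"
    using summable_block_Cauchy[OF sB, of "(e/3)\<^sup>2"] e by (auto simp: power2_eq_square)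
  obtain N3 where N3: "\<And>p q. p \<ge> N3 \<Longrightarrow> (\<Sum>n\<in>{p..<q}. sqrt 2 * (8 * C') * r n) < e/3"
    using summable_block_Cauchy[OF summable_mult[OF sr], of "e/3" "sqrt 2 * (8 * C')"] e by auto
  have small: "nrm2 M (\<lambda>x. h q x - h p x) < e" if "p \<le> q" "p \<ge> max 1 (max N1 (max N2 N3))" for p q
  proof -
    have "sqrt (\<Sum>n\<in>{p..<q}. (norm (A n))\<^sup>2) \<le> e/3"
      using N1[of p q] that e by (intro real_le_lsqrt sum_nonneg) auto
    moreover have "sqrt (\<Sum>n\<in>{p..<q}. (norm (B n))\<^sup>2) \<le> e/3"
      using N2[of p q] that e by (intro real_le_lsqrt sum_nonneg) auto
    moreover have "sqrt 2 * (8 * C' * (\<Sum>n\<in>{p..<q}. r n)) < e/3"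
      using N3[of p q] that by (simp add: sum_distrib_left mult_ac)
    ultimately show ?thesis using bound[of p q] that by linarith
  qed
  have "nrm2 M (\<lambda>x. h m x - h n x) < e" if "m \<ge> max 1 (max N1 (max N2 N3))" "n \<ge> max 1 (max N1 (max N2 N3))" for m n
  proof (cases "n \<le> m")
    case True then show ?thesis using small[OF True] that by simp
  next
    case False
    then have "nrm2 M (\<lambda>x. h n x - h m x) < e" using small[of m n] that by simp
    then show ?thesis by (simp add: nrm2_def norm_minus_commute)
  qed
  then show ?thesis unfolding M_def h_def by blast
qed

section \<open>Limits in the mean: representatives and almost everywhere properties\<close>

lemma L2_op_norm_iff:
  fixes f :: "real \<Rightarrow> complex^'r^'r"
  shows "f \<in> L2 op_norm S \<longleftrightarrow> sqint (lebesgue_on S) f"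
proof -
  define c where "c = (real CARD('r))\<^sup>2"
  have 1: "(op_norm A)\<^sup>2 \<le> (norm A)\<^sup>2" for A :: "complex^'r^'r"
    by (intro power_mono op_norm_le_norm op_norm_nonneg)
  have 2: "(norm A)\<^sup>2 \<le> c\<^sup>2 * (op_norm A)\<^sup>2" for A :: "complex^'r^'r"
    unfolding power_mult_distrib[symmetric] c_def by (intro power_mono norm_le_card_op_norm) auto
  have "integrable (lebesgue_on S) (\<lambda>x. (op_norm (f x))\<^sup>2) \<longleftrightarrow> integrable (lebesgue_on S) (\<lambda>x. (norm (f x))\<^sup>2)"
    if [measurable]: "f \<in> borel_measurable (lebesgue_on S)"
  proof
    assume "integrable (lebesgue_on S) (\<lambda>x. (op_norm (f x))\<^sup>2)"
    then have "integrable (lebesgue_on S) (\<lambda>x. c\<^sup>2 * (op_norm (f x))\<^sup>2)" by (rule integrable_mult_right)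
    then show "integrable (lebesgue_on S) (\<lambda>x. (norm (f x))\<^sup>2)"
      by (rule Bochner_Integration.integrable_bound) (use 2 in auto)
  next
    assume "integrable (lebesgue_on S) (\<lambda>x. (norm (f x))\<^sup>2)"
    then show "integrable (lebesgue_on S) (\<lambda>x. (op_norm (f x))\<^sup>2)"
      by (rule Bochner_Integration.integrable_bound) (use 1 in auto)
  qed
  then show ?thesis unfolding L2_def sqint_def by auto
qed

lemma L2_limit_op_norm_iff:
  fixes F :: "nat \<Rightarrow> real \<Rightarrow> complex^'r^'r"
  shows "L2_limit op_norm S F f \<longleftrightarrow> (\<forall>n. sqint (lebesgue_on S) (F n)) \<and> sqint (lebesgue_on S) f \<and>
    (\<lambda>n. nrm2 (lebesgue_on S) (\<lambda>x. F n x - f x)) \<longlonglongrightarrow> 0"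
proof -
  define M where "M = lebesgue_on S"
  define c where "c = (real CARD('r))\<^sup>2"
  have c0: "c \<ge> 0" by (simp add: c_def)
  have nn: "0 \<le> L2_dist op_norm S g h" for g h :: "real \<Rightarrow> complex^'r^'r" by (simp add: L2_dist_def)
  have *: "L2_dist op_norm S g h \<le> nrm2 M (\<lambda>x. g x - h x)" "nrm2 M (\<lambda>x. g x - h x) \<le> c * L2_dist op_norm S g h"
    if "sqint M g" "sqint M h" for g h :: "real \<Rightarrow> complex^'r^'r"
  proof -
    have s: "sqint M (\<lambda>x. g x - h x)" using that by (rule sqint_diff)
    then have i1: "integrable M (\<lambda>x. (norm (g x - h x))\<^sup>2)" by (rule sqintD)
    have i2: "integrable M (\<lambda>x. (op_norm (g x - h x))\<^sup>2)"
      using s unfolding M_def L2_op_norm_iff[symmetric] L2_def by simp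
    show "L2_dist op_norm S g h \<le> nrm2 M (\<lambda>x. g x - h x)"
      unfolding L2_dist_def nrm2_def M_def[symmetric]
      by (intro real_sqrt_le_mono integral_mono i1 i2 power_mono op_norm_le_norm op_norm_nonneg)
    have "nrm2 M (\<lambda>x. g x - h x) \<le> sqrt (LINT x|M. c\<^sup>2 * (op_norm (g x - h x))\<^sup>2)"
      unfolding nrm2_def
    proof (intro real_sqrt_le_mono integral_mono i1 integrable_mult_right i2)
      show "(norm (g x - h x))\<^sup>2 \<le> c\<^sup>2 * (op_norm (g x - h x))\<^sup>2" for x
        unfolding power_mult_distrib[symmetric] c_def by (intro power_mono norm_le_card_op_norm) auto
    qed
    also have "\<dots> = c * L2_dist op_norm S g h"
      by (simp add: L2_dist_def M_def real_sqrt_mult c0)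
    finally show "nrm2 M (\<lambda>x. g x - h x) \<le> c * L2_dist op_norm S g h" .
  qed
  have "(\<lambda>n. L2_dist op_norm S (F n) f) \<longlonglongrightarrow> 0 \<longleftrightarrow> (\<lambda>n. nrm2 M (\<lambda>x. F n x - f x)) \<longlonglongrightarrow> 0"
    if "\<And>n. sqint M (F n)" "sqint M f"
  proof
    assume "(\<lambda>n. L2_dist op_norm S (F n) f) \<longlonglongrightarrow> 0"
    then have "(\<lambda>n. c * L2_dist op_norm S (F n) f) \<longlonglongrightarrow> 0" by (rule tendsto_mult_right_zero)
    then show "(\<lambda>n. nrm2 M (\<lambda>x. F n x - f x)) \<longlonglongrightarrow> 0"
      by (rule tendsto_sandwich[OF _ _ tendsto_const, rotated 2]) (auto simp: nrm2_nonneg * that)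
  next
    assume "(\<lambda>n. nrm2 M (\<lambda>x. F n x - f x)) \<longlonglongrightarrow> 0"
    then show "(\<lambda>n. L2_dist op_norm S (F n) f) \<longlonglongrightarrow> 0"
      by (rule tendsto_sandwich[OF _ _ tendsto_const, rotated 2]) (auto simp: nn * that)
  qed
  then show ?thesis unfolding L2_limit_def L2_op_norm_iff M_def by blast
qed

lemma nrm2_tendsto_AE_subseq:
  fixes f :: "'a \<Rightarrow> 'b::euclidean_space"
  assumes F: "\<And>n. sqint M (F n)" "sqint M f" and lim: "(\<lambda>n. nrm2 M (\<lambda>x. F n x - f x)) \<longlonglongrightarrow> 0"
  shows "\<exists>r::nat\<Rightarrow>nat. AE x in M. (\<lambda>n. F (r n) x) \<longlonglongrightarrow> f x"
proof -
  have "(\<lambda>n. (nrm2 M (\<lambda>x. F n x - f x))\<^sup>2) \<longlonglongrightarrow> 0\<^sup>2" by (intro tendsto_power lim)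
  then have "(\<lambda>n. LINT x|M. norm ((norm (F n x - f x))\<^sup>2)) \<longlonglongrightarrow> 0" by (simp add: nrm2_sq)
  moreover have "integrable M (\<lambda>x. (norm (F n x - f x))\<^sup>2)" for n
    by (rule sqintD(2)) (intro sqint_diff F)
  ultimately obtain r where r: "AE x in M. (\<lambda>n. (norm (F (r n) x - f x))\<^sup>2) \<longlonglongrightarrow> 0"
    using tendsto_L1_AE_subseq[of M "\<lambda>n x. (norm (F n x - f x))\<^sup>2"] by blast
  have "(\<lambda>n. F (r n) x) \<longlonglongrightarrow> f x" if "(\<lambda>n. (norm (F (r n) x - f x))\<^sup>2) \<longlonglongrightarrow> 0" for x
  proof -
    have "(\<lambda>n. sqrt ((norm (F (r n) x - f x))\<^sup>2)) \<longlonglongrightarrow> sqrt 0" using that by (rule tendsto_real_sqrt)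
    then have "(\<lambda>n. norm (F (r n) x - f x)) \<longlonglongrightarrow> 0" by simp
    then show ?thesis by (simp add: LIM_zero_iff tendsto_norm_zero_iff)
  qed
  then show ?thesis using r by (intro exI[of _ r]) auto
qed

lemma AE_lborel_affine:
  fixes t c :: real
  assumes "AE x in lborel. P x" "c \<noteq> 0" shows "AE x in lborel. P (t + c * x)"
proof -
  obtain N where N: "\<And>x. x \<in> space lborel - N \<Longrightarrow> P x" "N \<in> null_sets lborel"
    using AE_E3[OF assms(1)] by metis
  have "Measurable.pred borel (\<lambda>x. x \<notin> N)" using N(2) by auto
  from AE_borel_affine[OF assms(2) this AE_not_in[OF N(2)], of t] show ?thesis
    by eventually_elim (use N(1) in auto)
qed

lemma AE_lebesgue_on_iff:
  fixes S :: "real set"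
  assumes "S \<in> sets borel"
  shows "(AE x in lebesgue_on S. P x) \<longleftrightarrow> (AE x in lborel. x \<in> S \<longrightarrow> P x)"
  using assms by (simp add: AE_restrict_space_iff AE_completion_iff)

lemma kern_even: "kern lam alpha J n (- x) = kern lam alpha J n x"
  by (simp add: kern_def)

lemma adj_kern: "(\<And>j. alpha j \<in> psd) \<Longrightarrow> adj (kern lam alpha J n x) = kern lam alpha J n x"
  by (simp add: kern_def adj_diff adj_sum adj_scaleR adj_mat_1 psd_def)

lemma even_limit:
  fixes H :: "real \<Rightarrow> 'b::euclidean_space"
  assumes F: "\<And>n. sqint (lebesgue_on {-a<..<a}) (F n)" "sqint (lebesgue_on {-a<..<a}) H"
    and lim: "(\<lambda>n. nrm2 (lebesgue_on {-a<..<a}) (\<lambda>x. F n x - H x)) \<longlonglongrightarrow> 0"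
    and even: "\<And>n x. F n (- x) = F n x"
  shows "AE x in lebesgue_on {-a<..<a}. H (- x) = H x"
proof -
  obtain r where r: "AE x in lebesgue_on {-a<..<a}. (\<lambda>n. F (r n) x) \<longlonglongrightarrow> H x"
    using nrm2_tendsto_AE_subseq[OF F lim] by blast
  have 1: "AE x in lborel. x \<in> {-a<..<a} \<longrightarrow> (\<lambda>n. F (r n) x) \<longlonglongrightarrow> H x"
    using r by (subst (asm) AE_lebesgue_on_iff) auto
  from AE_lborel_affine[OF this, of "-1" 0]
  have 2: "AE x in lborel. - x \<in> {-a<..<a} \<longrightarrow> (\<lambda>n. F (r n) x) \<longlonglongrightarrow> H (- x)"
    by (simp add: even)
  show ?thesis
    by (subst AE_lebesgue_on_iff, simp) (use 1 2 in \<open>eventually_elim; auto intro: LIMSEQ_unique\<close>)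
qed

lemma adj_limit:
  fixes H :: "real \<Rightarrow> complex^'r^'r"
  assumes F: "\<And>n. sqint M (F n)" "sqint M H"
    and lim: "(\<lambda>n. nrm2 M (\<lambda>x. F n x - H x)) \<longlonglongrightarrow> 0"
    and adj: "\<And>n x. adj (F n x) = F n x"
  shows "AE x in M. H x = adj (H x)"
proof -
  obtain r where "AE x in M. (\<lambda>n. F (r n) x) \<longlonglongrightarrow> H x"
    using nrm2_tendsto_AE_subseq[OF F lim] by blast
  then show ?thesis
  proof eventually_elim
    case (elim x)
    from bounded_linear.tendsto[OF bounded_linear_adj this] have "(\<lambda>n. F (r n) x) \<longlonglongrightarrow> adj (H x)"
      by (simp add: adj)
    with elim show ?case by (rule LIMSEQ_unique)
  qed
qed

text \<open>Almost everywhere equal Borel representatives, extended by zero.\<close>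

lemma borel_representative:
  fixes f :: "real \<Rightarrow> 'b::euclidean_space"
  assumes f: "f \<in> borel_measurable (lebesgue_on S)" and S: "S \<in> sets borel"
  shows "\<exists>g\<in>borel_measurable borel. (\<forall>x. x \<notin> S \<longrightarrow> g x = 0) \<and> (AE x in lborel. x \<in> S \<longrightarrow> g x = f x)"
proof -
  have m: "(\<lambda>x. indicator S x *\<^sub>R f x) \<in> borel_measurable lebesgue"
    using f S by (subst (asm) borel_measurable_restrict_space_iff) auto
  have "\<exists>g'\<in>borel_measurable lborel. AE x in lborel. (indicator S x *\<^sub>R f x) \<bullet> b = g' x" for b
    by (rule completion_ex_borel_measurable_real) (use m in measurable)
  then obtain g' where g': "\<And>b. g' b \<in> borel_measurable lborel"
    "\<And>b. AE x in lborel. (indicator S x *\<^sub>R f x) \<bullet> b = g' b x" by metis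
  define g where "g x = indicator S x *\<^sub>R (\<Sum>b\<in>Basis. g' b x *\<^sub>R b)" for x
  have "AE x in lborel. \<forall>b\<in>Basis. (indicator S x *\<^sub>R f x) \<bullet> b = g' b x"
    using g'(2) by (subst AE_finite_all) auto
  then have "AE x in lborel. x \<in> S \<longrightarrow> g x = f x"
  proof eventually_elim
    case (elim x)
    have "(\<Sum>b\<in>Basis. g' b x *\<^sub>R b) = (\<Sum>b\<in>Basis. (f x \<bullet> b) *\<^sub>R b)" if "x \<in> S"
      using elim that by (intro sum.cong) auto
    then show ?case by (auto simp: g_def euclidean_representation)
  qed
  moreover have "g \<in> borel_measurable borel"
    unfolding g_def[abs_def] using S g'(1) by measurable
  ultimately show ?thesis by (intro bexI[of _ g]) (auto simp: g_def)
qed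

lemma borel_measurable_lebesgue_on_AE:
  fixes f g :: "real \<Rightarrow> 'b::euclidean_space"
  assumes "S \<in> sets borel" "g \<in> borel_measurable borel" "AE x in lborel. x \<in> S \<longrightarrow> g x = f x"
  shows "f \<in> borel_measurable (lebesgue_on S)"
proof -
  have m: "(\<lambda>x. indicator S x *\<^sub>R g x) \<in> borel_measurable lebesgue"
    by (rule measurable_completion) (use assms in measurable)
  have "AE x in lborel. indicator S x *\<^sub>R g x = indicator S x *\<^sub>R f x"
    using assms(3) by eventually_elim (auto simp: indicator_def)
  then have "AE x in lebesgue. indicator S x *\<^sub>R g x = indicator S x *\<^sub>R f x"
    by (simp only: AE_completion_iff)
  from borel_measurable_AE[OF m this] show ?thesis
    using assms(1) by (subst borel_measurable_restrict_space_iff) auto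
qed

lemma integral_lebesgue_on_representative:
  fixes f g :: "real \<Rightarrow> 'b::euclidean_space"
  assumes "f \<in> borel_measurable (lebesgue_on S)" "S \<in> sets borel" "g \<in> borel_measurable borel"
    and "\<And>x. x \<notin> S \<Longrightarrow> g x = 0" "AE x in lborel. x \<in> S \<longrightarrow> g x = f x"
  shows "(LINT x|lebesgue_on S. f x) = (LINT x|lborel. g x)"
    and "integrable (lebesgue_on S) f \<longleftrightarrow> integrable lborel g"
proof -
  have m: "(\<lambda>x. indicator S x *\<^sub>R f x) \<in> borel_measurable lebesgue"
    using assms(1,2) by (subst (asm) borel_measurable_restrict_space_iff) auto
  have m': "g \<in> borel_measurable lebesgue" using assms(3) by (simp add: measurable_completion)
  have ae: "AE x in lebesgue. indicator S x *\<^sub>R f x = g x"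
  proof (subst AE_completion_iff)
    show "AE x in lborel. indicator S x *\<^sub>R f x = g x"
      using assms(5)
    proof eventually_elim
      case (elim x)
      then show ?case using assms(4)[of x] by (cases "x \<in> S") auto
    qed
  qed
  have "(LINT x|lebesgue_on S. f x) = (LINT x|lebesgue. indicator S x *\<^sub>R f x)"
    using assms(2) by (simp add: integral_restrict_space)
  also have "\<dots> = (LINT x|lebesgue. g x)" using m m' ae by (rule integral_cong_AE)
  also have "\<dots> = (LINT x|lborel. g x)" using assms(3) by (simp add: integral_completion)
  finally show "(LINT x|lebesgue_on S. f x) = (LINT x|lborel. g x)" .
  have "integrable (lebesgue_on S) f \<longleftrightarrow> integrable lebesgue (\<lambda>x. indicator S x *\<^sub>R f x)"
    using assms(2) by (simp add: integrable_restrict_space)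
  also have "\<dots> \<longleftrightarrow> integrable lebesgue g" using m m' ae by (rule integrable_cong_AE)
  also have "\<dots> \<longleftrightarrow> integrable lborel g" using assms(3) by (simp add: integrable_completion)
  finally show "integrable (lebesgue_on S) f \<longleftrightarrow> integrable lborel g" .
qed

lemma sqint_representative:
  fixes f g :: "real \<Rightarrow> 'b::euclidean_space"
  assumes "f \<in> borel_measurable (lebesgue_on S)" "S \<in> sets borel" "g \<in> borel_measurable borel"
    and "\<And>x. x \<notin> S \<Longrightarrow> g x = 0" "AE x in lborel. x \<in> S \<longrightarrow> g x = f x"
  shows "sqint (lebesgue_on S) f \<longleftrightarrow> sqint lborel g" "nrm2 (lebesgue_on S) f = nrm2 lborel g"
proof -
  have *: "(\<lambda>x. (norm (f x))\<^sup>2) \<in> borel_measurable (lebesgue_on S)" "(\<lambda>x. (norm (g x))\<^sup>2) \<in> borel_measurable borel"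
    using assms by measurable
  have "AE x in lborel. x \<in> S \<longrightarrow> (norm (g x))\<^sup>2 = (norm (f x))\<^sup>2"
    using assms(5) by eventually_elim auto
  note ** = integral_lebesgue_on_representative[OF *(1) assms(2) *(2) _ this]
  show "sqint (lebesgue_on S) f \<longleftrightarrow> sqint lborel g"
    using **(2) assms by (auto simp: sqint_def)
  show "nrm2 (lebesgue_on S) f = nrm2 lborel g"
    using **(1) assms(4) by (simp add: nrm2_def)
qed

section \<open>Convolution operators and trigonometric coefficients\<close>

lemma borel_measurable_matrix_vector_mult [measurable (raw)]:
  fixes A :: "'a \<Rightarrow> complex^'n^'m"
  assumes "A \<in> borel_measurable M" "v \<in> borel_measurable M"
  shows "(\<lambda>x. A x *v v x) \<in> borel_measurable M"
  using assms by (rule borel_measurable_continuous_Pair) (intro mv.continuous_on continuous_intros)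

lemma sqint_lborel_affine:
  fixes f :: "real \<Rightarrow> 'b::euclidean_space"
  assumes "sqint lborel f" "c \<noteq> 0" shows "sqint lborel (\<lambda>x. f (t + c * x))"
  unfolding sqint_def
proof
  show "(\<lambda>x. f (t + c * x)) \<in> borel_measurable lborel" using sqintD(1)[OF assms(1)] by measurable
  show "integrable lborel (\<lambda>x. (norm (f (t + c * x)))\<^sup>2)"
    using lborel_integrable_real_affine[OF sqintD(2)[OF assms(1)] assms(2)] .
qed

lemma nrm2_lborel_affine:
  fixes f :: "real \<Rightarrow> 'b::euclidean_space"
  assumes "\<bar>c\<bar> = 1" shows "nrm2 lborel (\<lambda>x. f (t + c * x)) = nrm2 lborel f"
  unfolding nrm2_def using assms
  by (subst (2) lborel_integral_real_affine[of c _ t]) auto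

text \<open>
  Convolution over the line. Functions on \<open>(0, 1)\<close> and kernels on \<open>(-1, 1)\<close> are extended by zero,
  so on \<open>(0, 1)\<close> this is the integral operator of the accelerant equation.
\<close>

definition conv :: "(real \<Rightarrow> complex^'r^'r) \<Rightarrow> (real \<Rightarrow> complex^'r) \<Rightarrow> real \<Rightarrow> complex^'r" where
  "conv K g x = (LINT t|lborel. K (x - t) *v g t)"

lemma conv_integrable:
  fixes K :: "real \<Rightarrow> complex^'r^'r" and g :: "real \<Rightarrow> complex^'r"
  assumes K: "sqint lborel K" and g: "sqint lborel g"
  shows "integrable lborel (\<lambda>t. K (x - t) *v g t)"
proof (rule Bochner_Integration.integrable_bound)
  have K': "sqint lborel (\<lambda>t. K (x - t))" using sqint_lborel_affine[OF K, of "-1" x] by simp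
  show "integrable lborel (\<lambda>t. norm (K (x - t)) * norm (g t))"
    by (rule sqint_mult_integrable[OF K' g])
  show "(\<lambda>t. K (x - t) *v g t) \<in> borel_measurable lborel"
    using sqintD(1)[OF K] sqintD(1)[OF g] by measurable
qed (auto simp: norm_matrix_vector_mult_le)

lemma norm_conv_le:
  fixes K :: "real \<Rightarrow> complex^'r^'r" and g :: "real \<Rightarrow> complex^'r"
  assumes K: "sqint lborel K" and g: "sqint lborel g"
  shows "norm (conv K g x) \<le> nrm2 lborel K * nrm2 lborel g"
proof -
  have K': "sqint lborel (\<lambda>t. K (x - t))" using sqint_lborel_affine[OF K, of "-1" x] by simp
  have "norm (conv K g x) \<le> (LINT t|lborel. norm (K (x - t)) * norm (g t))"
    unfolding conv_def
    by (rule Bochner_Integration.integral_norm_bound_integral[OF conv_integrable[OF K g] sqint_mult_integrable[OF K' g]])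
      (rule norm_matrix_vector_mult_le)
  also have "\<dots> \<le> nrm2 lborel (\<lambda>t. K (x - t)) * nrm2 lborel g"
    by (rule nrm2_Cauchy_Schwarz[OF K' g])
  finally show ?thesis using nrm2_lborel_affine[of "-1" K x] by simp
qed

lemma conv_diff:
  fixes K :: "real \<Rightarrow> complex^'r^'r" and g :: "real \<Rightarrow> complex^'r"
  assumes "sqint lborel K" "sqint lborel L" "sqint lborel g"
  shows "conv (\<lambda>x. K x - L x) g x = conv K g x - conv L g x"
  unfolding conv_def using assms by (simp add: mv.diff_left conv_integrable)

lemma borel_measurable_conv:
  assumes [measurable]: "K \<in> borel_measurable borel" "g \<in> borel_measurable borel"
  shows "conv K g \<in> borel_measurable borel"
  unfolding conv_def by measurable

text \<open>Cosine and sine coefficients at frequency \<open>w\<close>, as integrals over the line.\<close>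

definition cos_transform :: "real \<Rightarrow> (real \<Rightarrow> complex^'r) \<Rightarrow> complex^'r" where
  "cos_transform w g = (LINT t|lborel. cos (w * t) *\<^sub>R g t)"

definition sin_transform :: "real \<Rightarrow> (real \<Rightarrow> complex^'r) \<Rightarrow> complex^'r" where
  "sin_transform w g = (LINT t|lborel. sin (w * t) *\<^sub>R g t)"

lemma integrable_bounded_scaleR:
  fixes g :: "real \<Rightarrow> 'b::euclidean_space" and c :: "real \<Rightarrow> real"
  assumes "integrable lborel g" "c \<in> borel_measurable borel" "\<And>t. \<bar>c t\<bar> \<le> 1"
  shows "integrable lborel (\<lambda>t. c t *\<^sub>R g t)"
  by (rule Bochner_Integration.integrable_bound[OF assms(1)])
    (use assms in \<open>auto intro!: mult_left_le_one_le\<close>)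

lemma cos_shift_integral:
  fixes g :: "real \<Rightarrow> complex^'r"
  assumes "integrable lborel g"
  shows "(LINT t|lborel. cos (w * t - s) *\<^sub>R g t) = cos s *\<^sub>R cos_transform w g + sin s *\<^sub>R sin_transform w g"
proof -
  have i: "integrable lborel (\<lambda>t. cos (w * t) *\<^sub>R g t)" "integrable lborel (\<lambda>t. sin (w * t) *\<^sub>R g t)"
    by (rule integrable_bounded_scaleR[OF assms]; simp)+
  have "(\<lambda>t. cos (w * t - s) *\<^sub>R g t)
      = (\<lambda>t. cos s *\<^sub>R (cos (w * t) *\<^sub>R g t) + sin s *\<^sub>R (sin (w * t) *\<^sub>R g t))"
    by (auto simp: cos_diff scaleR_add_left mult.commute)
  then show ?thesis
    unfolding cos_transform_def sin_transform_def using i by (simp del: scaleR_scaleR)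
qed

text \<open>For \<open>g\<close> supported in \<open>(0, 1)\<close>, the \<open>n\<close>-th partial sum of its Fourier series of period one.\<close>

definition fourier_sum :: "nat \<Rightarrow> (real \<Rightarrow> complex^'r) \<Rightarrow> real \<Rightarrow> complex^'r" where
  "fourier_sum n g x = cos_transform 0 g + (\<Sum>k=1..n. 2 *\<^sub>R (cos (2 * pi * real k * x) *\<^sub>R cos_transform (2 * pi * real k) g
      + sin (2 * pi * real k * x) *\<^sub>R sin_transform (2 * pi * real k) g))"

text \<open>The kernel cut off outside \<open>(-1, 1)\<close>, which contains all differences of points of \<open>(0, 1)\<close>.\<close>

definition kern_cut :: "(nat \<Rightarrow> real) \<Rightarrow> (nat \<Rightarrow> complex^'r^'r) \<Rightarrow> nat set \<Rightarrow> nat \<Rightarrow> real \<Rightarrow> complex^'r^'r" where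
  "kern_cut lam alpha J n x = indicator {-1<..<1} x *\<^sub>R kern lam alpha J n x"

lemma borel_measurable_kern_cut [measurable]: "kern_cut lam alpha J n \<in> borel_measurable borel"
  unfolding kern_cut_def by measurable

lemma sqint_indicator_bounded:
  fixes f :: "real \<Rightarrow> 'b::euclidean_space"
  assumes "f \<in> borel_measurable borel" "\<And>x. a < x \<Longrightarrow> x < b \<Longrightarrow> norm (f x) \<le> B"
  shows "sqint lborel (\<lambda>x. indicator {a<..<b} x *\<^sub>R f x)"
  unfolding sqint_def
proof
  show "(\<lambda>x. indicator {a<..<b} x *\<^sub>R f x) \<in> borel_measurable lborel" using assms(1) by measurable
  have "integrable lborel (\<lambda>x. indicator {a<..<b} x *\<^sub>R (norm (f x))\<^sup>2)"
    by (rule integrableI_bounded_set_indicator[where B = "B\<^sup>2"])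
      (use assms in \<open>cases "a \<le> b"; auto intro!: power_mono\<close>)+
  moreover have "(norm (indicator {a<..<b} x *\<^sub>R f x))\<^sup>2 = indicator {a<..<b} x *\<^sub>R (norm (f x))\<^sup>2" for x
    by (auto simp: indicator_def)
  ultimately show "integrable lborel (\<lambda>x. (norm (indicator {a<..<b} x *\<^sub>R f x))\<^sup>2)" by simp
qed

lemma sqint_kern_cut: "sqint lborel (kern_cut lam alpha J n)"
  unfolding kern_cut_def[abs_def] by (rule sqint_indicator_bounded[OF borel_measurable_kern norm_kern_le])

lemma sqint_supported_integrable:
  fixes g :: "real \<Rightarrow> 'b::euclidean_space"
  assumes g: "sqint lborel g" and supp: "\<And>x. x \<notin> {a<..<b} \<Longrightarrow> g x = 0"
  shows "integrable lborel g"
proof -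
  have 1: "sqint lborel (\<lambda>x. indicator {a<..<b} x *\<^sub>R (1::real))"
    by (rule sqint_indicator_bounded[of _ _ _ 1]) auto
  have "integrable lborel (\<lambda>x. norm (g x) * norm (indicator {a<..<b} x *\<^sub>R (1::real)))"
    by (rule sqint_mult_integrable[OF g 1])
  moreover have "norm (g x) * norm (indicator {a<..<b} x *\<^sub>R (1::real)) = norm (g x)" for x
    using supp[of x] by (auto simp: indicator_def)
  ultimately have "integrable lborel (\<lambda>x. norm (g x))" by (simp only:)
  then show ?thesis using sqintD(1)[OF g] by (simp add: integrable_norm_iff)
qed

lemma conv_kern_cut:
  fixes alpha :: "nat \<Rightarrow> complex^'r^'r"
  assumes J: "finite J" and g: "integrable lborel g" and supp: "\<And>x. x \<notin> {0<..<1} \<Longrightarrow> g x = 0"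
    and x: "x \<in> {0..1}"
  shows "conv (kern_cut lam alpha J n) g x
    = (\<Sum>j\<in>J. 2 *\<^sub>R (cos (2 * lam j * x) *\<^sub>R (alpha j *v cos_transform (2 * lam j) g)
        + sin (2 * lam j * x) *\<^sub>R (alpha j *v sin_transform (2 * lam j) g))) - fourier_sum n g x"
proof -
  have i: "integrable lborel (\<lambda>t. cos (w * t - s) *\<^sub>R g t)" for w s
    by (rule integrable_bounded_scaleR[OF g]) auto
  have ij: "integrable lborel (\<lambda>t. alpha j *v (cos (w * t - s) *\<^sub>R g t))" for j w s
    by (rule integrable_bounded_linear[OF mv.bounded_linear_right i])
  have pt: "kern_cut lam alpha J n (x - t) *v g t
      = (\<Sum>j\<in>J. 2 *\<^sub>R (alpha j *v (cos (2 * lam j * t - 2 * lam j * x) *\<^sub>R g t)))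
        - (g t + (\<Sum>k=1..n. 2 *\<^sub>R (cos (2 * pi * real k * t - 2 * pi * real k * x) *\<^sub>R g t)))" for t
  proof (cases "t \<in> {0<..<1}")
    case True
    have c: "cos (w * (x - t)) = cos (w * t - w * x)" for w
      using cos_minus[of "w * (x - t)"] by (simp add: algebra_simps)
    have "x - t \<in> {-1<..<1}" using True x by auto
    then show ?thesis
      by (simp add: kern_cut_def kern_def mv.diff_left mv.sum_left mv.scaleR_left mv.scaleR_right
          mv.add_left matrix_vector_mul_lid scaleR_add_left scaleR_sum_left c)
  next
    case False
    then show ?thesis using supp[of t] by (simp add: mv.zero_right)
  qed
  have "conv (kern_cut lam alpha J n) g x
      = (\<Sum>j\<in>J. 2 *\<^sub>R (LINT t|lborel. alpha j *v (cos (2 * lam j * t - 2 * lam j * x) *\<^sub>R g t)))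
        - ((LINT t|lborel. g t) + (\<Sum>k=1..n. 2 *\<^sub>R (LINT t|lborel. cos (2 * pi * real k * t - 2 * pi * real k * x) *\<^sub>R g t)))"
    unfolding conv_def pt using i ij g by (simp del: scaleR_scaleR)
  also have "\<dots> = (\<Sum>j\<in>J. 2 *\<^sub>R (alpha j *v (LINT t|lborel. cos (2 * lam j * t - 2 * lam j * x) *\<^sub>R g t)))
        - ((LINT t|lborel. g t) + (\<Sum>k=1..n. 2 *\<^sub>R (LINT t|lborel. cos (2 * pi * real k * t - 2 * pi * real k * x) *\<^sub>R g t)))"
    by (simp add: integral_bounded_linear[OF mv.bounded_linear_right i])
  also have "\<dots> = (\<Sum>j\<in>J. 2 *\<^sub>R (cos (2 * lam j * x) *\<^sub>R (alpha j *v cos_transform (2 * lam j) g)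
        + sin (2 * lam j * x) *\<^sub>R (alpha j *v sin_transform (2 * lam j) g))) - fourier_sum n g x"
    by (simp add: cos_shift_integral[OF g] fourier_sum_def mv.add_right mv.scaleR_right cos_transform_def[of 0])
  finally show ?thesis .
qed

text \<open>
  Orthogonal projection onto finitely many real functions of square norms \<open>w i\<close>, with vector coefficients.
\<close>

lemma orthogonal_projection:
  fixes e :: "'i \<Rightarrow> 'a \<Rightarrow> real" and g :: "'a \<Rightarrow> 'b::euclidean_space"
  assumes I: "finite I" and e: "\<And>i. i \<in> I \<Longrightarrow> sqint M (e i)" and g: "sqint M g"
    and orth: "\<And>i j. i \<in> I \<Longrightarrow> j \<in> I \<Longrightarrow> (LINT x|M. e i x * e j x) = (if i = j then w i else 0)"
    and w: "\<And>i. i \<in> I \<Longrightarrow> w i \<noteq> 0"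
    and int: "\<And>i. i \<in> I \<Longrightarrow> integrable M (\<lambda>x. e i x *\<^sub>R g x)"
  defines "s \<equiv> (\<lambda>x. \<Sum>i\<in>I. (e i x / w i) *\<^sub>R (LINT y|M. e i y *\<^sub>R g y))"
  shows "sqint M s" "(nrm2 M (\<lambda>x. g x - s x))\<^sup>2 = (LINT x|M. g x \<bullet> (g x - s x))"
proof -
  define c where "c i = (LINT y|M. e i y *\<^sub>R g y)" for i
  define d where "d i = (1 / w i) *\<^sub>R c i" for i
  have s: "s = (\<lambda>x. \<Sum>i\<in>I. e i x *\<^sub>R d i)" by (auto simp: s_def d_def c_def)
  have ed: "sqint M (\<lambda>x. e i x *\<^sub>R d i)" if "i \<in> I" for i
  proof (rule sqint_bound[OF sqint_scaleR[OF e[OF that], of "norm (d i)"]])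
    show "(\<lambda>x. e i x *\<^sub>R d i) \<in> borel_measurable M" using sqintD(1)[OF e[OF that]] by measurable
  qed (auto simp: mult.commute)
  show sq: "sqint M s" unfolding s by (rule sqint_sum) (rule ed)
  have gs: "(LINT x|M. g x \<bullet> s x) = (\<Sum>i\<in>I. c i \<bullet> d i)"
  proof -
    have "(LINT x|M. g x \<bullet> s x) = (LINT x|M. (\<Sum>i\<in>I. (e i x *\<^sub>R g x) \<bullet> d i))"
      unfolding s by (simp add: inner_sum_right)
    also have "\<dots> = (\<Sum>i\<in>I. (LINT x|M. (e i x *\<^sub>R g x) \<bullet> d i))"
      by (intro Bochner_Integration.integral_sum integrable_inner_left int)
    also have "\<dots> = (\<Sum>i\<in>I. c i \<bullet> d i)"
      unfolding c_def by (intro sum.cong refl integral_inner_left int)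
    finally show ?thesis .
  qed
  have ee: "integrable M (\<lambda>x. e i x * e j x)" if "i \<in> I" "j \<in> I" for i j
    using sqint_inner_integrable[OF e[OF that(1)] e[OF that(2)]] by simp
  have ss: "(LINT x|M. s x \<bullet> s x) = (\<Sum>i\<in>I. c i \<bullet> d i)"
  proof -
    have "(LINT x|M. s x \<bullet> s x) = (LINT x|M. (\<Sum>i\<in>I. \<Sum>j\<in>I. (e i x * e j x) * (d i \<bullet> d j)))"
      unfolding s by (simp add: inner_sum_left inner_sum_right sum_distrib_left mult_ac inner_commute)
    also have "\<dots> = (\<Sum>i\<in>I. \<Sum>j\<in>I. (LINT x|M. e i x * e j x) * (d i \<bullet> d j))"
      using ee by (simp add: Bochner_Integration.integral_sum)
    also have "\<dots> = (\<Sum>i\<in>I. \<Sum>j\<in>I. if i = j then w i * (d i \<bullet> d i) else 0)"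
      by (intro sum.cong refl) (auto simp: orth)
    also have "\<dots> = (\<Sum>i\<in>I. w i * (d i \<bullet> d i))" using I by simp
    also have "\<dots> = (\<Sum>i\<in>I. c i \<bullet> d i)" using w by (intro sum.cong) (auto simp: d_def)
    finally show ?thesis .
  qed
  have i: "integrable M (\<lambda>x. g x \<bullet> g x)" "integrable M (\<lambda>x. g x \<bullet> s x)" "integrable M (\<lambda>x. s x \<bullet> s x)"
    by (rule sqint_inner_integrable[OF g g] sqint_inner_integrable[OF g sq] sqint_inner_integrable[OF sq sq])+
  have "(norm (g x - s x))\<^sup>2 = g x \<bullet> (g x - s x) - (g x \<bullet> s x - s x \<bullet> s x)" for x
    by (simp add: power2_norm_eq_inner inner_diff_left inner_diff_right inner_commute)
  then have "(nrm2 M (\<lambda>x. g x - s x))\<^sup>2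
      = (LINT x|M. g x \<bullet> (g x - s x)) - ((LINT x|M. g x \<bullet> s x) - (LINT x|M. s x \<bullet> s x))"
    using i by (simp add: nrm2_sq inner_diff_right)
  then show "(nrm2 M (\<lambda>x. g x - s x))\<^sup>2 = (LINT x|M. g x \<bullet> (g x - s x))" by (simp add: gs ss)
qed

lemma fourier_sum_projection:
  fixes g :: "real \<Rightarrow> complex^'r" and n :: nat
  assumes g: "sqint lborel g" and supp: "\<And>x. x \<notin> {0<..<1} \<Longrightarrow> g x = 0"
  defines "s \<equiv> (\<lambda>x. indicator {0<..<1} x *\<^sub>R fourier_sum n g x)"
  shows "sqint lborel s" "(nrm2 lborel (\<lambda>x. g x - s x))\<^sup>2 = (LINT x|lborel. g x \<bullet> (g x - fourier_sum n g x))"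
proof -
  define b where "b i x = (case i of Inl k \<Rightarrow> cos (2 * pi * real k * x) | Inr k \<Rightarrow> sin (2 * pi * real k * x))"
    for i :: "nat + nat" and x :: real
  define e where "e i x = indicator {0<..<1::real} x * b i x" for i x
  define w where "w i = (if i = Inl 0 then 1 else 1/2 :: real)" for i :: "nat + nat"
  define I where "I = {0..n} <+> {1..n}"
  have bm [measurable]: "b i \<in> borel_measurable borel" for i
    unfolding b_def[abs_def] by (cases i) auto
  have b1: "\<bar>b i x\<bar> \<le> 1" for i x by (cases i) (auto simp: b_def)
  have e: "sqint lborel (e i)" for i
    using sqint_indicator_bounded[of "b i" 0 1 1] b1 by (simp add: e_def[abs_def])
  have gi: "integrable lborel g" by (rule sqint_supported_integrable[OF g supp])
  have eg: "e i x *\<^sub>R g x = b i x *\<^sub>R g x" for i x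
    using supp[of x] by (cases "x \<in> {0<..<1}") (auto simp: e_def)
  have int: "integrable lborel (\<lambda>x. e i x *\<^sub>R g x)" for i
    unfolding eg by (rule integrable_bounded_scaleR[OF gi bm b1])
  have orth: "(LINT x|lborel. e i x * e j x) = (if i = j then w i else 0)" if "i \<in> I" "j \<in> I" for i j
  proof -
    have cont: "continuous_on {0..1} (\<lambda>x. b i x * b j x)"
      unfolding b_def by (cases i; cases j) (auto intro!: continuous_intros)
    have "AE x in lborel. x \<noteq> (0::real)" "AE x in lborel. x \<noteq> (1::real)" by (rule AE_lborel_singleton)+
    then have "AE x in lborel. e i x * e j x = indicator {0..1} x *\<^sub>R (b i x * b j x)"
      by eventually_elim (auto simp: e_def indicator_def)
    then have "(LINT x|lborel. e i x * e j x) = (LINT x:{0..1}|lborel. b i x * b j x)"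
      unfolding set_lebesgue_integral_def
      using sqintD(1)[OF e] by (intro integral_cong_AE) auto
    also have "\<dots> = integral {0..1} (\<lambda>x. b i x * b j x)"
      by (rule set_borel_integral_eq_integral) (rule borel_integrable_atLeastAtMost'[OF cont])
    also have "\<dots> = (if i = j then w i else 0)"
      using that integral_cos_cos[of 0 1] integral_sin_sin[of 0 1] integral_sin_cos[of 0 1]
      by (cases i; cases j) (auto simp: b_def w_def I_def mult.commute[of "cos _" "sin _"])
    finally show ?thesis .
  qed
  have fin: "finite I" by (simp add: I_def)
  have s: "s = (\<lambda>x. \<Sum>i\<in>I. (e i x / w i) *\<^sub>R (LINT y|lborel. e i y *\<^sub>R g y))"
  proof
    fix x
    have "(\<Sum>i\<in>I. (e i x / w i) *\<^sub>R (LINT y|lborel. e i y *\<^sub>R g y))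
        = (\<Sum>k\<in>{0..n}. (e (Inl k) x / w (Inl k)) *\<^sub>R cos_transform (2 * pi * real k) g)
        + (\<Sum>k\<in>{1..n}. (e (Inr k) x / w (Inr k)) *\<^sub>R sin_transform (2 * pi * real k) g)"
      unfolding eg I_def by (simp add: sum.Plus b_def cos_transform_def sin_transform_def)
    also have "{0..n} = insert 0 {1..n}" by auto
    also have "(\<Sum>k\<in>insert 0 {1..n}. (e (Inl k) x / w (Inl k)) *\<^sub>R cos_transform (2 * pi * real k) g)
        = indicator {0<..<1} x *\<^sub>R cos_transform 0 g
          + (\<Sum>k\<in>{1..n}. (indicator {0<..<1} x * (2 * cos (2 * pi * real k * x))) *\<^sub>R cos_transform (2 * pi * real k) g)"
      by (subst sum.insert) (auto simp: e_def b_def w_def intro!: sum.cong)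
    also have "(\<Sum>k\<in>{1..n}. (e (Inr k) x / w (Inr k)) *\<^sub>R sin_transform (2 * pi * real k) g)
        = (\<Sum>k\<in>{1..n}. (indicator {0<..<1} x * (2 * sin (2 * pi * real k * x))) *\<^sub>R sin_transform (2 * pi * real k) g)"
      by (auto simp: e_def b_def w_def intro!: sum.cong)
    finally show "s x = (\<Sum>i\<in>I. (e i x / w i) *\<^sub>R (LINT y|lborel. e i y *\<^sub>R g y))"
      by (simp add: s_def fourier_sum_def scaleR_add_right scaleR_sum_right sum.distrib)
  qed
  show "sqint lborel s"
    unfolding s by (rule orthogonal_projection(1)[OF fin e g orth _ int]) (auto simp: w_def)
  have "(nrm2 lborel (\<lambda>x. g x - s x))\<^sup>2 = (LINT x|lborel. g x \<bullet> (g x - s x))"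
    unfolding s by (rule orthogonal_projection(2)[OF fin e g orth _ int]) (auto simp: w_def)
  also have "\<dots> = (LINT x|lborel. g x \<bullet> (g x - fourier_sum n g x))"
  proof (intro Bochner_Integration.integral_cong refl)
    show "g x \<bullet> (g x - s x) = g x \<bullet> (g x - fourier_sum n g x)" for x
      using supp[of x] by (cases "x \<in> {0<..<1}") (auto simp: s_def)
  qed
  finally show "(nrm2 lborel (\<lambda>x. g x - s x))\<^sup>2 = (LINT x|lborel. g x \<bullet> (g x - fourier_sum n g x))" .
qed

text \<open>
  The quadratic form of identity plus convolution is a Bessel defect plus the contributions of the
  point masses.
\<close>

lemma quadratic_form_kern:
  fixes alpha :: "nat \<Rightarrow> complex^'r^'r"
  assumes psd: "\<And>j. alpha j \<in> psd" and J: "finite J"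
    and g: "sqint lborel g" and supp: "\<And>x. x \<notin> {0<..<1} \<Longrightarrow> g x = 0"
  shows "(LINT x|lborel. g x \<bullet> (g x + conv (kern_cut lam alpha J n) g x))
    = (nrm2 lborel (\<lambda>x. g x - indicator {0<..<1} x *\<^sub>R fourier_sum n g x))\<^sup>2
      + (\<Sum>j\<in>J. 2 * ((alpha j *v cos_transform (2 * lam j) g) \<bullet> cos_transform (2 * lam j) g
          + (alpha j *v sin_transform (2 * lam j) g) \<bullet> sin_transform (2 * lam j) g))"
proof -
  have gi: "integrable lborel g" by (rule sqint_supported_integrable[OF g supp])
  have ic: "integrable lborel (\<lambda>t. cos (w * t) *\<^sub>R g t)" "integrable lborel (\<lambda>t. sin (w * t) *\<^sub>R g t)" for w
    by (rule integrable_bounded_scaleR[OF gi]; simp)+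
  let ?C = "\<lambda>j. cos_transform (2 * lam j) g" and ?S = "\<lambda>j. sin_transform (2 * lam j) g"
  let ?q = "\<lambda>x. \<Sum>j\<in>J. 2 * ((cos (2 * lam j * x) *\<^sub>R g x) \<bullet> (alpha j *v ?C j)
      + (sin (2 * lam j * x) *\<^sub>R g x) \<bullet> (alpha j *v ?S j))"
  have pt: "g x \<bullet> (g x + conv (kern_cut lam alpha J n) g x) = g x \<bullet> (g x - fourier_sum n g x) + ?q x" for x
  proof (cases "x \<in> {0<..<1}")
    case True
    then have "x \<in> {0..1}" by auto
    from conv_kern_cut[OF J gi supp this] show ?thesis
      by (simp add: inner_add_right inner_diff_right inner_sum_right)
  qed (use supp[of x] in simp)
  have iq: "integrable lborel ?q"
    by (intro Bochner_Integration.integrable_sum integrable_mult_right Bochner_Integration.integrable_add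
        integrable_inner_left ic)
  have q: "(LINT x|lborel. ?q x) = (\<Sum>j\<in>J. 2 * ((alpha j *v ?C j) \<bullet> ?C j + (alpha j *v ?S j) \<bullet> ?S j))"
  proof -
    have gen: "(LINT x|lborel. 2 * (a x + b x)) = 2 * ((LINT x|lborel. a x) + (LINT x|lborel. b x))"
      if "integrable lborel a" "integrable lborel b" for a b :: "real \<Rightarrow> real" using that by simp
    have "(LINT x|lborel. ?q x) = (\<Sum>j\<in>J. LINT x|lborel. 2 * ((cos (2 * lam j * x) *\<^sub>R g x) \<bullet> (alpha j *v ?C j)
        + (sin (2 * lam j * x) *\<^sub>R g x) \<bullet> (alpha j *v ?S j)))"
      by (intro Bochner_Integration.integral_sum integrable_mult_right Bochner_Integration.integrable_add
          integrable_inner_left ic)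
    also have "\<dots> = (\<Sum>j\<in>J. 2 * (?C j \<bullet> (alpha j *v ?C j) + ?S j \<bullet> (alpha j *v ?S j)))"
      by (subst gen[OF integrable_inner_left[OF ic(1)] integrable_inner_left[OF ic(2)]])
        (simp add: integral_inner_left[OF ic(1)] integral_inner_left[OF ic(2)]
          cos_transform_def sin_transform_def del: inner_scaleR_left)
    finally show ?thesis by (simp add: inner_commute)
  qed
  have if': "integrable lborel (\<lambda>x. g x \<bullet> (g x - fourier_sum n g x))"
  proof -
    have "integrable lborel (\<lambda>x. g x \<bullet> (g x - indicator {0<..<1} x *\<^sub>R fourier_sum n g x))"
      by (intro sqint_inner_integrable sqint_diff g fourier_sum_projection(1) supp)
    also have "(\<lambda>x. g x \<bullet> (g x - indicator {0<..<1} x *\<^sub>R fourier_sum n g x)) = (\<lambda>x. g x \<bullet> (g x - fourier_sum n g x))"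
      using supp by (force simp: indicator_def)
    finally show ?thesis .
  qed
  have nf: "(nrm2 lborel (\<lambda>x. g x - indicator {0<..<1} x *\<^sub>R fourier_sum n g x))\<^sup>2
      = (LINT x|lborel. g x \<bullet> (g x - fourier_sum n g x))"
    using fourier_sum_projection(2)[OF g supp] .
  show ?thesis
    unfolding pt nf q[symmetric]
    by (rule Bochner_Integration.integral_add[OF if' iq])
qed

section \<open>Vanishing of the form forces annihilation by the point masses\<close>

lemma norm_indicator_scaleR_sq: "(norm (indicator A x *\<^sub>R v))\<^sup>2 = indicator A x * (norm v)\<^sup>2"
  by (simp add: indicator_def)

lemma nrm2_indicator_le:
  fixes f :: "real \<Rightarrow> 'b::euclidean_space"
  assumes "f \<in> borel_measurable borel" "\<And>x. x \<in> {0<..<1} \<Longrightarrow> norm (f x) \<le> B" "0 \<le> B"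
  shows "nrm2 lborel (\<lambda>x. indicator {0<..<1::real} x *\<^sub>R f x) \<le> B"
proof -
  have "sqint lborel (\<lambda>x. indicator {0<..<1::real} x *\<^sub>R B)"
    by (rule sqint_indicator_bounded[of _ _ _ B]) (use assms in auto)
  then have "nrm2 lborel (\<lambda>x. indicator {0<..<1::real} x *\<^sub>R f x) \<le> nrm2 lborel (\<lambda>x. indicator {0<..<1::real} x *\<^sub>R B)"
    by (rule nrm2_mono) (use assms in \<open>auto simp: indicator_def\<close>)
  also have "\<dots> = B"
    unfolding nrm2_def norm_indicator_scaleR_sq using assms(3) by simp
  finally show ?thesis .
qed

text \<open>
  Annihilation: all cosine and sine coefficients of \<open>g\<close> at the frequencies \<open>2 lam j\<close> lie in the
  kernel of \<open>alpha j\<close>.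
\<close>

definition annihilated :: "(nat \<Rightarrow> real) \<Rightarrow> (nat \<Rightarrow> complex^'r^'r) \<Rightarrow> (real \<Rightarrow> complex^'r) \<Rightarrow> bool" where
  "annihilated lam alpha g \<longleftrightarrow> (\<forall>j. alpha j *v cos_transform (2 * lam j) g = 0 \<and> alpha j *v sin_transform (2 * lam j) g = 0)"

text \<open>
  The setting: \<open>H\<close> is the limit, in \<open>L_2\<close> of the line, of the kernels cut off outside \<open>(-1, 1)\<close>
  whose point masses run through an exhausting sequence of finite index sets.
\<close>

locale point_mass_kernel =
  fixes lam :: "nat \<Rightarrow> real" and alpha :: "nat \<Rightarrow> complex^'r^'r" and J :: "nat \<Rightarrow> nat set"
    and H :: "real \<Rightarrow> complex^'r^'r"
  assumes psd: "\<And>j. alpha j \<in> psd"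
    and finJ: "\<And>n. finite (J n)"
    and exhaust: "\<And>j. \<exists>N. \<forall>n\<ge>N. j \<in> J n"
    and H: "sqint lborel H"
    and lim: "(\<lambda>n. nrm2 lborel (\<lambda>x. kern_cut lam alpha (J n) n x - H x)) \<longlonglongrightarrow> 0"
begin

text \<open>The distance in \<open>L_2\<close> of the line between the \<open>n\<close>-th cut off kernel and \<open>H\<close>.\<close>

definition err :: "nat \<Rightarrow> real" where
  "err n = nrm2 lborel (\<lambda>x. kern_cut lam alpha (J n) n x - H x)"

lemma err_nonneg: "0 \<le> err n"
  by (simp add: err_def nrm2_nonneg)

lemma err_tendsto: "err \<longlonglongrightarrow> 0"
  using lim by (simp add: err_def[abs_def])

lemma borel_measurable_H [measurable]: "H \<in> borel_measurable borel"
  using sqintD(1)[OF H] by simp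

lemma norm_conv_kern_diff_le:
  assumes g: "sqint lborel g"
  shows "norm (conv (kern_cut lam alpha (J n) n) g x - conv H g x) \<le> err n * nrm2 lborel g"
  using norm_conv_le[OF sqint_diff[OF sqint_kern_cut[of lam alpha "J n" n] H] g, of x]
  by (simp add: conv_diff[OF sqint_kern_cut H g] err_def)

lemma integrable_inner_conv:
  assumes K: "sqint lborel K" and g: "sqint lborel g" and gi: "integrable lborel g"
  shows "integrable lborel (\<lambda>x. g x \<bullet> conv K g x)"
proof (rule Bochner_Integration.integrable_bound)
  show "integrable lborel (\<lambda>x. norm (g x) * (nrm2 lborel K * nrm2 lborel g))" using gi by simp
  have [measurable]: "conv K g \<in> borel_measurable borel" "g \<in> borel_measurable borel"
    using borel_measurable_conv[of K g] sqintD(1)[OF K] sqintD(1)[OF g] by simp_all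
  show "(\<lambda>x. g x \<bullet> conv K g x) \<in> borel_measurable lborel" by measurable
  show "AE x in lborel. norm (g x \<bullet> conv K g x) \<le> norm (norm (g x) * (nrm2 lborel K * nrm2 lborel g))"
  proof (rule AE_I2)
    fix x
    have "norm (g x \<bullet> conv K g x) \<le> norm (g x) * norm (conv K g x)"
      using Cauchy_Schwarz_ineq2[of "g x" "conv K g x"] by simp
    also have "\<dots> \<le> norm (g x) * (nrm2 lborel K * nrm2 lborel g)"
      by (intro mult_left_mono norm_conv_le K g) simp
    finally show "norm (g x \<bullet> conv K g x) \<le> norm (norm (g x) * (nrm2 lborel K * nrm2 lborel g))"
      by (simp add: nrm2_nonneg)
  qed
qed

lemma form_tendsto:
  assumes g: "sqint lborel g" and gi: "integrable lborel g"
  shows "(\<lambda>n. LINT x|lborel. g x \<bullet> (g x + conv (kern_cut lam alpha (J n) n) g x))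
    \<longlonglongrightarrow> (LINT x|lborel. g x \<bullet> (g x + conv H g x))"
proof -
  let ?K = "\<lambda>n. kern_cut lam alpha (J n) n"
  define c where "c = nrm2 lborel g * (LINT x|lborel. norm (g x))"
  note i = integrable_inner_conv[OF sqint_kern_cut g gi] integrable_inner_conv[OF H g gi] sqint_inner_integrable[OF g g]
  have "norm ((LINT x|lborel. g x \<bullet> (g x + conv (?K n) g x)) - (LINT x|lborel. g x \<bullet> (g x + conv H g x))) \<le> err n * c" for n
  proof -
    have "(LINT x|lborel. g x \<bullet> (g x + conv (?K n) g x)) - (LINT x|lborel. g x \<bullet> (g x + conv H g x))
        = (LINT x|lborel. g x \<bullet> conv (?K n) g x - g x \<bullet> conv H g x)"
      using i by (simp add: inner_add_right)
    also have "norm \<dots> \<le> (LINT x|lborel. norm (g x) * (err n * nrm2 lborel g))"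
    proof (rule Bochner_Integration.integral_norm_bound_integral)
      show "integrable lborel (\<lambda>x. g x \<bullet> conv (?K n) g x - g x \<bullet> conv H g x)" using i by simp
      show "integrable lborel (\<lambda>x. norm (g x) * (err n * nrm2 lborel g))" using gi by simp
      fix x
      have "norm (g x \<bullet> conv (?K n) g x - g x \<bullet> conv H g x) \<le> norm (g x) * norm (conv (?K n) g x - conv H g x)"
        using Cauchy_Schwarz_ineq2[of "g x" "conv (?K n) g x - conv H g x"] by (simp add: inner_diff_right)
      also have "\<dots> \<le> norm (g x) * (err n * nrm2 lborel g)"
        by (intro mult_left_mono norm_conv_kern_diff_le g) simp
      finally show "norm (g x \<bullet> conv (?K n) g x - g x \<bullet> conv H g x) \<le> norm (g x) * (err n * nrm2 lborel g)" .
    qed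
    also have "\<dots> = err n * c" by (simp add: c_def)
    finally show ?thesis .
  qed
  moreover have "(\<lambda>n. err n * c) \<longlonglongrightarrow> 0" using err_tendsto by (rule tendsto_mult_left_zero)
  ultimately show ?thesis
    by (subst Lim_null) (rule Lim_null_comparison[OF always_eventually], auto)
qed

context
  fixes g :: "real \<Rightarrow> complex^'r"
  assumes g: "sqint lborel g" and supp: "\<And>x. x \<notin> {0<..<1} \<Longrightarrow> g x = 0"
    and form0: "(LINT x|lborel. g x \<bullet> (g x + conv H g x)) = 0"
begin

lemma g_integrable: "integrable lborel g"
  by (rule sqint_supported_integrable[OF g supp])

text \<open>
  In the following, \<open>g\<close> is a null function: square integrable, supported in \<open>(0, 1)\<close>, with
  vanishing form.
\<close>

lemma form_kern_tendsto_0: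
  "(\<lambda>n. LINT x|lborel. g x \<bullet> (g x + conv (kern_cut lam alpha (J n) n) g x)) \<longlonglongrightarrow> 0"
  using form_tendsto[OF g g_integrable] by (simp add: form0)

lemma annihilated_form_0: "annihilated lam alpha g"
  unfolding annihilated_def
proof
  fix j
  let ?C = "cos_transform (2 * lam j) g" and ?S = "sin_transform (2 * lam j) g"
  define Q where "Q n = (LINT x|lborel. g x \<bullet> (g x + conv (kern_cut lam alpha (J n) n) g x))" for n
  obtain N where N: "\<And>n. n \<ge> N \<Longrightarrow> j \<in> J n" using exhaust by blast
  have le: "2 * ((alpha j *v ?C) \<bullet> ?C + (alpha j *v ?S) \<bullet> ?S) \<le> Q n" if "n \<ge> N" for n
  proof -
    have "2 * ((alpha j *v ?C) \<bullet> ?C + (alpha j *v ?S) \<bullet> ?S)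
        \<le> (\<Sum>j\<in>J n. 2 * ((alpha j *v cos_transform (2 * lam j) g) \<bullet> cos_transform (2 * lam j) g
          + (alpha j *v sin_transform (2 * lam j) g) \<bullet> sin_transform (2 * lam j) g))"
      by (rule member_le_sum[OF N[OF that] _ finJ]) (simp add: psd_nonneg[OF psd])
    also have "\<dots> \<le> Q n"
    proof -
      have "Q n = (nrm2 lborel (\<lambda>x. g x - indicator {0<..<1} x *\<^sub>R fourier_sum n g x))\<^sup>2
        + (\<Sum>j\<in>J n. 2 * ((alpha j *v cos_transform (2 * lam j) g) \<bullet> cos_transform (2 * lam j) g
          + (alpha j *v sin_transform (2 * lam j) g) \<bullet> sin_transform (2 * lam j) g))"
        unfolding Q_def by (rule quadratic_form_kern[OF psd finJ g supp])
      then show ?thesis by simp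
    qed
    finally show ?thesis .
  qed
  have "2 * ((alpha j *v ?C) \<bullet> ?C + (alpha j *v ?S) \<bullet> ?S) \<le> 0"
    by (rule tendsto_lowerbound[OF form_kern_tendsto_0[folded Q_def]])
      (use le in \<open>auto simp: eventually_sequentially\<close>)
  moreover have "a = 0 \<and> b = 0" if "0 \<le> a" "0 \<le> b" "2 * (a + b) \<le> 0" for a b :: real
    using that by auto
  ultimately have "(alpha j *v ?C) \<bullet> ?C = 0 \<and> (alpha j *v ?S) \<bullet> ?S = 0"
    using psd_nonneg[OF psd, of j ?C] psd_nonneg[OF psd, of j ?S] by blast
  then show "alpha j *v ?C = 0 \<and> alpha j *v ?S = 0" using psd_mult_eq_0[OF psd] by blast
qed

text \<open>The kernels act on an annihilated function exactly as minus the Fourier partial sums.\<close>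

lemma conv_kern_eq_fourier_sum:
  assumes "x \<in> {0..1}"
  shows "conv (kern_cut lam alpha (J n) n) g x = - fourier_sum n g x"
  using conv_kern_cut[OF finJ g_integrable supp assms, where lam = lam and alpha = alpha and n = n] annihilated_form_0
  by (simp add: annihilated_def)

lemma norm_fourier_sum_conv_le:
  assumes "x \<in> {0..1}" shows "norm (fourier_sum n g x + conv H g x) \<le> err n * nrm2 lborel g"
  using norm_conv_kern_diff_le[OF g, of n x] conv_kern_eq_fourier_sum[OF assms, of n]
    norm_minus_commute[of "- fourier_sum n g x" "conv H g x"]
  by (simp add: add.commute)

lemma uniform_limit_fourier_sum:
  "uniform_limit {0..1} (\<lambda>n x. fourier_sum n g x) (\<lambda>x. - conv H g x) sequentially"
proof (rule uniform_limitI)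
  fix e :: real assume "e > 0"
  have "(\<lambda>n. err n * nrm2 lborel g) \<longlonglongrightarrow> 0" using err_tendsto by (rule tendsto_mult_left_zero)
  then have "\<forall>\<^sub>F n in sequentially. err n * nrm2 lborel g < e" using \<open>e > 0\<close> by (rule order_tendstoD)
  then show "\<forall>\<^sub>F n in sequentially. \<forall>x\<in>{0..1}. dist (fourier_sum n g x) (- conv H g x) < e"
    by eventually_elim (auto simp: dist_norm intro: le_less_trans[OF norm_fourier_sum_conv_le])
qed

lemma continuous_on_conv: "continuous_on {0..1} (\<lambda>x. - conv H g x)"
  by (rule uniform_limit_theorem[OF _ uniform_limit_fourier_sum])
    (auto simp: fourier_sum_def intro!: always_eventually continuous_intros)

text \<open>The partial sums are one-periodic, so their limits at the two end points agree.\<close>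

lemma conv_0_eq_1: "conv H g 0 = conv H g 1"
proof -
  have "(\<lambda>n. fourier_sum n g x) \<longlonglongrightarrow> - conv H g x" if "x \<in> {0..1}" for x
    by (rule tendsto_uniform_limitI[OF uniform_limit_fourier_sum that])
  then have l: "(\<lambda>n. fourier_sum n g 0) \<longlonglongrightarrow> - conv H g 0" "(\<lambda>n. fourier_sum n g 1) \<longlonglongrightarrow> - conv H g 1"
    by simp_all
  have "cos (2 * pi * real k) = 1" "sin (2 * pi * real k) = 0" for k
    using cos_int_2pin[of "int k"] sin_int_2pin[of "int k"] by simp_all
  then have "fourier_sum n g 0 = fourier_sum n g 1" for n
    by (simp add: fourier_sum_def)
  then have "- conv H g 0 = - conv H g 1" using LIMSEQ_unique[OF l(1)] l(2) by (simp only:)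
  then show ?thesis by simp
qed

text \<open>
  On \<open>(0, 1)\<close> a null function solves \<open>g = - H * g\<close>: with \<open>H_n * g = - S_n g\<close> the form is
  \<open>\<parallel>g - S_n g\<parallel>\<^sup>2\<close>, so this norm tends to zero, while \<open>S_n g\<close> tends to \<open>- H * g\<close>.
\<close>

lemma AE_eq_conv: "AE x in lborel. g x = indicator {0<..<1} x *\<^sub>R (- conv H g x)"
proof -
  have [measurable]: "conv H g \<in> borel_measurable borel" "g \<in> borel_measurable borel"
    using borel_measurable_conv[of H g] sqintD(1)[OF g] by simp_all
  have [measurable]: "fourier_sum n g \<in> borel_measurable borel" for n
    unfolding fourier_sum_def[abs_def] by measurable
  define u where "u x = g x - indicator {0<..<1} x *\<^sub>R (- conv H g x)" for x
  define s where "s n x = g x - indicator {0<..<1} x *\<^sub>R fourier_sum n g x" for n x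
  define d where "d n x = indicator {0<..<1::real} x *\<^sub>R (fourier_sum n g x + conv H g x)" for n x
  have sd: "sqint lborel (s n)" "sqint lborel (d n)" for n
  proof -
    show "sqint lborel (s n)" unfolding s_def[abs_def] by (intro sqint_diff g fourier_sum_projection(1) supp)
    show "sqint lborel (d n)" unfolding d_def[abs_def]
      by (rule sqint_indicator_bounded[of _ 0 1 "err n * nrm2 lborel g"])
        (measurable, rule norm_fourier_sum_conv_le, auto)
  qed
  have u: "u = (\<lambda>x. s n x + d n x)" for n by (auto simp: u_def s_def d_def algebra_simps)
  have su: "sqint lborel u" unfolding u[of 0] by (intro sqint_add sd)
  define Q where "Q n = (LINT x|lborel. g x \<bullet> (g x + conv (kern_cut lam alpha (J n) n) g x))" for n
  have bound: "nrm2 lborel u \<le> sqrt (Q n) + err n * nrm2 lborel g" for n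
  proof -
    have "nrm2 lborel (d n) \<le> err n * nrm2 lborel g"
      unfolding d_def by (rule nrm2_indicator_le)
        (auto intro!: norm_fourier_sum_conv_le mult_nonneg_nonneg err_nonneg nrm2_nonneg)
    moreover have "(nrm2 lborel (s n))\<^sup>2 = Q n"
    proof -
      have "g x \<bullet> (g x + conv (kern_cut lam alpha (J n) n) g x) = g x \<bullet> (g x - fourier_sum n g x)" for x
        using supp[of x] conv_kern_eq_fourier_sum[of x n] by (cases "x \<in> {0<..<1}") auto
      then show ?thesis unfolding Q_def s_def using fourier_sum_projection(2)[OF g supp, where n = n] by simp
    qed
    then have "nrm2 lborel (s n) = sqrt (Q n)" by (rule real_sqrt_unique[symmetric, OF _ nrm2_nonneg])
    ultimately show ?thesis using nrm2_triangle[OF sd(1)[of n] sd(2)[of n]] unfolding u[of n] by simp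
  qed
  have "(\<lambda>n. sqrt (Q n) + err n * nrm2 lborel g) \<longlonglongrightarrow> sqrt 0 + 0 * nrm2 lborel g"
    unfolding Q_def by (intro tendsto_intros form_kern_tendsto_0 err_tendsto)
  then have "nrm2 lborel u \<le> sqrt 0 + 0 * nrm2 lborel g"
    by (rule tendsto_lowerbound) (use bound in auto)
  then have "nrm2 lborel u = 0" using nrm2_nonneg[of lborel u] by simp
  from nrm2_eq_0_AE[OF su this] show ?thesis
    by eventually_elim (simp add: u_def eq_neg_iff_add_eq_0)
qed

end

end

section \<open>Consequences of completeness\<close>

lemma complex_span_cos_systemE:
  fixes alpha :: "nat \<Rightarrow> complex^'r^'r"
  assumes "phi \<in> complex_span (cos_system lam alpha)"
  obtains T :: "(real \<Rightarrow> complex^'r) set" and j u where "finite T"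
    "phi = (\<lambda>x. \<Sum>f\<in>T. cos (lam (j f) * x) *\<^sub>R (alpha (j f) *v u f))"
proof -
  obtain T c where T: "finite T" "T \<subseteq> cos_system lam alpha" and phi: "phi = (\<lambda>x. \<Sum>f\<in>T. c f *s f x)"
    using assms unfolding complex_span_def by blast
  have "\<exists>j v. f = (\<lambda>x. complex_of_real (cos (lam j * x)) *s (alpha j *v v))" if "f \<in> T" for f
    using T(2) that unfolding cos_system_def by blast
  then obtain j v where jv: "\<And>f. f \<in> T \<Longrightarrow> f = (\<lambda>x. complex_of_real (cos (lam (j f) * x)) *s (alpha (j f) *v v f))"
    by metis
  have sc: "z *s (complex_of_real r *s (A *v w)) = r *\<^sub>R (A *v (z *s w))" for z r and A :: "complex^'r^'r" and w
    by (simp add: vec_eq_iff matrix_vector_mult_def sum_distrib_left scaleR_conv_of_real[where 'a = complex] mult_ac)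
  have "phi = (\<lambda>x. \<Sum>f\<in>T. cos (lam (j f) * x) *\<^sub>R (alpha (j f) *v (c f *s v f)))"
    unfolding phi
  proof (intro ext sum.cong refl)
    fix x f assume "f \<in> T"
    have "f x = complex_of_real (cos (lam (j f) * x)) *s (alpha (j f) *v v f)"
      using fun_cong[OF jv[OF \<open>f \<in> T\<close>], of x] by (simp only:)
    then show "c f *s f x = cos (lam (j f) * x) *\<^sub>R (alpha (j f) *v (c f *s v f))" by (simp only: sc)
  qed
  with T(1) show ?thesis by (rule that[of T j "\<lambda>f. c f *s v f"])
qed

lemma complex_span_cos_system_even:
  fixes alpha :: "nat \<Rightarrow> complex^'r^'r"
  assumes "phi \<in> complex_span (cos_system lam alpha)" shows "phi (- x) = phi x"
proof -
  obtain T j u where phi: "phi = (\<lambda>x. \<Sum>f\<in>(T :: (real \<Rightarrow> complex^'r) set). cos (lam (j f) * x) *\<^sub>R (alpha (j f) *v u f))"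
    using assms by (rule complex_span_cos_systemE)
  show ?thesis unfolding phi by (simp only: mult_minus_right cos_minus)
qed

lemma continuous_on_complex_span_cos_system:
  fixes alpha :: "nat \<Rightarrow> complex^'r^'r"
  assumes "phi \<in> complex_span (cos_system lam alpha)" shows "continuous_on A phi"
proof -
  obtain T j u where phi: "phi = (\<lambda>x. \<Sum>f\<in>(T :: (real \<Rightarrow> complex^'r) set). cos (lam (j f) * x) *\<^sub>R (alpha (j f) *v u f))"
    using assms by (rule complex_span_cos_systemE)
  show ?thesis unfolding phi by (intro continuous_intros)
qed

text \<open>The shift \<open>s\<close> is free, since both the cosine and the sine coefficients are annihilated.\<close>

lemma annihilated_orthogonal_span:
  fixes g :: "real \<Rightarrow> complex^'r"
  assumes psd: "\<And>j. alpha j \<in> psd" and g: "integrable lborel g" and ann: "annihilated lam alpha g"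
    and phi: "phi \<in> complex_span (cos_system lam alpha)"
  shows "integrable lborel (\<lambda>x. g x \<bullet> phi (2 * x - s))" "(LINT x|lborel. g x \<bullet> phi (2 * x - s)) = 0"
proof -
  obtain T j u where T: "finite T"
    and phi: "phi = (\<lambda>x. \<Sum>f\<in>(T :: (real \<Rightarrow> complex^'r) set). cos (lam (j f) * x) *\<^sub>R (alpha (j f) *v u f))"
    using phi by (rule complex_span_cos_systemE)
  have eq: "g x \<bullet> phi (2 * x - s)
      = (\<Sum>f\<in>T. (cos (2 * lam (j f) * x - lam (j f) * s) *\<^sub>R g x) \<bullet> (alpha (j f) *v u f))" for x
    unfolding phi by (simp add: inner_sum_right algebra_simps)
  have i: "integrable lborel (\<lambda>x. cos (w * x - r) *\<^sub>R g x)" for w r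
    by (rule integrable_bounded_scaleR[OF g]) auto
  show "integrable lborel (\<lambda>x. g x \<bullet> phi (2 * x - s))"
    unfolding eq by (intro Bochner_Integration.integrable_sum integrable_inner_left i)
  have "(LINT x|lborel. g x \<bullet> phi (2 * x - s))
      = (\<Sum>f\<in>T. (LINT x|lborel. cos (2 * lam (j f) * x - lam (j f) * s) *\<^sub>R g x) \<bullet> (alpha (j f) *v u f))"
    unfolding eq by (subst Bochner_Integration.integral_sum)
      (simp_all only: integral_inner_left[OF i] integrable_inner_left[OF i])
  also have "\<dots> = 0"
  proof (intro sum.neutral ballI)
    fix f
    have "(LINT x|lborel. cos (2 * lam (j f) * x - lam (j f) * s) *\<^sub>R g x) \<bullet> (alpha (j f) *v u f)
        = (alpha (j f) *v (LINT x|lborel. cos (2 * lam (j f) * x - lam (j f) * s) *\<^sub>R g x)) \<bullet> u f"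
      by (rule psd_inner_commute[OF psd, symmetric])
    also have "\<dots> = 0"
      using ann by (simp add: cos_shift_integral[OF g] mv.add_right mv.scaleR_right annihilated_def)
    finally show "(LINT x|lborel. cos (2 * lam (j f) * x - lam (j f) * s) *\<^sub>R g x) \<bullet> (alpha (j f) *v u f) = 0" .
  qed
  finally show "(LINT x|lborel. g x \<bullet> phi (2 * x - s)) = 0" .
qed

lemma continuous_on_Icc_bound:
  fixes f :: "real \<Rightarrow> 'b::real_normed_vector"
  assumes "continuous_on {a..b} f"
  shows "\<exists>B. \<forall>x\<in>{a..b}. norm (f x) \<le> B"
  using compact_imp_bounded[OF compact_continuous_image[OF assms compact_Icc]]
  by (auto simp: bounded_iff simp del: atLeastAtMost_iff)

text \<open>
  Completeness of the cosines on \<open>(0, 1)\<close> gives approximation of functions symmetric about \<open>1/2\<close>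
  in the variable \<open>(1 + y) / 2\<close>.
\<close>

lemma symmetric_approximation:
  fixes psi :: "real \<Rightarrow> complex^'r"
  assumes compl: "complete_in_L2 (cos_system lam alpha)" and cont: "continuous_on UNIV psi"
    and sym: "\<And>x. x \<in> {0<..<1} \<Longrightarrow> psi (1 - x) = psi x" and e: "e > 0"
  obtains phi where "phi \<in> complex_span (cos_system lam alpha)"
    "nrm2 lborel (\<lambda>x. indicator {0<..<1} x *\<^sub>R (psi x - phi (2 * x - 1))) < e"
proof -
  define f where "f y = psi ((1 + y) / 2)" for y
  have cf: "continuous_on A f" for A
    unfolding f_def by (intro continuous_on_compose2[OF cont] continuous_intros) auto
  have "f \<in> L2 norm {0<..<1}"
  proof -
    obtain B where "\<forall>x\<in>{0..1}. norm (f x) \<le> B" using continuous_on_Icc_bound[OF cf] by blast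
    then have "sqint (lebesgue_on {0<..<1}) f"
      by (intro sqint_lebesgue_on_Ioo_bounded[of _ _ _ B] borel_measurable_continuous_onI cf) auto
    then show ?thesis by (simp add: L2_def sqint_def)
  qed
  then obtain phi where phi: "phi \<in> complex_span (cos_system lam alpha)" and d: "L2_dist norm {0<..<1} f phi < e"
    using compl e unfolding complete_in_L2_def by blast
  have cp: "continuous_on A phi" for A by (rule continuous_on_complex_span_cos_system[OF phi])
  have [measurable]: "f \<in> borel_measurable borel" "phi \<in> borel_measurable borel" "psi \<in> borel_measurable borel"
    by (intro borel_measurable_continuous_onI cf cp cont)+
  define D where "D u = (norm (f u - phi u))\<^sup>2" for u
  have [measurable]: "D \<in> borel_measurable borel" unfolding D_def[abs_def] by measurable
  have "nrm2 (lebesgue_on {0<..<1}) (\<lambda>x. f x - phi x) = nrm2 lborel (\<lambda>x. indicator {0<..<1} x *\<^sub>R (f x - phi x))"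
    by (rule sqint_representative(2)) (auto intro!: measurable_restrict_space1 measurable_completion)
  then have d': "sqrt (LINT u|lborel. indicator {0<..<1} u * D u) < e"
    using d unfolding L2_dist_def nrm2_def norm_indicator_scaleR_sq D_def by simp
  have even: "D (- u) = D u" if "u \<in> {-1<..<1}" for u
  proof -
    have "psi (1 - (1 + u) / 2) = psi ((1 + u) / 2)" by (rule sym) (use that in auto)
    moreover have "1 - (1 + u) / 2 = (1 + - u) / 2" by (simp add: field_simps)
    ultimately have "f (- u) = f u" unfolding f_def by (simp only:)
    then show ?thesis by (simp add: D_def complex_span_cos_system_even[OF phi])
  qed
  obtain B where B: "\<And>u. u \<in> {0..1} \<Longrightarrow> norm (f u - phi u) \<le> B"
    using continuous_on_Icc_bound[OF continuous_on_diff[OF cf cp]] by blast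
  have i1: "integrable lborel (\<lambda>u. indicator {0<..<1} u * D u)"
    using sqintD(2)[OF sqint_indicator_bounded[of "\<lambda>u. f u - phi u" 0 1 B]] B
    unfolding norm_indicator_scaleR_sq D_def by simp
  have i2: "integrable lborel (\<lambda>u. indicator {0<..<1} (- u) * D (- u))"
    using lborel_integrable_real_affine[OF i1, of "-1" 0] by simp
  have "(LINT x|lborel. (norm (indicator {0<..<1} x *\<^sub>R (psi x - phi (2 * x - 1))))\<^sup>2)
      = (1/2) * (LINT u|lborel. (norm (indicator {0<..<1} (1/2 + 1/2 * u) *\<^sub>R (psi (1/2 + 1/2 * u) - phi (2 * (1/2 + 1/2 * u) - 1))))\<^sup>2)"
    by (subst lborel_integral_real_affine[where c = "1/2" and t = "1/2"]) auto
  also have "(LINT u|lborel. (norm (indicator {0<..<1} (1/2 + 1/2 * u) *\<^sub>R (psi (1/2 + 1/2 * u) - phi (2 * (1/2 + 1/2 * u) - 1))))\<^sup>2)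
      = (LINT u|lborel. indicator {0<..<1} u * D u + indicator {0<..<1} (- u) * D (- u))"
  proof (rule integral_cong_AE)
    have "AE u in lborel. u \<noteq> (0::real)" by (rule AE_lborel_singleton)
    then show "AE u in lborel. (norm (indicator {0<..<1} (1/2 + 1/2 * u) *\<^sub>R (psi (1/2 + 1/2 * u) - phi (2 * (1/2 + 1/2 * u) - 1))))\<^sup>2
        = indicator {0<..<1} u * D u + indicator {0<..<1} (- u) * D (- u)"
    proof eventually_elim
      case (elim u)
      have "psi (1/2 + 1/2 * u) - phi (2 * (1/2 + 1/2 * u) - 1) = f u - phi u"
        by (simp add: f_def add_divide_distrib)
      moreover have "indicator {0<..<1} (1/2 + 1/2 * u) = (indicator {0<..<1} u + indicator {0<..<1} (- u) :: real)"
        using elim by (auto simp: indicator_def)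
      ultimately show ?case using even[of u] elim
        by (auto simp: D_def indicator_def)
    qed
  qed auto
  also have "\<dots> = (LINT u|lborel. indicator {0<..<1} u * D u) + (LINT u|lborel. indicator {0<..<1} (- u) * D (- u))"
    by (rule Bochner_Integration.integral_add[OF i1 i2])
  also have "(LINT u|lborel. indicator {0<..<1} (- u) * D (- u)) = (LINT u|lborel. indicator {0<..<1} u * D u)"
    by (subst (2) lborel_integral_real_affine[where c = "-1" and t = 0]) auto
  finally have "nrm2 lborel (\<lambda>x. indicator {0<..<1} x *\<^sub>R (psi x - phi (2 * x - 1))) < e"
    using d' by (simp add: nrm2_def)
  with phi show ?thesis by (rule that)
qed

context point_mass_kernel
begin

text \<open>
  Under completeness a null function of the form has a representative that is continuous on the
  line, odd about \<open>1/2\<close> and zero off \<open>(0, 1)\<close>: its part symmetric about \<open>1/2\<close> is orthogonal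
  to a complete system, and oddness together with periodicity kills the end point values.
\<close>

lemma continuous_odd_representative:
  assumes compl: "complete_in_L2 (cos_system lam alpha)"
    and g: "sqint lborel g" and supp: "\<And>x. x \<notin> {0<..<1} \<Longrightarrow> g x = 0"
    and form0: "(LINT x|lborel. g x \<bullet> (g x + conv H g x)) = 0"
  obtains G where "continuous_on UNIV G" "\<And>x. x \<notin> {0<..<1} \<Longrightarrow> G x = 0"
    "\<And>x. x \<in> {0..1} \<Longrightarrow> G x = - conv H G x" "\<And>x. G (1 - x) = - G x"
    "annihilated lam alpha G" "AE x in lborel. g x = G x"
proof -
  define ga where "ga x = - conv H g x" for x
  \<comment> \<open>\<open>ga\<close> is known to be continuous only on \<open>[0, 1]\<close>; clamping the argument extends it to the line.\<close>
  define cl where "cl x = max 0 (min 1 (x::real))" for x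
  define psi where "psi x = ga (cl x) + ga (1 - cl x)" for x
  have gi: "integrable lborel g" by (rule sqint_supported_integrable[OF g supp])
  have ann: "annihilated lam alpha g" by (rule annihilated_form_0[OF g supp form0])
  have gac: "continuous_on {0..1} ga"
    unfolding ga_def by (rule continuous_on_conv[OF g supp form0])
  have cl01: "cl x \<in> {0..1}" for x by (auto simp: cl_def)
  have clx: "cl x = x" if "x \<in> {0..1}" for x using that by (auto simp: cl_def)
  have clc: "continuous_on UNIV cl" unfolding cl_def by (intro continuous_intros)
  have c1: "continuous_on UNIV (\<lambda>x. ga (cl x))"
    by (rule continuous_on_compose2[OF gac clc]) (use cl01 in auto)
  have c2: "continuous_on UNIV (\<lambda>x. ga (1 - cl x))"
    by (rule continuous_on_compose2[OF gac]) (use cl01 in \<open>auto intro!: continuous_intros clc\<close>)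
  have psic: "continuous_on UNIV psi" unfolding psi_def by (intro continuous_on_add c1 c2)
  have [measurable]: "psi \<in> borel_measurable borel" by (rule borel_measurable_continuous_onI[OF psic])
  have gm [measurable]: "g \<in> borel_measurable borel" using sqintD(1)[OF g] by simp
  have ae1: "AE x in lborel. g x = indicator {0<..<1} x *\<^sub>R ga x"
    using AE_eq_conv[OF g supp form0] by (simp add: ga_def)
  have ae2: "AE x in lborel. g (1 - x) = indicator {0<..<1} (1 - x) *\<^sub>R ga (1 - x)"
    using AE_lborel_affine[OF ae1, of "-1" 1] by simp
  define Y where "Y x = indicator {0<..<1::real} x *\<^sub>R psi x" for x
  have [measurable]: "Y \<in> borel_measurable borel" unfolding Y_def[abs_def] by measurable
  have sY: "sqint lborel Y"
  proof -
    obtain B where "\<And>x. x \<in> {0..1} \<Longrightarrow> norm (psi x) \<le> B"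
      using continuous_on_Icc_bound[where a = 0 and b = 1, OF continuous_on_subset[OF psic subset_UNIV]] by blast
    then show ?thesis unfolding Y_def[abs_def] by (intro sqint_indicator_bounded[of _ _ _ B]) auto
  qed
  have Yg: "AE x in lborel. Y x = g x + g (1 - x)"
    using ae1 ae2
  proof eventually_elim
    case (elim x)
    show ?case
    proof (cases "x \<in> {0<..<1}")
      case True
      then have x: "x \<in> {0..1}" "1 - x \<in> {0<..<1}" by auto
      have "g x = ga x" using elim(1) True by (simp only: indicator_simps scaleR_one)
      moreover have "g (1 - x) = ga (1 - x)" using elim(2) x(2) by (simp only: indicator_simps scaleR_one)
      moreover have "Y x = ga x + ga (1 - x)"
        using True by (simp only: Y_def psi_def clx[OF x(1)] indicator_simps scaleR_one)
      ultimately show ?thesis by (simp only:)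
    next
      case False
      then show ?thesis using supp[of x] supp[of "1 - x"] by (auto simp: Y_def)
    qed
  qed
  have small: "(nrm2 lborel Y)\<^sup>2 \<le> nrm2 lborel Y * e" if "e > 0" for e
  proof -
    have "psi (1 - x) = psi x" if "x \<in> {0<..<1}" for x
      using that clx[of x] clx[of "1 - x"] by (simp add: psi_def add.commute)
    then obtain phi where phi: "phi \<in> complex_span (cos_system lam alpha)"
      and d: "nrm2 lborel (\<lambda>x. indicator {0<..<1} x *\<^sub>R (psi x - phi (2 * x - 1))) < e"
      using symmetric_approximation[OF compl psic _ \<open>e > 0\<close>] by blast
    define R where "R x = indicator {0<..<1::real} x *\<^sub>R (psi x - phi (2 * x - 1))" for x
    have phic: "continuous_on UNIV (\<lambda>x. phi (2 * x - 1))"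
      by (rule continuous_on_compose2[OF continuous_on_complex_span_cos_system[OF phi]]) (auto intro!: continuous_intros)
    have [measurable]: "(\<lambda>x. phi (2 * x - 1)) \<in> borel_measurable borel" by (rule borel_measurable_continuous_onI[OF phic])
    have sR: "sqint lborel R"
    proof -
      obtain B where "\<And>x. x \<in> {0..1} \<Longrightarrow> norm (psi x - phi (2 * x - 1)) \<le> B"
        using continuous_on_Icc_bound[where a = 0 and b = 1, OF continuous_on_subset[OF continuous_on_diff[OF psic phic] subset_UNIV]] by blast
      then show ?thesis unfolding R_def[abs_def] by (intro sqint_indicator_bounded[of _ _ _ B]) auto
    qed
    note orth = annihilated_orthogonal_span[OF psd gi ann phi, of 1]
    have o2: "integrable lborel (\<lambda>x. g (1 - x) \<bullet> phi (2 * x - 1))" "(LINT x|lborel. g (1 - x) \<bullet> phi (2 * x - 1)) = 0"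
    proof -
      have e: "g (1 - x) \<bullet> phi (2 * x - 1) = g (1 + (-1) * x) \<bullet> phi (2 * (1 + (-1) * x) - 1)" for x
        using complex_span_cos_system_even[OF phi, of "2 * x - 1"] by (simp add: algebra_simps)
      show "integrable lborel (\<lambda>x. g (1 - x) \<bullet> phi (2 * x - 1))"
        unfolding e by (rule lborel_integrable_real_affine[OF orth(1)]) simp
      show "(LINT x|lborel. g (1 - x) \<bullet> phi (2 * x - 1)) = 0"
        unfolding e using lborel_integral_real_affine[of "-1" "\<lambda>x. g x \<bullet> phi (2 * x - 1)" 1] orth(2) by simp
    qed
    have "(LINT x|lborel. Y x \<bullet> phi (2 * x - 1)) = (LINT x|lborel. g x \<bullet> phi (2 * x - 1) + g (1 - x) \<bullet> phi (2 * x - 1))"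
    proof (rule integral_cong_AE)
      show "AE x in lborel. Y x \<bullet> phi (2 * x - 1) = g x \<bullet> phi (2 * x - 1) + g (1 - x) \<bullet> phi (2 * x - 1)"
        using Yg by eventually_elim (simp add: inner_add_left)
    qed measurable
    also have "\<dots> = 0" using orth o2 by simp
    finally have Y0: "(LINT x|lborel. Y x \<bullet> phi (2 * x - 1)) = 0" .
    have iR: "integrable lborel (\<lambda>x. Y x \<bullet> R x)" by (rule sqint_inner_integrable[OF sY sR])
    have iY: "integrable lborel (\<lambda>x. Y x \<bullet> Y x)" by (rule sqint_inner_integrable[OF sY sY])
    have "Y x \<bullet> phi (2 * x - 1) = Y x \<bullet> Y x - Y x \<bullet> R x" for x
      by (simp add: Y_def R_def inner_diff_right algebra_simps indicator_def)
    then have "(nrm2 lborel Y)\<^sup>2 = (LINT x|lborel. Y x \<bullet> R x)"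
      using Y0 iR iY by (simp add: nrm2_sq power2_norm_eq_inner)
    also have "\<dots> \<le> nrm2 lborel Y * nrm2 lborel R" using nrm2_inner_le[OF sY sR] by simp
    also have "\<dots> \<le> nrm2 lborel Y * e" using d by (intro mult_left_mono nrm2_nonneg) (simp add: R_def[abs_def])
    finally show ?thesis .
  qed
  have "nrm2 lborel Y = 0"
  proof (rule ccontr)
    assume "nrm2 lborel Y \<noteq> 0"
    then have p: "nrm2 lborel Y > 0" using nrm2_nonneg[of lborel Y] by simp
    have "nrm2 lborel Y * nrm2 lborel Y \<le> nrm2 lborel Y * (nrm2 lborel Y / 2)"
      using small[of "nrm2 lborel Y / 2"] p by (simp add: power2_eq_square)
    then have "nrm2 lborel Y \<le> nrm2 lborel Y / 2" using p by (rule mult_left_le_imp_le)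
    then show False using p by simp
  qed
  then have Y0: "AE x in lborel. Y x = 0" by (rule nrm2_eq_0_AE[OF sY])
  have closed: "closed {x. psi x = 0}"
    using continuous_closed_preimage_constant[OF psic closed_UNIV, of 0] by simp
  have "psi x = 0" if "x \<in> {0<..<1}" for x
  proof -
    have "AE x in lborel. x \<in> {0<..<1} \<longrightarrow> x \<in> {x. psi x = 0}"
      using Y0 by eventually_elim (auto simp: Y_def)
    then have "AE x\<in>{0<..<1} in lebesgue. x \<in> {x. psi x = 0}" by (simp only: AE_completion_iff)
    from mem_closed_if_AE_lebesgue_open[OF _ closed this that] show ?thesis by simp
  qed
  then have "closure {0<..<1} \<subseteq> {x. psi x = 0}" by (intro closure_minimal closed) auto
  then have psi0: "psi x = 0" if "x \<in> {0..1}" for x using that by auto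
  have anti: "ga (1 - x) = - ga x" if "x \<in> {0..1}" for x
    using psi0[OF that] clx[OF that] by (simp add: psi_def add_eq_0_iff)
  have e01: "ga 0 = ga 1" using conv_0_eq_1[OF g supp form0] by (simp add: ga_def)
  moreover have "ga 1 = - ga 0" using anti[of 0] by simp
  ultimately have "2 *\<^sub>R ga 0 = 0" unfolding scaleR_2 by (metis add.right_inverse)
  then have ends: "ga 0 = 0" "ga 1 = 0" using e01 by simp_all
  define G where "G x = ga (cl x)" for x
  have G1: "G x = (if x \<in> {0..1} then ga x else 0)" for x
    using ends clx[of x] by (auto simp: G_def cl_def)
  have G0: "G x = 0" if "x \<notin> {0<..<1}" for x
  proof -
    have "x = 0 \<or> x = 1 \<or> x \<notin> {0..1}" using that by auto
    then show ?thesis using ends by (auto simp: G1)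
  qed
  have aeG: "AE x in lborel. g x = G x"
    using ae1
  proof eventually_elim
    case (elim x)
    then show ?case using G0[of x] by (cases "x \<in> {0<..<1}") (auto simp: G1)
  qed
  have Gc: "continuous_on UNIV G" unfolding G_def by (rule c1)
  have [measurable]: "G \<in> borel_measurable borel" by (rule borel_measurable_continuous_onI[OF Gc])
  have convG: "conv H G x = conv H g x" for x
    unfolding conv_def by (rule integral_cong_AE) (use aeG in auto)
  have tr: "cos_transform w G = cos_transform w g" "sin_transform w G = sin_transform w g" for w
    unfolding cos_transform_def sin_transform_def by (rule integral_cong_AE; use aeG in auto)+
  show ?thesis
  proof (rule that[of G])
    show "G x = - conv H G x" if "x \<in> {0..1}" for x using that by (simp add: G1 convG ga_def)
    show "G (1 - x) = - G x" for x using anti[of x] by (auto simp: G1)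
    show "annihilated lam alpha G" using ann by (simp add: annihilated_def tr)
  qed (fact Gc G0 aeG)+
qed

end

section \<open>Difference quotients of null functions\<close>

text \<open>Young's inequality for the exponents two, one and two.\<close>

lemma conv_Young:
  fixes K :: "real \<Rightarrow> complex^'r^'r" and b :: "real \<Rightarrow> complex^'r"
  assumes K: "sqint lborel K" and b: "integrable lborel b"
  shows "sqint lborel (conv K b)" "nrm2 lborel (conv K b) \<le> nrm2 lborel K * (LINT t|lborel. norm (b t))"
proof -
  have [measurable]: "K \<in> borel_measurable borel" "b \<in> borel_measurable borel"
    using sqintD(1)[OF K] borel_measurable_integrable[OF b] by simp_all
  have cm [measurable]: "conv K b \<in> borel_measurable borel" by (rule borel_measurable_conv) measurable
  define c where "c = (LINT t|lborel. norm (b t))"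
  have c0: "c \<ge> 0" by (simp add: c_def)
  have c: "(\<integral>\<^sup>+t. ennreal (norm (b t)) \<partial>lborel) = ennreal c"
    unfolding c_def using b by (intro nn_integral_eq_integral) auto
  have KK: "(\<integral>\<^sup>+x. ennreal ((norm (K (x - t)))\<^sup>2) \<partial>lborel) = ennreal ((nrm2 lborel K)\<^sup>2)" for t
  proof -
    have "(\<integral>\<^sup>+x. ennreal ((norm (K (x - t)))\<^sup>2) \<partial>lborel) = (\<integral>\<^sup>+x. ennreal ((norm (K x))\<^sup>2) \<partial>lborel)"
      by (subst (2) nn_integral_real_affine[where c = 1 and t = "- t"]) auto
    then show ?thesis using sqintD(2)[OF K] by (simp add: nn_integral_eq_integral nrm2_sq)
  qed
  \<comment> \<open>Cauchy--Schwarz with the weight \<open>norm (b t)\<close> shared equally between the two factors.\<close>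
  have pt: "ennreal ((norm (conv K b x))\<^sup>2)
      \<le> (\<integral>\<^sup>+t. ennreal ((norm (K (x - t)))\<^sup>2) * ennreal (norm (b t)) \<partial>lborel) * ennreal c" for x
  proof -
    have "ennreal (norm (conv K b x)) \<le> (\<integral>\<^sup>+t. ennreal (norm (K (x - t) *v b t)) \<partial>lborel)"
      unfolding conv_def
      by (cases "integrable lborel (\<lambda>t. K (x - t) *v b t)")
        (auto intro: integral_norm_bound_ennreal simp: not_integrable_integral_eq)
    also have "\<dots> \<le> (\<integral>\<^sup>+t. ennreal (norm (K (x - t)) * sqrt (norm (b t))) * ennreal (sqrt (norm (b t))) \<partial>lborel)"
      by (intro nn_integral_mono) (simp add: ennreal_mult[symmetric] norm_matrix_vector_mult_le mult.assoc)
    finally have "(ennreal (norm (conv K b x)))\<^sup>2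
        \<le> (\<integral>\<^sup>+t. ennreal (norm (K (x - t)) * sqrt (norm (b t))) * ennreal (sqrt (norm (b t))) \<partial>lborel)\<^sup>2"
      by (rule power_mono) simp
    also have "\<dots> \<le> (\<integral>\<^sup>+t. (ennreal (norm (K (x - t)) * sqrt (norm (b t))))\<^sup>2 \<partial>lborel)
        * (\<integral>\<^sup>+t. (ennreal (sqrt (norm (b t))))\<^sup>2 \<partial>lborel)"
      by (rule Cauchy_Schwarz_nn_integral) measurable
    also have "(\<integral>\<^sup>+t. (ennreal (sqrt (norm (b t))))\<^sup>2 \<partial>lborel) = ennreal c"
      by (simp add: ennreal_power c)
    finally show ?thesis by (simp add: ennreal_power power_mult_distrib ennreal_mult)
  qed
  have "(\<integral>\<^sup>+x. ennreal ((norm (conv K b x))\<^sup>2) \<partial>lborel)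
      \<le> (\<integral>\<^sup>+x. (\<integral>\<^sup>+t. ennreal ((norm (K (x - t)))\<^sup>2) * ennreal (norm (b t)) \<partial>lborel) * ennreal c \<partial>lborel)"
    by (intro nn_integral_mono pt)
  also have "\<dots> = (\<integral>\<^sup>+x. (\<integral>\<^sup>+t. ennreal ((norm (K (x - t)))\<^sup>2) * ennreal (norm (b t)) \<partial>lborel) \<partial>lborel) * ennreal c"
    by (rule nn_integral_multc) measurable
  also have "(\<integral>\<^sup>+x. (\<integral>\<^sup>+t. ennreal ((norm (K (x - t)))\<^sup>2) * ennreal (norm (b t)) \<partial>lborel) \<partial>lborel)
      = (\<integral>\<^sup>+t. (\<integral>\<^sup>+x. ennreal ((norm (K (x - t)))\<^sup>2) * ennreal (norm (b t)) \<partial>lborel) \<partial>lborel)"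
    by (rule lborel_pair.Fubini') measurable
  also have "\<dots> = (\<integral>\<^sup>+t. ennreal ((nrm2 lborel K)\<^sup>2) * ennreal (norm (b t)) \<partial>lborel)"
    by (simp add: nn_integral_multc KK)
  also have "\<dots> = ennreal ((nrm2 lborel K)\<^sup>2) * ennreal c" by (simp add: nn_integral_cmult c)
  also have "\<dots> * ennreal c = ennreal ((nrm2 lborel K * c)\<^sup>2)"
    using c0 by (simp add: ennreal_mult[symmetric] power_mult_distrib power2_eq_square mult_ac)
  finally have fin: "(\<integral>\<^sup>+x. ennreal ((norm (conv K b x))\<^sup>2) \<partial>lborel) \<le> ennreal ((nrm2 lborel K * c)\<^sup>2)" .
  show sq: "sqint lborel (conv K b)" unfolding sqint_def
  proof
    show "integrable lborel (\<lambda>x. (norm (conv K b x))\<^sup>2)"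
      by (rule integrableI_nonneg) (use fin in \<open>auto intro: le_less_trans\<close>)
  qed simp
  have "ennreal ((nrm2 lborel (conv K b))\<^sup>2) \<le> ennreal ((nrm2 lborel K * c)\<^sup>2)"
    using fin sqintD(2)[OF sq] by (simp add: nn_integral_eq_integral nrm2_sq)
  then have "(nrm2 lborel (conv K b))\<^sup>2 \<le> (nrm2 lborel K * c)\<^sup>2" by (subst (asm) ennreal_le_iff) auto
  then show "nrm2 lborel (conv K b) \<le> nrm2 lborel K * (LINT t|lborel. norm (b t))"
    unfolding c_def[symmetric] by (rule power2_le_imp_le) (intro mult_nonneg_nonneg nrm2_nonneg c0)
qed

lemma conv_add_right:
  fixes K :: "real \<Rightarrow> complex^'r^'r" and f g :: "real \<Rightarrow> complex^'r"
  assumes "sqint lborel K" "sqint lborel f" "sqint lborel g"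
  shows "conv K (\<lambda>x. f x + g x) x = conv K f x + conv K g x"
    "conv K (\<lambda>x. f x - g x) x = conv K f x - conv K g x"
  unfolding conv_def using assms by (simp_all add: mv.add_right mv.diff_right conv_integrable)

lemma conv_translate: "conv K g (x + h) = conv K (\<lambda>t. g (t + h)) x"
proof -
  have "conv K g (x + h) = (LINT t|lborel. K (x + h - (h + 1 * t)) *v g (h + 1 * t))"
    unfolding conv_def by (subst lborel_integral_real_affine[where c = 1 and t = h]) auto
  then show ?thesis by (simp add: conv_def add.commute)
qed

lemma fourier_sum_Lipschitz:
  "\<exists>L\<ge>0. \<forall>x h. norm (fourier_sum n g (x + h) - fourier_sum n g x) \<le> L * \<bar>h\<bar>"
proof -
  have c: "\<bar>cos p - cos q\<bar> \<le> \<bar>p - q\<bar>" for p q :: real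
  proof -
    have "\<bar>cos p - cos q\<bar> = 2 * (\<bar>sin ((p + q) / 2)\<bar> * \<bar>sin ((q - p) / 2)\<bar>)"
      by (simp add: cos_diff_cos abs_mult)
    also have "\<dots> \<le> 2 * (1 * \<bar>(q - p) / 2\<bar>)"
      by (intro mult_left_mono mult_mono abs_sin_x_le_abs_x) auto
    finally show ?thesis by simp
  qed
  have s: "\<bar>sin p - sin q\<bar> \<le> \<bar>p - q\<bar>" for p q :: real
  proof -
    have "\<bar>sin p - sin q\<bar> = 2 * (\<bar>sin ((p - q) / 2)\<bar> * \<bar>cos ((p + q) / 2)\<bar>)"
      by (simp add: sin_diff_sin abs_mult)
    also have "\<dots> \<le> 2 * (\<bar>(p - q) / 2\<bar> * 1)"
      by (intro mult_left_mono mult_mono abs_sin_x_le_abs_x) auto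
    finally show ?thesis by simp
  qed
  define w where "w k = 2 * pi * real k" for k
  define L where "L = (\<Sum>k=1..n. 2 * (w k * norm (cos_transform (w k) g) + w k * norm (sin_transform (w k) g)))"
  have w0: "w k \<ge> 0" for k by (simp add: w_def)
  have "norm (fourier_sum n g (x + h) - fourier_sum n g x) \<le> L * \<bar>h\<bar>" for x h
  proof -
    have eq: "fourier_sum n g (x + h) - fourier_sum n g x
        = (\<Sum>k=1..n. 2 *\<^sub>R ((cos (w k * (x + h)) - cos (w k * x)) *\<^sub>R cos_transform (w k) g
          + (sin (w k * (x + h)) - sin (w k * x)) *\<^sub>R sin_transform (w k) g))"
      unfolding fourier_sum_def w_def[symmetric] add_diff_cancel_left sum_subtractf[symmetric]
      by (intro sum.cong refl) (simp add: scaleR_diff_left scaleR_diff_right scaleR_add_right)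
    have "norm (\<Sum>k=1..n. 2 *\<^sub>R ((cos (w k * (x + h)) - cos (w k * x)) *\<^sub>R cos_transform (w k) g
          + (sin (w k * (x + h)) - sin (w k * x)) *\<^sub>R sin_transform (w k) g)) \<le> (\<Sum>k=1..n. 2 * (w k * norm (cos_transform (w k) g) + w k * norm (sin_transform (w k) g)) * \<bar>h\<bar>)"
    proof (rule order_trans[OF norm_sum], rule sum_mono)
      fix k
      have "\<bar>cos (w k * (x + h)) - cos (w k * x)\<bar> \<le> w k * \<bar>h\<bar>" "\<bar>sin (w k * (x + h)) - sin (w k * x)\<bar> \<le> w k * \<bar>h\<bar>"
        using c[of "w k * (x + h)" "w k * x"] s[of "w k * (x + h)" "w k * x"] w0[of k]
        by (simp_all add: distrib_left abs_mult)
      then have "norm ((cos (w k * (x + h)) - cos (w k * x)) *\<^sub>R cos_transform (w k) g) \<le> (w k * \<bar>h\<bar>) * norm (cos_transform (w k) g)"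
        "norm ((sin (w k * (x + h)) - sin (w k * x)) *\<^sub>R sin_transform (w k) g) \<le> (w k * \<bar>h\<bar>) * norm (sin_transform (w k) g)"
        unfolding norm_scaleR by (intro mult_right_mono; simp)+
      from norm_triangle_mono[OF this]
      have "2 * norm ((cos (w k * (x + h)) - cos (w k * x)) *\<^sub>R cos_transform (w k) g
          + (sin (w k * (x + h)) - sin (w k * x)) *\<^sub>R sin_transform (w k) g)
        \<le> 2 * ((w k * \<bar>h\<bar>) * norm (cos_transform (w k) g) + (w k * \<bar>h\<bar>) * norm (sin_transform (w k) g))"
        by simp
      also have "\<dots> = 2 * (w k * norm (cos_transform (w k) g) + w k * norm (sin_transform (w k) g)) * \<bar>h\<bar>"
        by (simp add: distrib_left distrib_right mult_ac)
      finally show "norm (2 *\<^sub>R ((cos (w k * (x + h)) - cos (w k * x)) *\<^sub>R cos_transform (w k) g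
          + (sin (w k * (x + h)) - sin (w k * x)) *\<^sub>R sin_transform (w k) g))
        \<le> 2 * (w k * norm (cos_transform (w k) g) + w k * norm (sin_transform (w k) g)) * \<bar>h\<bar>"
        by simp
    qed
    then show ?thesis unfolding eq L_def sum_distrib_right .
  qed
  moreover have "L \<ge> 0" unfolding L_def by (intro sum_nonneg) (simp add: w0)
  ultimately show ?thesis by blast
qed

text \<open>
  The difference \<open>G (x + h) - G x\<close> of a function supported in \<open>(0, 1)\<close>, split into the part on
  \<open>(0, 1 - h)\<close>, where both values are genuine, and the part near the end points.
\<close>

definition diff_inner :: "(real \<Rightarrow> complex^'r) \<Rightarrow> real \<Rightarrow> real \<Rightarrow> complex^'r" where
  "diff_inner G h x = indicator {0<..<1 - h} x *\<^sub>R (G (x + h) - G x)"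

definition diff_boundary :: "(real \<Rightarrow> complex^'r) \<Rightarrow> real \<Rightarrow> real \<Rightarrow> complex^'r" where
  "diff_boundary G h x = G (x + h) - G x - diff_inner G h x"

lemma sqint_supported_bounded:
  fixes f :: "real \<Rightarrow> 'b::euclidean_space"
  assumes "f \<in> borel_measurable borel" "\<And>x. norm (f x) \<le> B" "\<And>x. x \<notin> {a<..<b} \<Longrightarrow> f x = 0"
  shows "sqint lborel f"
proof -
  have "sqint lborel (\<lambda>x. indicator {a<..<b} x *\<^sub>R f x)"
    by (rule sqint_indicator_bounded[OF assms(1)]) (rule assms(2))
  also have "(\<lambda>x. indicator {a<..<b} x *\<^sub>R f x) = f"
    using assms(3) by (auto simp: indicator_def fun_eq_iff)
  finally show ?thesis .
qed

lemma continuous_supported_bounded: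
  fixes G :: "real \<Rightarrow> 'b::euclidean_space"
  assumes "continuous_on UNIV G" "\<And>x. x \<notin> {0<..<1} \<Longrightarrow> G x = 0"
  shows "\<exists>M\<ge>0. \<forall>x. norm (G x) \<le> M"
proof -
  obtain B where B: "\<And>x. x \<in> {0..1} \<Longrightarrow> norm (G x) \<le> B"
    using continuous_on_Icc_bound[where a = 0 and b = 1, OF continuous_on_subset[OF assms(1) subset_UNIV]] by blast
  have "norm (G x) \<le> max B 0" for x
    using B[of x] assms(2)[of x] by (cases "x \<in> {0<..<1}") auto
  then show ?thesis by (intro exI[of _ "max B 0"]) auto
qed

context
  fixes G :: "real \<Rightarrow> complex^'r"
  assumes cont: "continuous_on UNIV G" and supp: "\<And>x. x \<notin> {0<..<1} \<Longrightarrow> G x = 0"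
begin

lemma supported_measurable [measurable]: "G \<in> borel_measurable borel"
  by (rule borel_measurable_continuous_onI[OF cont])

lemma sqint_supported: "sqint lborel G"
proof -
  obtain M where "\<And>x. norm (G x) \<le> M" using continuous_supported_bounded[OF cont supp] by blast
  then show ?thesis by (intro sqint_supported_bounded[OF supported_measurable _ supp])
qed

lemma borel_measurable_diff_parts [measurable]:
  "diff_inner G h \<in> borel_measurable borel" "diff_boundary G h \<in> borel_measurable borel"
  unfolding diff_inner_def[abs_def] diff_boundary_def[abs_def] by measurable

lemma norm_diff_boundary_le:
  assumes h: "0 < h" "h < 1" and m: "\<And>x. x \<in> {0..h} \<union> {1 - h..1} \<Longrightarrow> norm (G x) \<le> m"
  shows "norm (diff_boundary G h x) \<le> indicator ({-h..0} \<union> {1 - h..1}) x * m"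
proof -
  consider "x < - h" | "x \<in> {-h..0}" | "x \<in> {0<..<1 - h}" | "x \<in> {1 - h..1}" | "x > 1" by fastforce
  then show ?thesis
  proof cases
    case 2
    then show ?thesis using supp[of x] m[of "x + h"] h by (auto simp: diff_boundary_def diff_inner_def)
  next
    case 4
    then show ?thesis using supp[of "x + h"] m[of x] h by (auto simp: diff_boundary_def diff_inner_def)
  next
    case 1
    then show ?thesis using supp[of x] supp[of "x + h"] h by (auto simp: diff_boundary_def diff_inner_def)
  next
    case 5
    then show ?thesis using supp[of x] supp[of "x + h"] h by (auto simp: diff_boundary_def diff_inner_def)
  next
    case 3
    then show ?thesis by (auto simp: diff_boundary_def diff_inner_def)
  qed
qed

lemma diff_boundary_integral:
  assumes h: "0 < h" "h < 1" and m: "\<And>x. x \<in> {0..h} \<union> {1 - h..1} \<Longrightarrow> norm (G x) \<le> m"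
  shows "integrable lborel (diff_boundary G h)" "(LINT x|lborel. norm (diff_boundary G h x)) \<le> 2 * h * m"
proof -
  let ?B = "{-h..0} \<union> {1 - h..1::real}"
  have "?B \<in> sets lborel" by simp
  have "emeasure lborel ?B \<le> emeasure lborel {-h..0} + emeasure lborel {1 - h..1}"
    by (rule emeasure_subadditive) auto
  also have "\<dots> = ennreal (2 * h)" using h by (simp flip: ennreal_plus)
  finally have e: "emeasure lborel ?B \<le> ennreal (2 * h)" .
  then have fin: "emeasure lborel ?B < \<infinity>" by (rule le_less_trans) simp
  have ms: "Sigma_Algebra.measure lborel ?B \<le> 2 * h"
    using enn2real_mono[OF e] h by (simp add: measure_def)
  have m0: "0 \<le> m" using order_trans[OF norm_ge_zero m[of 0]] h by simp
  have ii: "integrable lborel (\<lambda>x. indicator ?B x * m)"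
    using fin by (intro integrable_mult_left) (simp add: integrable_indicator_iff)
  show i: "integrable lborel (diff_boundary G h)"
    by (rule Bochner_Integration.integrable_bound[OF ii])
      (use norm_diff_boundary_le[OF h m] m0 in \<open>auto simp: abs_mult\<close>)
  have "(LINT x|lborel. norm (diff_boundary G h x)) \<le> (LINT x|lborel. indicator ?B x * m)"
    by (intro integral_mono integrable_norm i ii norm_diff_boundary_le h m)
  also have "\<dots> = Sigma_Algebra.measure lborel ?B * m" by simp
  also have "\<dots> \<le> 2 * h * m" by (intro mult_right_mono ms m0)
  finally show "(LINT x|lborel. norm (diff_boundary G h x)) \<le> 2 * h * m" .
qed

lemma sqint_diff_parts:
  assumes h: "0 < h" "h < 1"
  shows "sqint lborel (\<lambda>x. G (x + h))" "sqint lborel (diff_inner G h)" "sqint lborel (diff_boundary G h)"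
proof -
  show 1: "sqint lborel (\<lambda>x. G (x + h))"
    using sqint_lborel_affine[OF sqint_supported, of 1 h] by (simp add: add.commute)
  show 2: "sqint lborel (diff_inner G h)"
    by (rule sqint_bound[OF sqint_diff[OF 1 sqint_supported]]) (auto simp: diff_inner_def indicator_def)
  show "sqint lborel (diff_boundary G h)"
    unfolding diff_boundary_def[abs_def] by (intro sqint_diff 1 2 sqint_supported)
qed

end

context point_mass_kernel
begin

text \<open>
  An annihilated solution of \<open>G = - H * G\<close> has difference quotients bounded in \<open>L_2\<close>. Split \<open>H\<close> into
  a trigonometric kernel, which acts on an annihilated function as minus a Lipschitz Fourier sum, and
  a remainder of norm at most \<open>1/2\<close>. Convolution of the remainder with the inner part of the
  difference is absorbed; with the boundary part it costs only the \<open>L_1\<close> norm, of order \<open>h\<close>.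
\<close>

lemma difference_quotient_bound:
  assumes cont: "continuous_on UNIV G" and supp: "\<And>x. x \<notin> {0<..<1} \<Longrightarrow> G x = 0"
    and eq: "\<And>x. x \<in> {0..1} \<Longrightarrow> G x = - conv H G x" and ann: "annihilated lam alpha G"
  shows "\<exists>C. \<forall>h. 0 < h \<and> h < 1 \<longrightarrow> nrm2 lborel (diff_inner G h) \<le> C * h"
proof -
  note Gm [measurable] = supported_measurable[OF cont]
  have sG: "sqint lborel G" by (rule sqint_supported[OF cont supp])
  have gi: "integrable lborel G" by (rule sqint_supported_integrable[OF sG supp])
  obtain M where M: "M \<ge> 0" "\<And>x. norm (G x) \<le> M" using continuous_supported_bounded[OF cont supp] by blast
  have "\<forall>\<^sub>F n in sequentially. err n < 1/2" by (rule order_tendstoD(2)[OF err_tendsto]) simp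
  then obtain N where N: "err N < 1/2" by (auto simp: eventually_sequentially)
  define K where "K = kern_cut lam alpha (J N) N"
  define R where "R x = H x - K x" for x
  have sK: "sqint lborel K" unfolding K_def by (rule sqint_kern_cut)
  have sR: "sqint lborel R" unfolding R_def[abs_def] by (rule sqint_diff[OF H sK])
  have nR: "nrm2 lborel R \<le> 1/2"
  proof -
    have "nrm2 lborel R = err N" by (simp add: R_def K_def err_def nrm2_def norm_minus_commute)
    then show ?thesis using N by simp
  qed
  obtain L where L: "L \<ge> 0" "\<And>x h. norm (fourier_sum N G (x + h) - fourier_sum N G x) \<le> L * \<bar>h\<bar>"
    using fourier_sum_Lipschitz[of N G] by blast
  have rep: "G x = fourier_sum N G x - conv R G x" if "x \<in> {0..1}" for x
  proof -
    have "conv K G x = - fourier_sum N G x"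
      unfolding K_def using conv_kern_cut[OF finJ gi supp that, where lam = lam and alpha = alpha and n = N] ann
      by (simp add: annihilated_def)
    moreover have "conv R G x = conv H G x - conv K G x"
      unfolding R_def by (rule conv_diff[OF H sK sG])
    ultimately show ?thesis using eq[OF that] by simp
  qed
  have "nrm2 lborel (diff_inner G h) \<le> (2 * (L + M)) * h" if h: "0 < h" "h < 1" for h
  proof -
    define D where "D = diff_inner G h"
    define B where "B = diff_boundary G h"
    have sq: "sqint lborel (\<lambda>x. G (x + h))" "sqint lborel D" "sqint lborel B"
      unfolding D_def B_def using sqint_diff_parts[OF cont supp h] by blast+
    have Bi: "integrable lborel B" "(LINT x|lborel. norm (B x)) \<le> 2 * h * M"
      unfolding B_def using diff_boundary_integral[OF cont supp h, of M] M(2) by blast+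
    define F where "F x = fourier_sum N G (x + h) - fourier_sum N G x" for x
    have FL: "norm (F x) \<le> L * h" for x using L(2)[of x h] h by (simp add: F_def)
    have [measurable]: "fourier_sum N G \<in> borel_measurable borel"
      unfolding fourier_sum_def[abs_def] by measurable
    have [measurable]: "F \<in> borel_measurable borel" unfolding F_def[abs_def] by measurable
    have [measurable]: "D \<in> borel_measurable borel" "B \<in> borel_measurable borel" "R \<in> borel_measurable borel"
      using sqintD(1)[OF sq(2)] sqintD(1)[OF sq(3)] sqintD(1)[OF sR] by simp_all
    have [measurable]: "conv R D \<in> borel_measurable borel" "conv R B \<in> borel_measurable borel"
      by (rule borel_measurable_conv; measurable)+
    have cRD: "norm (conv R D x) \<le> 1/2 * nrm2 lborel D" for x
      by (rule order_trans[OF norm_conv_le[OF sR sq(2)]]) (intro mult_right_mono nR nrm2_nonneg)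
    define I where "I x = (indicator {0<..<1 - h} x :: real)" for x
    define u where "u x = I x *\<^sub>R F x" for x
    define v where "v x = I x *\<^sub>R conv R D x" for x
    define w where "w x = I x *\<^sub>R conv R B x" for x
    \<comment> \<open>\<open>u\<close> is the Lipschitz part, \<open>v\<close> is absorbed into the left side, \<open>w\<close> is the effect of the boundary part.\<close>
    have D: "D = (\<lambda>x. u x - v x - w x)"
    proof
      fix x
      show "D x = u x - v x - w x"
      proof (cases "x \<in> {0<..<1 - h}")
        case True
        then have x: "x \<in> {0..1}" "x + h \<in> {0..1}" using h by auto
        have d: "G (t + h) - G t = D t + B t" for t by (simp add: D_def B_def diff_boundary_def)
        have "conv R G (x + h) - conv R G x = conv R (\<lambda>t. G (t + h) - G t) x"
          unfolding conv_translate by (rule conv_add_right(2)[OF sR sq(1) sG, symmetric])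
        also have "\<dots> = conv R D x + conv R B x"
          unfolding d by (rule conv_add_right(1)[OF sR sq(2) sq(3)])
        finally have c: "conv R G (x + h) - conv R G x = conv R D x + conv R B x" .
        have "D x = G (x + h) - G x" using True by (simp add: D_def diff_inner_def)
        also have "\<dots> = F x - (conv R G (x + h) - conv R G x)"
          using rep[OF x(1)] rep[OF x(2)] by (simp add: F_def)
        finally show ?thesis using True c by (simp add: u_def v_def w_def I_def)
      next
        case False
        then show ?thesis by (simp add: D_def diff_inner_def u_def v_def w_def I_def)
      qed
    qed
    have su: "sqint lborel u" unfolding u_def[abs_def] I_def
      by (rule sqint_indicator_bounded[of _ _ _ "L * h"]) (use FL in auto)
    have sv: "sqint lborel v" unfolding v_def[abs_def] I_def
      by (rule sqint_indicator_bounded[of _ _ _ "1/2 * nrm2 lborel D"]) (use cRD in auto)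
    have wm: "w \<in> borel_measurable lborel" unfolding w_def[abs_def] I_def by measurable
    have wb: "AE x in lborel. norm (w x) \<le> norm (conv R B x)" by (auto simp: w_def I_def indicator_def)
    note Y = conv_Young[OF sR Bi(1)]
    have sw: "sqint lborel w" by (rule sqint_bound[OF Y(1) wm wb])
    have I: "I x = indicator {0<..<1} x * I x" for x using h by (auto simp: I_def indicator_def)
    have nu: "nrm2 lborel u \<le> L * h"
    proof -
      have "nrm2 lborel (\<lambda>x. indicator {0<..<1::real} x *\<^sub>R (I x *\<^sub>R F x)) \<le> L * h"
        by (rule nrm2_indicator_le) (use FL L(1) h in \<open>auto simp: I_def indicator_def\<close>)
      moreover have "u = (\<lambda>x. indicator {0<..<1::real} x *\<^sub>R (I x *\<^sub>R F x))"
        unfolding u_def[abs_def] by (subst I) simp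
      ultimately show ?thesis by simp
    qed
    have nv: "nrm2 lborel v \<le> 1/2 * nrm2 lborel D"
    proof -
      have "nrm2 lborel (\<lambda>x. indicator {0<..<1::real} x *\<^sub>R (I x *\<^sub>R conv R D x)) \<le> 1/2 * nrm2 lborel D"
        by (rule nrm2_indicator_le) (use cRD nrm2_nonneg[of lborel D] in \<open>auto simp: I_def indicator_def\<close>)
      moreover have "v = (\<lambda>x. indicator {0<..<1::real} x *\<^sub>R (I x *\<^sub>R conv R D x))"
        unfolding v_def[abs_def] by (subst I) simp
      ultimately show ?thesis by simp
    qed
    have nw: "nrm2 lborel w \<le> M * h"
    proof -
      have "nrm2 lborel w \<le> nrm2 lborel R * (LINT t|lborel. norm (B t))"
        using nrm2_mono[OF Y(1) wm wb] Y(2) by simp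
      also have "\<dots> \<le> 1/2 * (2 * h * M)"
        by (intro mult_mono nR Bi(2)) (simp_all add: nrm2_nonneg)
      finally show ?thesis by (simp add: mult.commute)
    qed
    have "nrm2 lborel D \<le> nrm2 lborel u + nrm2 lborel v + nrm2 lborel w"
      unfolding D using nrm2_triangle_diff[OF sqint_diff[OF su sv] sw] nrm2_triangle_diff[OF su sv] by simp
    then have "nrm2 lborel D \<le> L * h + 1/2 * nrm2 lborel D + M * h" using nu nv nw by linarith
    then show ?thesis unfolding D_def[symmetric] by (simp add: algebra_simps)
  qed
  then show ?thesis by blast
qed

end

section \<open>Vanishing of odd null functions\<close>

context
  fixes G :: "real \<Rightarrow> complex^'r"
  assumes cont: "continuous_on UNIV G" and supp: "\<And>x. x \<notin> {0<..<1} \<Longrightarrow> G x = 0"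
begin

lemma integrable_inner_continuous:
  assumes f: "continuous_on UNIV f"
  shows "integrable lborel (\<lambda>x. G x \<bullet> f x)"
proof -
  obtain B where B: "\<forall>x\<in>{0..1}. norm (f x) \<le> B"
    using continuous_on_Icc_bound[where a = 0 and b = 1, OF continuous_on_subset[OF f subset_UNIV]] by blast
  have "sqint lborel (\<lambda>x. indicator {0<..<1} x *\<^sub>R f x)"
    by (rule sqint_indicator_bounded[of _ _ _ B]) (use B in \<open>auto intro: borel_measurable_continuous_onI[OF f]\<close>)
  from sqint_inner_integrable[OF sqint_supported[OF cont supp] this]
  have "integrable lborel (\<lambda>x. G x \<bullet> (indicator {0<..<1} x *\<^sub>R f x))" .
  moreover have "G x \<bullet> (indicator {0<..<1} x *\<^sub>R f x) = G x \<bullet> f x" for x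
    using supp[of x] by (cases "x \<in> {0<..<1}") auto
  ultimately show ?thesis by (simp only:)
qed

text \<open>The primitive of an odd function is symmetric, and its increments are \<open>h\<close> times the function up to \<open>o(h)\<close>.\<close>

lemma symmetric_primitive:
  assumes odd: "\<And>x. G (1 - x) = - G x"
  obtains psi where "continuous_on UNIV psi" "\<And>x. x \<in> {0<..<1} \<Longrightarrow> psi (1 - x) = psi x"
    "\<And>x h e. x \<in> {0<..<1} \<Longrightarrow> 0 < h \<Longrightarrow> h < 1 \<Longrightarrow> (\<And>y. y \<in> {x - h..x} \<Longrightarrow> norm (G y - G x) \<le> e) \<Longrightarrow>
      norm (psi x - psi (x - h) - h *\<^sub>R G x) \<le> e * h"
proof -
  define P where "P x = integral {-1..x} G" for x
  define cl where "cl x = max (-1) (min 2 (x::real))" for x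
  define psi where "psi x = P (cl x)" for x
  have Gc: "continuous_on A G" for A by (rule continuous_on_subset[OF cont]) simp
  have deriv: "(P has_vector_derivative G x) (at x within {-1..2})" if "x \<in> {-1..2}" for x
    unfolding P_def by (rule integral_has_vector_derivative[OF Gc that])
  have Pc: "continuous_on {-1..2} P"
    unfolding continuous_on_eq_continuous_within using deriv has_vector_derivative_continuous by blast
  have psic: "continuous_on UNIV psi"
    unfolding psi_def
    by (rule continuous_on_compose2[OF Pc]) (auto simp: cl_def intro!: continuous_intros)
  have psi: "psi x = P x" if "x \<in> {-1..2}" for x using that by (simp add: psi_def cl_def)
  have sym: "P (1 - x) = P x" if "x \<in> {0<..<1}" for x
  proof -
    have "((\<lambda>x. P (1 - x) - P x) has_vector_derivative 0) (at x within {0..1})" if x: "x \<in> {0..1}" for x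
    proof -
      have im: "(\<lambda>x. 1 - x) ` {0..1::real} \<subseteq> {-1..2}" by auto
      have "((\<lambda>x. 1 - x) has_vector_derivative (-1::real)) (at x within {0..1})"
        by (auto intro!: derivative_eq_intros)
      moreover have "(P has_vector_derivative G (1 - x)) (at (1 - x) within (\<lambda>x. 1 - x) ` {0..1})"
        by (rule has_vector_derivative_within_subset[OF deriv im]) (use x in auto)
      ultimately have "((P \<circ> (\<lambda>x. 1 - x)) has_vector_derivative ((-1) *\<^sub>R G (1 - x))) (at x within {0..1})"
        by (rule vector_diff_chain_within)
      then have "((\<lambda>x. P (1 - x)) has_vector_derivative G x) (at x within {0..1})"
        by (simp add: o_def odd)
      moreover have "(P has_vector_derivative G x) (at x within {0..1})"
        by (rule has_vector_derivative_within_subset[OF deriv]) (use x in auto)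
      ultimately show ?thesis
        using has_vector_derivative_diff by fastforce
    qed
    then obtain c where c: "\<And>x. x \<in> {0..1} \<Longrightarrow> P (1 - x) - P x = c"
      using has_vector_derivative_zero_constant[of "{0..1::real}" "\<lambda>x. P (1 - x) - P x"] by auto
    from c[of "1/2"] c[of x] that show ?thesis by simp
  qed
  have incr: "norm (psi x - psi (x - h) - h *\<^sub>R G x) \<le> e * h"
    if x: "x \<in> {0<..<1}" and h: "0 < h" "h < 1" and e: "\<And>y. y \<in> {x - h..x} \<Longrightarrow> norm (G y - G x) \<le> e" for x h e
  proof -
    have i: "G integrable_on {a..b}" for a b by (rule integrable_continuous_real[OF Gc])
    have "P (x - h) + integral {x - h..x} G = P x"
      unfolding P_def by (rule Henstock_Kurzweil_Integration.integral_combine[OF _ _ i]) (use x h in auto)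
    then have "psi x - psi (x - h) - h *\<^sub>R G x = integral {x - h..x} G - integral {x - h..x} (\<lambda>_. G x)"
      using psi[of x] psi[of "x - h"] x h by (simp add: algebra_simps)
    also have "\<dots> = integral {x - h..x} (\<lambda>y. G y - G x)"
      by (rule Henstock_Kurzweil_Integration.integral_diff[symmetric, OF i]) auto
    finally have I: "psi x - psi (x - h) - h *\<^sub>R G x = integral {x - h..x} (\<lambda>y. G y - G x)" .
    have "norm (integral {x - h..x} (\<lambda>y. G y - G x)) \<le> e * (x - (x - h))"
      by (rule integral_bound) (use e h in \<open>auto intro!: continuous_on_diff Gc continuous_on_const\<close>)
    then show ?thesis unfolding I by simp
  qed
  show ?thesis
  proof (rule that[OF psic _ incr])
    show "psi (1 - x) = psi x" if "x \<in> {0<..<1}" for x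
      using sym[OF that] psi[of x] psi[of "1 - x"] that by simp
  qed auto
qed

text \<open>
  The primitive \<open>psi\<close> is approximated by a combination \<open>phi\<close> of the complete system. The differences
  of \<open>G\<close> are orthogonal to \<open>phi\<close>, whereas against \<open>psi\<close> they give \<open>-h\<close> times the square norm
  of \<open>G\<close>, up to \<open>o(h)\<close>.
\<close>

lemma odd_annihilated_eq_0:
  fixes alpha :: "nat \<Rightarrow> complex^'r^'r"
  assumes psd: "\<And>j. alpha j \<in> psd" and compl: "complete_in_L2 (cos_system lam alpha)"
    and odd: "\<And>x. G (1 - x) = - G x" and ann: "annihilated lam alpha G"
    and C: "\<And>h. 0 < h \<Longrightarrow> h < 1 \<Longrightarrow> nrm2 lborel (diff_inner G h) \<le> C * h"
  shows "AE x in lborel. G x = 0"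
proof -
  note Gm [measurable] = supported_measurable[OF cont]
  have sG: "sqint lborel G" by (rule sqint_supported[OF cont supp])
  have gi: "integrable lborel G" by (rule sqint_supported_integrable[OF sG supp])
  obtain psi where psic: "continuous_on UNIV psi" and sym: "\<And>x. x \<in> {0<..<1} \<Longrightarrow> psi (1 - x) = psi x"
    and incr: "\<And>x h e. x \<in> {0<..<1} \<Longrightarrow> 0 < h \<Longrightarrow> h < 1 \<Longrightarrow> (\<And>y. y \<in> {x - h..x} \<Longrightarrow> norm (G y - G x) \<le> e) \<Longrightarrow>
      norm (psi x - psi (x - h) - h *\<^sub>R G x) \<le> e * h"
    using symmetric_primitive[OF odd] by metis
  define I2 where "I2 = (nrm2 lborel G)\<^sup>2"
  define m where "m = (LINT x|lborel. norm (G x))"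
  have m0: "m \<ge> 0" by (simp add: m_def)
  have C0: "C \<ge> 0" using C[of "1/2"] nrm2_nonneg[of lborel "diff_inner G (1/2)"] by simp
  have main: "I2 \<le> C * e" if e: "e > 0" for e
  proof -
    obtain phi where phi: "phi \<in> complex_span (cos_system lam alpha)"
      and d: "nrm2 lborel (\<lambda>x. indicator {0<..<1} x *\<^sub>R (psi x - phi (2 * x - 1))) < e"
      using symmetric_approximation[OF compl psic sym e] by blast
    have phic: "continuous_on UNIV (\<lambda>x. phi (2 * x - s))" for s
      by (rule continuous_on_compose2[OF continuous_on_complex_span_cos_system[OF phi]]) (auto intro!: continuous_intros)
    define Z where "Z x = psi x - phi (2 * x - 1)" for x
    have Zc: "continuous_on UNIV Z" unfolding Z_def by (intro continuous_on_diff psic phic)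
    have [measurable]: "Z \<in> borel_measurable borel" by (rule borel_measurable_continuous_onI[OF Zc])
    obtain R where R: "\<forall>x\<in>{-1..1}. norm (Z x) \<le> R"
      using continuous_on_Icc_bound[where a = "-1" and b = 1, OF continuous_on_subset[OF Zc subset_UNIV]] by blast
    have R0: "R \<ge> 0" using order_trans[OF norm_ge_zero, of "Z 0" R] R by auto
    define Z1 where "Z1 x = indicator {0<..<1::real} x *\<^sub>R Z x" for x
    have sZ: "sqint lborel Z1" unfolding Z1_def[abs_def]
      by (rule sqint_indicator_bounded[of _ _ _ R]) (use R in auto)
    have nZ: "nrm2 lborel Z1 \<le> e" using d by (simp add: Z1_def[abs_def] Z_def)
    have step: "I2 \<le> C * e + eta * (m + 2 * R)" if eta: "eta > 0" for eta
    proof -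
      have "uniformly_continuous_on {-1..2} G"
        by (rule compact_uniformly_continuous) (auto intro: continuous_on_subset[OF cont])
      then obtain dl where dl: "dl > 0" "\<And>x y. x \<in> {-1..2} \<Longrightarrow> y \<in> {-1..2} \<Longrightarrow> dist y x < dl \<Longrightarrow> dist (G y) (G x) < eta"
        using eta unfolding uniformly_continuous_on_def by blast
      define h where "h = min dl (1/2) / 2"
      have h: "0 < h" "h < 1" "h < dl" "h < 1/2" using dl(1) by (auto simp: h_def)
      have near: "norm (G y - G x) \<le> eta" if "x \<in> {-1..2}" "y \<in> {-1..2}" "\<bar>y - x\<bar> \<le> h" for x y
        using dl(2)[OF that(1,2)] that(3) h(3) by (simp add: dist_norm dist_real_def less_imp_le)
      define D where "D = diff_inner G h"
      define B where "B = diff_boundary G h"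
      have sq: "sqint lborel (\<lambda>x. G (x + h))" "sqint lborel D" "sqint lborel B"
        unfolding D_def B_def using sqint_diff_parts[OF cont supp h(1,2)] by blast+
      have G01: "G 0 = 0" "G 1 = 0" using supp by auto
      have bd: "norm (G x) \<le> eta" if "x \<in> {0..h} \<union> {1 - h..1}" for x
        using that near[of 0 x] near[of 1 x] h G01 by auto
      have Bi: "integrable lborel B" "(LINT x|lborel. norm (B x)) \<le> 2 * h * eta"
        unfolding B_def using diff_boundary_integral[OF cont supp h(1,2) bd] by blast+
      have Bsupp: "norm (B x) = 0" if "x \<notin> {-1..1}" for x
        using norm_diff_boundary_le[OF cont supp h(1,2) bd, of x] that h by (auto simp: B_def indicator_def split: if_splits)
      have BZ: "norm (B x \<bullet> Z x) \<le> norm (B x) * R" for x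
      proof (cases "x \<in> {-1..1}")
        case True
        then have "norm (B x) * norm (Z x) \<le> norm (B x) * R" using R by (intro mult_left_mono) auto
        then show ?thesis using Cauchy_Schwarz_ineq2[of "B x" "Z x"] by simp
      qed (use Bsupp[of x] in simp)
      have [measurable]: "B \<in> borel_measurable borel" using sqintD(1)[OF sq(3)] by simp
      have iBZ: "integrable lborel (\<lambda>x. B x \<bullet> Z x)"
        by (rule Bochner_Integration.integrable_bound[of _ "\<lambda>x. norm (B x) * R"])
          (use Bi(1) BZ R0 in \<open>auto simp: abs_mult\<close>)
      have DB: "G (x + h) - G x = D x + B x" for x by (simp add: D_def B_def diff_boundary_def)
      have psih: "continuous_on UNIV (\<lambda>x. psi (x - h))"
        by (rule continuous_on_compose2[OF psic]) (auto intro!: continuous_intros)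
      note i1 = integrable_inner_continuous[OF psih]
      note i2 = integrable_inner_continuous[OF psic]
      have t: "integrable lborel (\<lambda>x. G (x + h) \<bullet> f x)" "(LINT x|lborel. G (x + h) \<bullet> f x) = (LINT x|lborel. G x \<bullet> f (x - h))"
        if "integrable lborel (\<lambda>x. G x \<bullet> f (x - h))" for f
        using lborel_integrable_real_affine[OF that, of 1 h] lborel_integral_real_affine[of 1 "\<lambda>x. G x \<bullet> f (x - h)" h]
        by (simp_all add: add.commute)
      define A where "A = (LINT x|lborel. G x \<bullet> psi (x - h)) - (LINT x|lborel. G x \<bullet> psi x)"
      have iG: "integrable lborel (\<lambda>x. G x \<bullet> G x)" by (rule sqint_inner_integrable[OF sG sG])
      have "A + h * I2 = (LINT x|lborel. G x \<bullet> psi (x - h) - G x \<bullet> psi x + h * (G x \<bullet> G x))"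
        unfolding A_def I2_def nrm2_sq power2_norm_eq_inner using i1 i2 iG by simp
      also have "\<bar>\<dots>\<bar> \<le> (LINT x|lborel. norm (G x) * (eta * h))"
        unfolding real_norm_def[symmetric]
      proof (rule Bochner_Integration.integral_norm_bound_integral)
        show "integrable lborel (\<lambda>x. G x \<bullet> psi (x - h) - G x \<bullet> psi x + h * (G x \<bullet> G x))" using i1 i2 iG by simp
        show "integrable lborel (\<lambda>x. norm (G x) * (eta * h))" using gi by simp
        fix x
        show "norm (G x \<bullet> psi (x - h) - G x \<bullet> psi x + h * (G x \<bullet> G x)) \<le> norm (G x) * (eta * h)"
        proof (cases "x \<in> {0<..<1}")
          case True
          have "G x \<bullet> psi (x - h) - G x \<bullet> psi x + h * (G x \<bullet> G x) = - (G x \<bullet> (psi x - psi (x - h) - h *\<^sub>R G x))"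
            by (simp add: inner_diff_right)
          also have "norm \<dots> \<le> norm (G x) * norm (psi x - psi (x - h) - h *\<^sub>R G x)"
            using Cauchy_Schwarz_ineq2 by simp
          also have "\<dots> \<le> norm (G x) * (eta * h)"
          proof (intro mult_left_mono incr[OF True h(1,2)])
            fix y assume "y \<in> {x - h..x}"
            then show "norm (G y - G x) \<le> eta" using True h by (intro near) auto
          qed simp
          finally show ?thesis .
        qed (use supp[of x] in simp)
      qed
      also have "\<dots> = h * (eta * m)" by (simp add: m_def)
      finally have A1: "\<bar>A + h * I2\<bar> \<le> h * (eta * m)" .
      have o1: "integrable lborel (\<lambda>x. G x \<bullet> phi (2 * x - s))" "(LINT x|lborel. G x \<bullet> phi (2 * x - s)) = 0" for s
        using annihilated_orthogonal_span[OF psd gi ann phi] by blast+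
      have o2: "integrable lborel (\<lambda>x. G (x + h) \<bullet> phi (2 * x - 1))" "(LINT x|lborel. G (x + h) \<bullet> phi (2 * x - 1)) = 0"
        using t[of "\<lambda>x. phi (2 * x - 1)"] o1[of "2 * h + 1"] by (simp_all add: algebra_simps)
      have "A = (LINT x|lborel. G (x + h) \<bullet> psi x) - (LINT x|lborel. G x \<bullet> psi x)"
        unfolding A_def t(2)[OF i1] ..
      also have "\<dots> = (LINT x|lborel. (G (x + h) \<bullet> psi x - G x \<bullet> psi x) - (G (x + h) \<bullet> phi (2 * x - 1) - G x \<bullet> phi (2 * x - 1)))"
        using t(1)[OF i1] i2 o1[of 1] o2 by simp
      also have "\<dots> = (LINT x|lborel. D x \<bullet> Z1 x + B x \<bullet> Z x)"
      proof (rule Bochner_Integration.integral_cong[OF refl])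
        fix x
        have "(G (x + h) \<bullet> psi x - G x \<bullet> psi x) - (G (x + h) \<bullet> phi (2 * x - 1) - G x \<bullet> phi (2 * x - 1))
            = (G (x + h) - G x) \<bullet> Z x"
          by (simp add: Z_def inner_diff_left inner_diff_right)
        also have "\<dots> = D x \<bullet> Z x + B x \<bullet> Z x" unfolding DB by (rule inner_add_left)
        also have "D x \<bullet> Z x = D x \<bullet> Z1 x"
          using h by (auto simp: D_def diff_inner_def Z1_def indicator_def)
        finally show "(G (x + h) \<bullet> psi x - G x \<bullet> psi x) - (G (x + h) \<bullet> phi (2 * x - 1) - G x \<bullet> phi (2 * x - 1))
            = D x \<bullet> Z1 x + B x \<bullet> Z x" .
      qed
      also have "\<dots> = (LINT x|lborel. D x \<bullet> Z1 x) + (LINT x|lborel. B x \<bullet> Z x)"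
      proof (rule Bochner_Integration.integral_add)
        show "integrable lborel (\<lambda>x. D x \<bullet> Z1 x)" by (rule sqint_inner_integrable[OF sq(2) sZ])
      next
        show "integrable lborel (\<lambda>x. B x \<bullet> Z x)" by (rule iBZ)
      qed
      finally have A2: "A = (LINT x|lborel. D x \<bullet> Z1 x) + (LINT x|lborel. B x \<bullet> Z x)" .
      have A3: "\<bar>LINT x|lborel. D x \<bullet> Z1 x\<bar> \<le> (C * h) * e"
      proof -
        have "\<bar>LINT x|lborel. D x \<bullet> Z1 x\<bar> \<le> nrm2 lborel D * nrm2 lborel Z1" by (rule nrm2_inner_le[OF sq(2) sZ])
        also have "\<dots> \<le> (C * h) * e"
          using C[OF h(1,2)] nZ C0 h(1) by (intro mult_mono) (auto simp: D_def nrm2_nonneg)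
        finally show ?thesis .
      qed
      have A4: "\<bar>LINT x|lborel. B x \<bullet> Z x\<bar> \<le> (2 * h * eta) * R"
      proof -
        have "norm (LINT x|lborel. B x \<bullet> Z x) \<le> (LINT x|lborel. norm (B x) * R)"
          by (rule Bochner_Integration.integral_norm_bound_integral[OF iBZ]) (use Bi(1) BZ in auto)
        also have "\<dots> = (LINT x|lborel. norm (B x)) * R" by simp
        also have "\<dots> \<le> (2 * h * eta) * R" by (intro mult_right_mono Bi(2) R0)
        finally show ?thesis by simp
      qed
      have "h * I2 \<le> h * (eta * m) + ((C * h) * e + (2 * h * eta) * R)"
        using A1 A2 A3 A4 by linarith
      also have "\<dots> = h * (C * e + eta * (m + 2 * R))" by (simp add: algebra_simps)
      finally show ?thesis using h(1) by simp
    qed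
    show ?thesis
    proof (rule field_le_epsilon)
      fix eps :: real assume "eps > 0"
      define k where "k = m + 2 * R + 1"
      have k: "k > 0" using m0 R0 by (simp add: k_def)
      have "I2 \<le> C * e + eps / k * (m + 2 * R)" using step[of "eps / k"] \<open>eps > 0\<close> k by simp
      also have "\<dots> \<le> C * e + eps / k * k" using \<open>eps > 0\<close> k by (intro add_left_mono mult_left_mono) (auto simp: k_def)
      finally show "I2 \<le> C * e + eps" using k by simp
    qed
  qed
  have "I2 \<le> 0"
  proof (rule field_le_epsilon)
    fix eps :: real assume "eps > 0"
    have "I2 \<le> C * (eps / (C + 1))" using main[of "eps / (C + 1)"] \<open>eps > 0\<close> C0 by simp
    also have "\<dots> \<le> eps" using \<open>eps > 0\<close> C0 by (simp add: field_simps)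
    finally show "I2 \<le> 0 + eps" by simp
  qed
  then have "nrm2 lborel G = 0" by (simp add: I2_def)
  then show ?thesis by (rule nrm2_eq_0_AE[OF sG])
qed

end

lemma (in point_mass_kernel) form_null_eq_0:
  assumes compl: "complete_in_L2 (cos_system lam alpha)"
    and g: "sqint lborel g" and supp: "\<And>x. x \<notin> {0<..<1} \<Longrightarrow> g x = 0"
    and form0: "(LINT x|lborel. g x \<bullet> (g x + conv H g x)) = 0"
  shows "AE x in lborel. g x = 0"
proof -
  obtain G where G: "continuous_on UNIV G" "\<And>x. x \<notin> {0<..<1} \<Longrightarrow> G x = 0"
    "\<And>x. x \<in> {0..1} \<Longrightarrow> G x = - conv H G x" "\<And>x. G (1 - x) = - G x"
    "annihilated lam alpha G" "AE x in lborel. g x = G x"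
    using continuous_odd_representative[OF assms] by blast
  obtain C where "\<And>h. 0 < h \<Longrightarrow> h < 1 \<Longrightarrow> nrm2 lborel (diff_inner G h) \<le> C * h"
    using difference_quotient_bound[OF G(1,2,3,5)] by blast
  from odd_annihilated_eq_0[OF G(1,2) psd compl G(4,5) this]
  have "AE x in lborel. G x = 0" .
  with G(6) show ?thesis by eventually_elim simp
qed

section \<open>The accelerant\<close>

lemma upto_ix_exhaust: "\<exists>N. \<forall>n\<ge>N. j \<in> upto_ix lam n"
proof -
  obtain N where N: "lam j \<le> real N" using real_arch_simple by blast
  have "lam j \<le> pi * (real n + 1/2)" if "n \<ge> N" for n
  proof -
    have "real N \<le> 1 * (real n + 1/2)" using that by simp
    also have "\<dots> \<le> pi * (real n + 1/2)" using pi_gt3 by (intro mult_right_mono) auto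
    finally show ?thesis using N by simp
  qed
  then show ?thesis by (auto simp: upto_ix_def)
qed

text \<open>
  Passage from the accelerant equation on \<open>(0, a)\<close> to the form on \<open>(0, 1)\<close>: the solution cut off
  at \<open>a\<close> is a null function of the form, since the equation holds wherever it is nonzero.
\<close>

lemma accelerant_equation_trivial:
  fixes lam :: "nat \<Rightarrow> real" and alpha :: "nat \<Rightarrow> complex^'r^'r"
  assumes psd: "\<And>j. alpha j \<in> psd" and fin: "\<And>n. finite (upto_ix lam n)"
    and compl: "complete_in_L2 (cos_system lam alpha)"
    and H: "sqint (lebesgue_on {-1<..<1}) H"
    and lim: "(\<lambda>n. nrm2 (lebesgue_on {-1<..<1}) (\<lambda>x. kern lam alpha (upto_ix lam n) n x - H x)) \<longlonglongrightarrow> 0"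
    and a: "a \<in> {0..1}" and f: "sqint (lebesgue_on {0<..<1}) f"
    and eq: "AE x in lebesgue_on {0<..<1}. f x + (LINT t|lebesgue_on {0<..<a}. H (x - t) *v f t) = 0"
  shows "AE x in lebesgue_on {0<..<1}. f x = 0"
proof -
  obtain H' where H'm [measurable]: "H' \<in> borel_measurable borel" and H'0: "\<And>x. x \<notin> {-1<..<1} \<Longrightarrow> H' x = 0"
    and H'eq: "AE x in lborel. x \<in> {-1<..<1} \<longrightarrow> H' x = H x"
    using borel_representative[OF sqintD(1)[OF H]] by auto
  have sH': "sqint lborel H'"
    using sqint_representative(1)[OF sqintD(1)[OF H] _ H'm H'0 H'eq] H by simp
  obtain f' where f'm [measurable]: "f' \<in> borel_measurable borel" and f'0: "\<And>x. x \<notin> {0<..<1} \<Longrightarrow> f' x = 0"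
    and f'eq: "AE x in lborel. x \<in> {0<..<1} \<longrightarrow> f' x = f x"
    using borel_representative[OF sqintD(1)[OF f]] by auto
  have sf': "sqint lborel f'"
    using sqint_representative(1)[OF sqintD(1)[OF f] _ f'm f'0 f'eq] f by simp
  define J where "J = upto_ix lam"
  have nk: "nrm2 (lebesgue_on {-1<..<1}) (\<lambda>x. kern lam alpha (J n) n x - H x)
      = nrm2 lborel (\<lambda>x. kern_cut lam alpha (J n) n x - H' x)" for n
  proof (rule sqint_representative(2))
    show "(\<lambda>x. kern lam alpha (J n) n x - H x) \<in> borel_measurable (lebesgue_on {-1<..<1})"
      by (intro borel_measurable_diff sqintD(1)[OF H] sqintD(1)[OF sqint_kern])
    show "kern_cut lam alpha (J n) n x - H' x = 0" if "x \<notin> {-1<..<1}" for x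
      using that H'0 by (simp add: kern_cut_def)
    show "AE x in lborel. x \<in> {-1<..<1} \<longrightarrow> kern_cut lam alpha (J n) n x - H' x = kern lam alpha (J n) n x - H x"
      using H'eq by eventually_elim (auto simp: kern_cut_def)
  qed auto
  interpret point_mass_kernel lam alpha J H'
  proof
    show "\<exists>N. \<forall>n\<ge>N. j \<in> J n" for j unfolding J_def by (rule upto_ix_exhaust)
    show "(\<lambda>n. nrm2 lborel (\<lambda>x. kern_cut lam alpha (J n) n x - H' x)) \<longlonglongrightarrow> 0"
      using lim unfolding J_def nk[unfolded J_def] .
  qed (use psd fin sH' in \<open>auto simp: J_def\<close>)
  define g where "g x = indicator {0<..<a} x *\<^sub>R f' x" for x
  have gm [measurable]: "g \<in> borel_measurable borel" unfolding g_def[abs_def] by measurable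
  have sg: "sqint lborel g"
    by (rule sqint_bound[OF sf']) (auto simp: g_def indicator_def)
  have g0: "g x = 0" if "x \<notin> {0<..<1}" for x
    using that a by (auto simp: g_def indicator_def)
  have cv: "(LINT t|lebesgue_on {0<..<a}. H (x - t) *v f t) = conv H' g x" if x: "x \<in> {0<..<1}" for x
  proof -
    have mm [measurable]: "(\<lambda>t. H' (x - t) *v g t) \<in> borel_measurable borel" by measurable
    have "AE t in lborel. x + (-1) * t \<in> {-1<..<1} \<longrightarrow> H' (x + (-1) * t) = H (x + (-1) * t)"
      by (rule AE_lborel_affine[OF H'eq]) simp
    then have ae: "AE t in lborel. t \<in> {0<..<a} \<longrightarrow> H' (x - t) *v g t = H (x - t) *v f t"
      using f'eq by eventually_elim (use x a in \<open>auto simp: g_def\<close>)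
    have "(LINT t|lebesgue_on {0<..<a}. H (x - t) *v f t) = (LINT t|lborel. H' (x - t) *v g t)"
    proof (rule integral_lebesgue_on_representative(1)[OF _ _ mm _ ae])
      show "(\<lambda>t. H (x - t) *v f t) \<in> borel_measurable (lebesgue_on {0<..<a})"
        by (rule borel_measurable_lebesgue_on_AE[OF _ mm ae]) simp
    qed (auto simp: g_def)
    then show ?thesis by (simp add: conv_def)
  qed
  have eq': "AE x in lborel. x \<in> {0<..<1} \<longrightarrow> f x + conv H' g x = 0"
  proof -
    have "AE x in lborel. x \<in> {0<..<1} \<longrightarrow> f x + (LINT t|lebesgue_on {0<..<a}. H (x - t) *v f t) = 0"
      using eq by (subst (asm) AE_lebesgue_on_iff) auto
    then show ?thesis by eventually_elim (simp add: cv)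
  qed
  have "AE x in lborel. g x \<bullet> (g x + conv H' g x) = 0"
    using eq' f'eq
  proof eventually_elim
    case (elim x)
    then show ?case using a by (cases "x \<in> {0<..<a}") (auto simp: g_def)
  qed
  then have "(LINT x|lborel. g x \<bullet> (g x + conv H' g x)) = 0" by (rule integral_eq_zero_AE)
  from form_null_eq_0[OF compl sg g0 this] have gz: "AE x in lborel. g x = 0" by blast
  have "conv H' g x = 0" for x
    unfolding conv_def
  proof (rule integral_eq_zero_AE)
    show "AE t in lborel. H' (x - t) *v g t = 0"
      using gz by eventually_elim (simp add: mv.zero_right)
  qed
  then have "AE x in lborel. x \<in> {0<..<1} \<longrightarrow> f x = 0" using eq' by simp
  then show ?thesis by (subst AE_lebesgue_on_iff) auto
qed

theorem theorem1p6:
  fixes lam :: "nat \<Rightarrow> real" and alpha :: "nat \<Rightarrow> complex^'r^'r"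
  assumes lam_mono: "strict_mono lam"
    and lam_nonneg: "\<And>j. 0 \<le> lam j"
    and alpha_psd: "\<And>j. alpha j \<in> psd"
    and alpha_nz: "\<And>j. alpha j \<noteq> 0"
    and A1_lam: "summable (\<lambda>n. \<Sum>j | lam j \<in> Delta (Suc n). \<bar>lam j - pi * real (Suc n)\<bar>\<^sup>2)"
    and A1_card: "\<exists>C. \<forall>n\<ge>1. finite {j. lam j \<in> Delta n} \<and> card {j. lam j \<in> Delta n} \<le> C"
    and A1_alpha: "summable (\<lambda>n. (op_norm (mat 1 - (\<Sum>j | lam j \<in> Delta (Suc n). alpha j)))\<^sup>2)"
  shows "(\<exists>H. L2_limit op_norm {-1<..<1} (H_partial lam alpha) H) \<and>
         (complete_in_L2 (cos_system lam alpha) \<longrightarrow>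
            (\<forall>H. L2_limit op_norm {-1<..<1} (H_partial lam alpha) H \<longrightarrow> H \<in> Re_accelerants))"
proof -
  define M where "M = lebesgue_on {-1<..<1::real}"
  obtain c0 where c0: "\<And>n. n \<ge> 1 \<Longrightarrow> finite {j. lam j \<in> Delta n} \<and> card {j. lam j \<in> Delta n} \<le> c0"
    using A1_card by blast
  have inj: "inj lam" using lam_mono by (rule strict_mono_imp_inj_on)
  have fin: "finite (upto_ix lam n)" for n
    by (rule finite_upto_ix[OF inj lam_nonneg]) (use c0 in blast)
  have Hp: "H_partial lam alpha n = kern lam alpha (upto_ix lam n) n" for n
    by (rule ext) (rule H_partial_eq_kern[OF fin lam_nonneg])
  have lim_iff: "L2_limit op_norm {-1<..<1} (H_partial lam alpha) H \<longleftrightarrow>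
      sqint M H \<and> (\<lambda>n. nrm2 M (\<lambda>x. kern lam alpha (upto_ix lam n) n x - H x)) \<longlonglongrightarrow> 0" for H
    unfolding L2_limit_op_norm_iff Hp M_def by (simp add: sqint_kern)
  have ex: "\<exists>H. L2_limit op_norm {-1<..<1} (H_partial lam alpha) H"
    unfolding lim_iff unfolding M_def
    by (rule finite_measure.sqint_complete[OF finite_measure_lebesgue_on_Ioo sqint_kern
          kern_L2_Cauchy[OF alpha_psd inj lam_nonneg A1_lam c0 A1_alpha]])
  have "H \<in> Re_accelerants"
    if compl: "complete_in_L2 (cos_system lam alpha)"
      and L: "L2_limit op_norm {-1<..<1} (H_partial lam alpha) H" for H
  proof -
    have H: "sqint (lebesgue_on {-1<..<1}) H"
      and lim: "(\<lambda>n. nrm2 (lebesgue_on {-1<..<1}) (\<lambda>x. kern lam alpha (upto_ix lam n) n x - H x)) \<longlonglongrightarrow> 0"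
      using L unfolding lim_iff M_def by auto
    have "AE x in lebesgue_on {-1<..<1}. H (- x) = H x"
      by (rule even_limit[OF sqint_kern H lim kern_even])
    moreover have "AE x in lebesgue_on {-1<..<1}. H x = adj (H x)"
      by (rule adj_limit[OF sqint_kern H lim adj_kern[OF alpha_psd]])
    moreover have "AE x in lebesgue_on {0<..<1}. f x = 0"
      if "a \<in> {0..1}" "f \<in> L2 norm {0<..<1}"
        "AE x in lebesgue_on {0<..<1}. f x + (LINT t|lebesgue_on {0<..<a}. H (x - t) *v f t) = 0" for a f
      by (rule accelerant_equation_trivial[OF alpha_psd fin compl H lim that(1) _ that(3)])
        (use that(2) in \<open>simp add: L2_def sqint_def\<close>)
    ultimately show ?thesis
      using H unfolding Re_accelerants_def accelerants_def by (auto simp: L2_op_norm_iff)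
  qed
  with ex show ?thesis by blast
qed

end
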